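(* Let $n\ge1$, let $\theta=(\theta_{jk})$ be a real skew-symmetric $n\times n$ matrix, and let $A=\mathcal{O}(SO_\theta(2n+1))$, $H=\mathcal{O}(SO_\theta(2n))$, $B=\mathcal{O}(S^{2n}_\theta)=A^{\mathrm{co}H}$. Then the flip $S_{\mathcal{C}}(x\otimes y)=y\otimes x$ is the antipode of the Ehresmann--Schauenburg bialgebroid $\mathcal{C}(A,H)$ of the Hopf--Galois extension $B\subseteq A$; that is, it is an invertible antipode making $\mathcal{C}(A,H)$ a Hopf algebroid over $B$.
   Context: All algebras are over $\mathbb{C}$ and $\otimes=\otimes_{\mathbb{C}}$. The algebra $\mathcal{O}(SO_\theta(2n+1))$. Put $Q=\begin{pmatrix}0&\mathbb{I}_n&0\\\mathbb{I}_n&0&0\\0&0&1\end{pmatrix}$. The commutative $*$-Hopf algebra $\mathcal{O}(SO(2n+1))$ is generated by the entries of a $(2n+1)\times(2n+1)$ matrix $N=(N_{JK})$ with relations $N^tQN=Q=NQN^t$, $\det N=1$, $*$-structure $(N_{JK})^*=(QNQ)_{JK}$, $\Delta(N_{JK})=\sum_LN_{JL}\otimes N_{LK}$, $\varepsilon(N_{JK})=\delta_{JK}$, antipode $S(N)=QN^tQ=N^\dagger$, where $(M^\dagger)_{JK}=(M_{KJ})^*$. It is bigraded by $\mathbb{Z}^n\times\mathbb{Z}^n$ through $\deg N_{JK}=(w_J,w_K)$, where $w_j=e_j$, $w_{n+j}=-e_j$ ($1\le j\le n$), $w_{2n+1}=0$, with $e_j$ the standard basis of $\mathbb{Z}^n$.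 $A=\mathcal{O}(SO_\theta(2n+1))$ is the same coalgebra with the same counit, antipode and $*$-structure, and with product on homogeneous elements $x,y$ of bidegrees $(r_1,r_2),(l_1,l_2)$ deformed to $\lambda_\theta(r_1,l_1)\lambda_\theta(r_2,l_2)^{-1}xy$, where $\lambda_\theta(r,l)=e^{\pi i\sum_{j,k}\theta_{jk}r_jl_k}$. Equivalently, the generators satisfy $N_{IJ}N_{KL}=\lambda_{IK}\lambda_{LJ}N_{KL}N_{IJ}$ with $\lambda_{IK}=\lambda_\theta(w_I,w_K)^2$, together with $N^\dagger N=NN^\dagger=\mathbb{I}$ and the deformed determinant condition. $H=\mathcal{O}(SO_\theta(2n))$ is defined in the same way with $2n\times2n$ generating matrix $\mathbf{w}$, $Q=\begin{pmatrix}0&\mathbb{I}_n\\\mathbb{I}_n&0\end{pmatrix}$ and weights $w_1,\dots,w_{2n}$. The extension. There is a surjective Hopf algebra map $\pi:A\to H$ with $\pi(N)=\begin{pmatrix}\mathbf{w}&0\\0&1\end{pmatrix}$, giving the right coaction $\delta^A=(\mathrm{id}\otimes\pi)\Delta:A\to A\otimes H$, $\delta^A(a)=a_{(0)}\otimes a_{(1)}$. Its coinvariant subalgebra $B=\mathcal{O}(S^{2n}_\theta)=\{b:\delta^A(b)=b\otimes1\}$ is generated by the last column of $N$, and $B\subseteq A$ is a (faithfully flat) Hopf--Galois extension: $\chi:A\otimes_BA\to A\otimes H$, $\tilde a\otimes_Ba\mapsto\tilde aa_{(0)}\otimes a_{(1)}$, is bijective. With $\Phi$ the matrix formed by the first $2n$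 columns of $N$, its translation map $\tau(h)=\chi^{-1}(1\otimes h)=h^{\langle1\rangle}\otimes_Bh^{\langle2\rangle}$ satisfies $\tau(\mathbf{w}_{rs})=\sum_J(\Phi^\dagger)_{rJ}\otimes_B\Phi_{Js}$. $\mathcal{C}(A,H)=(A\otimes A)^{\mathrm{co}H}$ is the space of coinvariants of the diagonal coaction $a\otimes\tilde a\mapsto a_{(0)}\otimes\tilde a_{(0)}\otimes a_{(1)}\tilde a_{(1)}$, a left $B$-bialgebroid with product $(x\otimes\tilde x)(y\otimes\tilde y)=xy\otimes\tilde y\tilde x$, unit $1\otimes1$, source $s(b)=b\otimes1$, target $t(b)=1\otimes b$, $B$-bimodule structure $b\triangleright x\triangleleft\tilde b=s(b)t(\tilde b)x$, coproduct $\Delta(a\otimes\tilde a)=a_{(0)}\otimes a_{(1)}{}^{\langle1\rangle}\otimes_Ba_{(1)}{}^{\langle2\rangle}\otimes\tilde a$, and counit $\varepsilon(a\otimes\tilde a)=a\tilde a$. The flip maps $\mathcal{C}(A,H)$ to itself. Invertible antipode of a left $B$-bialgebroid $\mathcal{L}$: an invertible algebra anti-homomorphism $S:\mathcal{L}\to\mathcal{L}$ such that $S\circ t=s$ and, for all $h\in\mathcal{L}$, $$(S^{-1}h_{(2)})_{(1')}\otimes_B(S^{-1}h_{(2)})_{(2')}h_{(1)}=S^{-1}h\otimes_B1,\qquad(Sh_{(1)})_{(1')}h_{(2)}\otimes_B(Sh_{(1)})_{(2')}=1\otimes_BSh,$$ where $\Delta(h)=h_{(1)}\otimes_Bh_{(2)}$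 and primed indices denote a further application of $\Delta$. A Hopf algebroid is a left bialgebroid with such an antipode. *)

theory Defs
  imports "HOL-Analysis.Analysis" "HOL-Library.Poly_Mapping"
begin

section \<open>Complex vector spaces\<close>

class cvec = ab_group_add +
  fixes scaleC :: "complex \<Rightarrow> 'a \<Rightarrow> 'a"  (infixr \<open>*\<^sub>C\<close> 75)
  assumes scaleC_add_right: "c *\<^sub>C (x + y) = c *\<^sub>C x + c *\<^sub>C y"
    and scaleC_add_left: "(c + d) *\<^sub>C x = c *\<^sub>C x + d *\<^sub>C x"
    and scaleC_scaleC: "c *\<^sub>C d *\<^sub>C x = (c * d) *\<^sub>C x"
    and scaleC_one: "1 *\<^sub>C x = x"

global_interpretation cvec: vector_space "scaleC :: complex \<Rightarrow> 'a \<Rightarrow> 'a :: cvec"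
  by unfold_locales (simp_all add: scaleC_add_right scaleC_add_left scaleC_scaleC scaleC_one)

abbreviation clinear :: "('a::cvec \<Rightarrow> 'b::cvec) \<Rightarrow> bool"
  where "clinear \<equiv> Vector_Spaces.linear scaleC scaleC"

definition cbilinear :: "('a::cvec \<Rightarrow> 'b::cvec \<Rightarrow> 'c::cvec) \<Rightarrow> bool"
  where "cbilinear f \<longleftrightarrow> (\<forall>x. clinear (f x)) \<and> (\<forall>y. clinear (\<lambda>x. f x y))"

lemma clinearI:
  "(\<And>x y. f (x + y) = f x + f y) \<Longrightarrow> (\<And>c x. f (c *\<^sub>C x) = c *\<^sub>C f x) \<Longrightarrow> clinear f"
  unfolding Vector_Spaces.linear_def module_hom_def module_hom_axioms_def
  by (simp add: cvec.vector_space_axioms cvec.module_axioms)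

lemma clinear_add: "clinear f \<Longrightarrow> f (x + y) = f x + f y"
  by (simp add: Vector_Spaces.linear_def module_hom_def module_hom_axioms_def)

lemma clinear_scale: "clinear f \<Longrightarrow> f (c *\<^sub>C x) = c *\<^sub>C f x"
  by (simp add: Vector_Spaces.linear_def module_hom_def module_hom_axioms_def)

lemma clinear_sum: "clinear f \<Longrightarrow> f (\<Sum>i\<in>I. g i) = (\<Sum>i\<in>I. f (g i))"
  using clinear_scale[of f 0 0]
  by (induction I rule: infinite_finite_induct) (simp_all add: clinear_add)

instantiation complex :: cvec
begin
definition scaleC_complex :: "complex \<Rightarrow> complex \<Rightarrow> complex" where "scaleC_complex = (*)"
instance by standard (simp_all add: scaleC_complex_def algebra_simps)
end

instantiation poly_mapping :: (type, cvec) cvec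
begin
lift_definition scaleC_poly_mapping :: "complex \<Rightarrow> ('a \<Rightarrow>\<^sub>0 'b) \<Rightarrow> ('a \<Rightarrow>\<^sub>0 'b)"
  is "\<lambda>c f x. c *\<^sub>C f x"
proof -
  fix c and f :: "'a \<Rightarrow> 'b" assume "finite {x. f x \<noteq> 0}"
  moreover have "{x. c *\<^sub>C f x \<noteq> 0} \<subseteq> {x. f x \<noteq> 0}" by auto
  ultimately show "finite {x. c *\<^sub>C f x \<noteq> 0}" by (rule rev_finite_subset)
qed
instance
  by standard (transfer, simp add: fun_eq_iff scaleC_add_right scaleC_add_left scaleC_scaleC scaleC_one)+
end

text \<open>Class of \<open>v\<close> in the quotient by the subspace \<open>K\<close>. Quotient spaces that depend on the
  deformation parameter are subquotients of types; their elements are such cosets.\<close>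

definition coset :: "'a::cvec set \<Rightarrow> 'a \<Rightarrow> 'a set"
  where "coset K v = {v + k |k. k \<in> K}"


section \<open>Tensor products\<close>

text \<open>The tensor product over the complex numbers: the free vector space on pairs modulo the
  bilinearity relations.\<close>

definition bilinear_relations :: "('a::cvec \<times> 'b::cvec \<Rightarrow>\<^sub>0 complex) set" where
  "bilinear_relations = cvec.span (
     {Poly_Mapping.single (x + x', y) 1 - Poly_Mapping.single (x, y) 1
        - Poly_Mapping.single (x', y) 1 |x x' y. True} \<union>
     {Poly_Mapping.single (x, y + y') 1 - Poly_Mapping.single (x, y) 1
        - Poly_Mapping.single (x, y') 1 |x y y'. True} \<union>
     {Poly_Mapping.single (c *\<^sub>C x, y) 1 - Poly_Mapping.single (x, y) c |c x y. True} \<union>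
     {Poly_Mapping.single (x, c *\<^sub>C y) 1 - Poly_Mapping.single (x, y) c |c x y. True})"

lemma subspace_equivp:
  assumes "cvec.subspace K"
  shows "equivp (\<lambda>p q. p - q \<in> K)"
proof (rule equivpI)
  show "reflp (\<lambda>p q. p - q \<in> K)"
    using assms by (simp add: reflp_def cvec.subspace_0)
  show "symp (\<lambda>p q. p - q \<in> K)"
    by (rule sympI) (use cvec.subspace_neg[OF assms] in fastforce)
  show "transp (\<lambda>p q. p - q \<in> K)"
  proof (rule transpI)
    fix p q r assume "p - q \<in> K" "q - r \<in> K"
    from cvec.subspace_add[OF assms this] show "p - r \<in> K" by simp
  qed
qed

lemma bilinear_relations_subspace: "cvec.subspace bilinear_relations"
  by (simp add: bilinear_relations_def)

quotient_type (overloaded) ('a, 'b) tensor (infixr \<open>\<otimes>\<close> 70) =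
  "'a::cvec \<times> 'b::cvec \<Rightarrow>\<^sub>0 complex" / "\<lambda>p q. p - q \<in> bilinear_relations"
  by (rule subspace_equivp) (rule bilinear_relations_subspace)

instantiation tensor :: (cvec, cvec) cvec
begin
lift_definition zero_tensor :: "'a \<otimes> 'b" is 0 .
lift_definition plus_tensor :: "'a \<otimes> 'b \<Rightarrow> 'a \<otimes> 'b \<Rightarrow> 'a \<otimes> 'b" is "(+)"
  by (simp add: add_diff_add bilinear_relations_subspace cvec.subspace_add)
lift_definition minus_tensor :: "'a \<otimes> 'b \<Rightarrow> 'a \<otimes> 'b \<Rightarrow> 'a \<otimes> 'b" is "(-)"
proof -
  fix p p' q q' :: "'a \<times> 'b \<Rightarrow>\<^sub>0 complex"
  assume "p - p' \<in> bilinear_relations" "q - q' \<in> bilinear_relations"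
  from cvec.subspace_diff[OF bilinear_relations_subspace this]
  show "p - q - (p' - q') \<in> bilinear_relations" by (simp add: algebra_simps)
qed
lift_definition uminus_tensor :: "'a \<otimes> 'b \<Rightarrow> 'a \<otimes> 'b" is uminus
  by (simp only: minus_diff_minus cvec.subspace_neg bilinear_relations_subspace)
lift_definition scaleC_tensor :: "complex \<Rightarrow> 'a \<otimes> 'b \<Rightarrow> 'a \<otimes> 'b" is "(*\<^sub>C)"
  by (simp only: cvec.scale_right_diff_distrib[symmetric] cvec.subspace_scale bilinear_relations_subspace)
instance
  by standard (transfer; simp add: algebra_simps scaleC_add_right scaleC_add_left scaleC_scaleC
      scaleC_one cvec.subspace_0[OF bilinear_relations_subspace])+
end

lift_definition tensor_elem :: "'a::cvec \<Rightarrow> 'b::cvec \<Rightarrow> 'a \<otimes> 'b"  (infixr \<open>\<otimes>\<close> 70)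
  is "\<lambda>x y. Poly_Mapping.single (x, y) 1" .

text \<open>The linear map induced by a bilinear map.\<close>

definition tensor_lift :: "('a::cvec \<Rightarrow> 'b::cvec \<Rightarrow> 'c::cvec) \<Rightarrow> 'a \<otimes> 'b \<Rightarrow> 'c" where
  "tensor_lift f = (THE F. clinear F \<and> (\<forall>x y. F (x \<otimes> y) = f x y))"

lemma abs_tensor_cases: obtains p where "u = abs_tensor p"
  by (rule that[of "rep_tensor u"]) (rule Quotient3_abs_rep[OF Quotient3_tensor, symmetric])

lemma clinear_abs_tensor: "clinear abs_tensor"
  by (rule clinearI) (simp_all only: plus_tensor.abs_eq scaleC_tensor.abs_eq)

lemma abs_tensor_eq_sum:
  "abs_tensor p = (\<Sum>k\<in>Poly_Mapping.keys p. Poly_Mapping.lookup p k *\<^sub>C (fst k \<otimes> snd k))"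
proof -
  have single: "abs_tensor (Poly_Mapping.single k c) = c *\<^sub>C (fst k \<otimes> snd k)" for k :: "'a \<times> 'b" and c
  proof -
    have "c *\<^sub>C Poly_Mapping.single k 1 = Poly_Mapping.single k c"
      by (rule poly_mapping_eqI)
        (simp add: scaleC_poly_mapping.rep_eq scaleC_complex_def lookup_single when_def)
    then show ?thesis
      by (simp add: tensor_elem.abs_eq scaleC_tensor.abs_eq)
  qed
  have "abs_tensor (\<Sum>k\<in>Poly_Mapping.keys p. Poly_Mapping.single k (Poly_Mapping.lookup p k)) =
      (\<Sum>k\<in>Poly_Mapping.keys p. Poly_Mapping.lookup p k *\<^sub>C (fst k \<otimes> snd k))"
    by (simp add: single clinear_sum[OF clinear_abs_tensor])
  moreover have "(\<Sum>k\<in>Poly_Mapping.keys p. Poly_Mapping.single k (Poly_Mapping.lookup p k)) = p"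
    by (rule poly_mapping_eqI) (simp add: lookup_sum lookup_single when_def not_in_keys_iff_lookup_eq_zero)
  ultimately show ?thesis by simp
qed

lemma clinear_eqI:
  fixes F G :: "'a::cvec \<otimes> 'b::cvec \<Rightarrow> 'c::cvec"
  assumes "clinear F" "clinear G" "\<And>x y. F (x \<otimes> y) = G (x \<otimes> y)"
  shows "F = G"
proof
  fix u :: "'a \<otimes> 'b"
  obtain p where u: "u = abs_tensor p" by (rule abs_tensor_cases)
  show "F u = G u"
    unfolding u abs_tensor_eq_sum
    by (simp add: assms clinear_sum[OF assms(1)] clinear_sum[OF assms(2)]
        clinear_scale[OF assms(1)] clinear_scale[OF assms(2)])
qed

lemma tensor_lift_exists:
  assumes "cbilinear f"
  shows "\<exists>!F. clinear F \<and> (\<forall>x y. F (x \<otimes> y) = f x y)"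
proof (rule ex_ex1I)
  have f1: "clinear (f x)" and f2: "clinear (\<lambda>x. f x y)" for x y
    using assms by (auto simp: cbilinear_def)
  define G :: "('a \<times> 'b \<Rightarrow>\<^sub>0 complex) \<Rightarrow> 'c" where
    "G p = (\<Sum>k\<in>Poly_Mapping.keys p. Poly_Mapping.lookup p k *\<^sub>C f (fst k) (snd k))" for p
  have G_superset: "G p = (\<Sum>k\<in>S. Poly_Mapping.lookup p k *\<^sub>C f (fst k) (snd k))"
    if "finite S" "Poly_Mapping.keys p \<subseteq> S" for p S
    unfolding G_def by (rule sum.mono_neutral_left) (use that in \<open>auto simp: not_in_keys_iff_lookup_eq_zero\<close>)
  have G_add: "G (p + q) = G p + G q" for p q
  proof -
    let ?S = "Poly_Mapping.keys p \<union> Poly_Mapping.keys q"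
    have "Poly_Mapping.keys (p + q) \<subseteq> ?S" by (rule keys_add)
    then show ?thesis
      by (simp add: G_superset[of ?S] lookup_add scaleC_add_left sum.distrib)
  qed
  have G_scale: "G (c *\<^sub>C p) = c *\<^sub>C G p" for c p
  proof -
    have "Poly_Mapping.keys (c *\<^sub>C p) \<subseteq> Poly_Mapping.keys p"
      by (auto simp: in_keys_iff scaleC_poly_mapping.rep_eq)
    then have "G (c *\<^sub>C p) =
        (\<Sum>k\<in>Poly_Mapping.keys p. Poly_Mapping.lookup (c *\<^sub>C p) k *\<^sub>C f (fst k) (snd k))"
      by (intro G_superset) auto
    then show ?thesis
      by (simp add: G_def scaleC_poly_mapping.rep_eq scaleC_complex_def cvec.scale_sum_right scaleC_scaleC)
  qed
  have G_linear: "clinear G" by (rule clinearI) (fact G_add G_scale)+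
  have G_single: "G (Poly_Mapping.single (x, y) c) = c *\<^sub>C f x y" for x y c
    by (simp add: G_def)
  have G_diff: "G (p - q) = G p - G q" for p q
    using G_add[of "p - q" q] by simp
  have G_rel: "G p = 0" if "p \<in> bilinear_relations" for p
    using that unfolding bilinear_relations_def
  proof (induction rule: cvec.span_induct)
    show "cvec.subspace {p. G p = 0}"
      using G_diff[of 0 0] by (simp add: cvec.subspace_def G_add G_scale)
  qed (auto simp: G_diff G_single clinear_add[OF f1] clinear_scale[OF f1] scaleC_one
      clinear_add[OF f2] clinear_scale[OF f2])
  have G_rep: "G (rep_tensor (abs_tensor p)) = G p" for p
  proof -
    have "rep_tensor (abs_tensor p) - p \<in> bilinear_relations"
      by (rule Quotient3_rep_abs[OF Quotient3_tensor])
        (simp add: cvec.subspace_0 bilinear_relations_subspace)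
    from G_rel[OF this] show ?thesis by (simp add: G_diff)
  qed
  define F where "F u = G (rep_tensor u)" for u
  have "clinear F"
  proof (rule clinearI)
    show "F (u + v) = F u + F v" for u v
    proof -
      obtain p where u: "u = abs_tensor p" by (rule abs_tensor_cases)
      obtain q where v: "v = abs_tensor q" by (rule abs_tensor_cases)
      from u v show ?thesis by (simp add: F_def plus_tensor.abs_eq G_rep G_add)
    qed
    show "F (c *\<^sub>C u) = c *\<^sub>C F u" for c u
    proof -
      obtain p where "u = abs_tensor p" by (rule abs_tensor_cases)
      then show ?thesis by (simp add: F_def scaleC_tensor.abs_eq G_rep G_scale)
    qed
  qed
  moreover have "F (x \<otimes> y) = f x y" for x y
    by (simp add: F_def tensor_elem.abs_eq G_rep G_single scaleC_one)
  ultimately show "\<exists>F. clinear F \<and> (\<forall>x y. F (x \<otimes> y) = f x y)" by blast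
next
  fix F G
  assume "clinear F \<and> (\<forall>x y. F (x \<otimes> y) = f x y)" "clinear G \<and> (\<forall>x y. G (x \<otimes> y) = f x y)"
  then show "F = G" by (intro clinear_eqI) simp_all
qed

lemma clinear_tensor_lift: "cbilinear f \<Longrightarrow> clinear (tensor_lift f)"
  and tensor_lift_tensor [simp]: "cbilinear f \<Longrightarrow> tensor_lift f (x \<otimes> y) = f x y"
  using theI'[OF tensor_lift_exists[of f]] by (simp_all add: tensor_lift_def)

definition tensor_map :: "('a::cvec \<Rightarrow> 'c::cvec) \<Rightarrow> ('b::cvec \<Rightarrow> 'd::cvec) \<Rightarrow> 'a \<otimes> 'b \<Rightarrow> 'c \<otimes> 'd"
  where "tensor_map f g = tensor_lift (\<lambda>x y. f x \<otimes> g y)"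

text \<open>Componentwise product of two bilinear products.\<close>

definition tensor_mult :: "('a::cvec \<Rightarrow> 'a \<Rightarrow> 'a) \<Rightarrow> ('b::cvec \<Rightarrow> 'b \<Rightarrow> 'b) \<Rightarrow>
    'a \<otimes> 'b \<Rightarrow> 'a \<otimes> 'b \<Rightarrow> 'a \<otimes> 'b" where
  "tensor_mult m m' u v =
     tensor_lift (\<lambda>x x'. tensor_lift (\<lambda>y y'. m x y \<otimes> m' x' y') v) u"

text \<open>Balanced tensor product of subspaces \<open>X\<close>, \<open>Y\<close> over \<open>B\<close>, for a right action \<open>r\<close> of \<open>B\<close> on
  \<open>X\<close> and a left action \<open>l\<close> of \<open>B\<close> on \<open>Y\<close>. Over a field, the tensor product of subspaces is the
  subspace spanned by the pure tensors.\<close>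

definition balancing :: "'a::cvec set \<Rightarrow> 'b::cvec set \<Rightarrow> 'r set \<Rightarrow> ('a \<Rightarrow> 'r \<Rightarrow> 'a) \<Rightarrow>
    ('r \<Rightarrow> 'b \<Rightarrow> 'b) \<Rightarrow> ('a \<otimes> 'b) set" where
  "balancing X Y B r l =
     cvec.span {r x b \<otimes> y - x \<otimes> l b y |x y b. x \<in> X \<and> y \<in> Y \<and> b \<in> B}"

definition balanced_tensor :: "'a::cvec set \<Rightarrow> 'b::cvec set \<Rightarrow> 'r set \<Rightarrow> ('a \<Rightarrow> 'r \<Rightarrow> 'a) \<Rightarrow>
    ('r \<Rightarrow> 'b \<Rightarrow> 'b) \<Rightarrow> ('a \<otimes> 'b) set set" where
  "balanced_tensor X Y B r l =
     coset (balancing X Y B r l) ` cvec.span {x \<otimes> y |x y. x \<in> X \<and> y \<in> Y}"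

text \<open>Sweedler-style evaluation of a map on a tensor class \<open>D\<close>: all sums \<open>\<Sum>\<^sub>i z\<^sub>i\<close> with
  \<open>z\<^sub>i \<in> f x\<^sub>i y\<^sub>i\<close>, over all decompositions \<open>\<Sum>\<^sub>i x\<^sub>i \<otimes> y\<^sub>i \<in> D\<close> with \<open>x\<^sub>i \<in> X\<close>, \<open>y\<^sub>i \<in> Y\<close>,
  modulo the relations \<open>K\<close> of the target. If the assignment \<open>x \<otimes> y \<mapsto> f x y\<close> is well defined
  on \<open>D\<close>, this is a single coset of \<open>K\<close>; otherwise it is larger than one. An equation between
  such a set and a coset of \<open>K\<close> therefore includes independence of the decomposition.\<close>

definition sweedler :: "'a::cvec set \<Rightarrow> 'b::cvec set \<Rightarrow> 'c::cvec set \<Rightarrow>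
    ('a \<Rightarrow> 'b \<Rightarrow> 'c set) \<Rightarrow> ('a \<otimes> 'b) set \<Rightarrow> 'c set" where
  "sweedler X Y K f D =
     {sum_list zs + k |ps zs k.
        set ps \<subseteq> X \<times> Y \<and> (\<Sum>(x, y)\<leftarrow>ps. x \<otimes> y) \<in> D \<and>
        list_all2 (\<lambda>(x, y) z. z \<in> f x y) ps zs \<and> k \<in> K}"


section \<open>Left bialgebroids and Hopf algebroids\<close>

locale algebra_on =
  fixes X :: "'a::cvec set" and mul :: "'a \<Rightarrow> 'a \<Rightarrow> 'a"  (infixl \<open>\<cdot>\<close> 70) and unit :: 'a
  assumes subspace: "cvec.subspace X"
    and unit_closed: "unit \<in> X"
    and mul_closed: "x \<in> X \<Longrightarrow> y \<in> X \<Longrightarrow> x \<cdot> y \<in> X"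
    and mul_assoc: "x \<in> X \<Longrightarrow> y \<in> X \<Longrightarrow> z \<in> X \<Longrightarrow> (x \<cdot> y) \<cdot> z = x \<cdot> (y \<cdot> z)"
    and unit_left: "x \<in> X \<Longrightarrow> unit \<cdot> x = x"
    and unit_right: "x \<in> X \<Longrightarrow> x \<cdot> unit = x"
    and mul_add_left: "x \<in> X \<Longrightarrow> y \<in> X \<Longrightarrow> z \<in> X \<Longrightarrow> (x + y) \<cdot> z = x \<cdot> z + y \<cdot> z"
    and mul_add_right: "x \<in> X \<Longrightarrow> y \<in> X \<Longrightarrow> z \<in> X \<Longrightarrow> x \<cdot> (y + z) = x \<cdot> y + x \<cdot> z"
    and mul_scale_left: "x \<in> X \<Longrightarrow> y \<in> X \<Longrightarrow> (c *\<^sub>C x) \<cdot> y = c *\<^sub>C (x \<cdot> y)"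
    and mul_scale_right: "x \<in> X \<Longrightarrow> y \<in> X \<Longrightarrow> x \<cdot> (c *\<^sub>C y) = c *\<^sub>C (x \<cdot> y)"

locale bialgebroid_data =
  fixes B :: "'b::cvec set" and mulB :: "'b \<Rightarrow> 'b \<Rightarrow> 'b" and oneB :: 'b
    and L :: "'l::cvec set" and mul :: "'l \<Rightarrow> 'l \<Rightarrow> 'l"  (infixl \<open>\<cdot>\<close> 75) and one :: 'l
    and s t :: "'b \<Rightarrow> 'l"
    and \<Delta> :: "'l \<Rightarrow> ('l \<otimes> 'l) set" and \<epsilon> :: "'l \<Rightarrow> 'b"
begin

text \<open>The bimodule structure is \<open>b \<triangleright> x \<triangleleft> b' = s b \<cdot> t b' \<cdot> x\<close>.\<close>

definition rel2 :: "('l \<otimes> 'l) set"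
  where "rel2 = balancing L L B (\<lambda>x b. t b \<cdot> x) (\<lambda>b y. s b \<cdot> y)"

definition tens2 :: "('l \<otimes> 'l) set set"
  where "tens2 = balanced_tensor L L B (\<lambda>x b. t b \<cdot> x) (\<lambda>b y. s b \<cdot> y)"

definition rel3 :: "('l \<otimes> 'l \<otimes> 'l) set" where
  "rel3 = cvec.span
     ({(t b \<cdot> x) \<otimes> y \<otimes> z - x \<otimes> (s b \<cdot> y) \<otimes> z |x y z b. x \<in> L \<and> y \<in> L \<and> z \<in> L \<and> b \<in> B} \<union>
      {x \<otimes> (t b \<cdot> y) \<otimes> z - x \<otimes> y \<otimes> (s b \<cdot> z) |x y z b. x \<in> L \<and> y \<in> L \<and> z \<in> L \<and> b \<in> B})"

end

locale left_bialgebroid = bialgebroid_data +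
  assumes base_algebra: "algebra_on B mulB oneB"
    and total_algebra: "algebra_on L mul one"
    \<comment> \<open>source and target\<close>
    and source_closed: "b \<in> B \<Longrightarrow> s b \<in> L"
    and target_closed: "b \<in> B \<Longrightarrow> t b \<in> L"
    and source_add: "a \<in> B \<Longrightarrow> b \<in> B \<Longrightarrow> s (a + b) = s a + s b"
    and target_add: "a \<in> B \<Longrightarrow> b \<in> B \<Longrightarrow> t (a + b) = t a + t b"
    and source_scale: "b \<in> B \<Longrightarrow> s (c *\<^sub>C b) = c *\<^sub>C s b"
    and target_scale: "b \<in> B \<Longrightarrow> t (c *\<^sub>C b) = c *\<^sub>C t b"
    and source_one: "s oneB = one"
    and target_one: "t oneB = one"
    and source_mult: "a \<in> B \<Longrightarrow> b \<in> B \<Longrightarrow> s (mulB a b) = s a \<cdot> s b"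
    and target_mult: "a \<in> B \<Longrightarrow> b \<in> B \<Longrightarrow> t (mulB a b) = t b \<cdot> t a"
    and source_target_commute: "a \<in> B \<Longrightarrow> b \<in> B \<Longrightarrow> s a \<cdot> t b = t b \<cdot> s a"
    \<comment> \<open>coring: bimodule maps, coassociativity, counitality\<close>
    and coproduct_closed: "h \<in> L \<Longrightarrow> \<Delta> h \<in> tens2"
    and coproduct_add: "g \<in> L \<Longrightarrow> h \<in> L \<Longrightarrow> \<Delta> (g + h) = {u + v |u v. u \<in> \<Delta> g \<and> v \<in> \<Delta> h}"
    and coproduct_bimodule: "h \<in> L \<Longrightarrow> a \<in> B \<Longrightarrow> b \<in> B \<Longrightarrow>
      \<Delta> (s a \<cdot> t b \<cdot> h) = sweedler L L rel2 (\<lambda>x y. {(s a \<cdot> x) \<otimes> (t b \<cdot> y)}) (\<Delta> h)"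
    and counit_closed: "h \<in> L \<Longrightarrow> \<epsilon> h \<in> B"
    and counit_add: "g \<in> L \<Longrightarrow> h \<in> L \<Longrightarrow> \<epsilon> (g + h) = \<epsilon> g + \<epsilon> h"
    and counit_bimodule: "h \<in> L \<Longrightarrow> a \<in> B \<Longrightarrow> b \<in> B \<Longrightarrow>
      \<epsilon> (s a \<cdot> t b \<cdot> h) = mulB (mulB a (\<epsilon> h)) b"
    and coassociative: "h \<in> L \<Longrightarrow>
      sweedler L L rel3 (\<lambda>x y. {tensor_lift (\<lambda>u v. u \<otimes> v \<otimes> y) d |d. d \<in> \<Delta> x}) (\<Delta> h) =
      sweedler L L rel3 (\<lambda>x y. {x \<otimes> d |d. d \<in> \<Delta> y}) (\<Delta> h)"
    and counit_left: "h \<in> L \<Longrightarrow> sweedler L L {0} (\<lambda>x y. {s (\<epsilon> x) \<cdot> y}) (\<Delta> h) = {h}"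
    and counit_right: "h \<in> L \<Longrightarrow> sweedler L L {0} (\<lambda>x y. {t (\<epsilon> y) \<cdot> x}) (\<Delta> h) = {h}"
    \<comment> \<open>the coproduct is an algebra map into the Takeuchi product. The componentwise product is
      decomposed on the right factor first: right multiplication by any \<open>u \<otimes> v\<close> is well defined
      on the balanced tensor product, left multiplication is not.\<close>
    and takeuchi: "h \<in> L \<Longrightarrow> b \<in> B \<Longrightarrow>
      sweedler L L rel2 (\<lambda>x y. {(x \<cdot> t b) \<otimes> y}) (\<Delta> h) =
      sweedler L L rel2 (\<lambda>x y. {x \<otimes> (y \<cdot> s b)}) (\<Delta> h)"
    and coproduct_one: "\<Delta> one = coset rel2 (one \<otimes> one)"
    and coproduct_mult: "g \<in> L \<Longrightarrow> h \<in> L \<Longrightarrow>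
      \<Delta> (g \<cdot> h) = sweedler L L rel2 (\<lambda>u v.
        sweedler L L rel2 (\<lambda>x y. {(x \<cdot> u) \<otimes> (y \<cdot> v)}) (\<Delta> g)) (\<Delta> h)"
    \<comment> \<open>the counit is a left character\<close>
    and counit_one: "\<epsilon> one = oneB"
    and counit_source: "g \<in> L \<Longrightarrow> h \<in> L \<Longrightarrow> \<epsilon> (g \<cdot> s (\<epsilon> h)) = \<epsilon> (g \<cdot> h)"
    and counit_target: "g \<in> L \<Longrightarrow> h \<in> L \<Longrightarrow> \<epsilon> (g \<cdot> t (\<epsilon> h)) = \<epsilon> (g \<cdot> h)"

locale hopf_algebroid =
  left_bialgebroid B mulB oneB L mul one s t \<Delta> \<epsilon>
  for B :: "'b::cvec set" and mulB :: "'b \<Rightarrow> 'b \<Rightarrow> 'b" and oneB :: 'b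
    and L :: "'l::cvec set" and mul :: "'l \<Rightarrow> 'l \<Rightarrow> 'l"  (infixl \<open>\<cdot>\<close> 75) and one :: 'l
    and s t :: "'b \<Rightarrow> 'l"
    and \<Delta> :: "'l \<Rightarrow> ('l \<otimes> 'l) set" and \<epsilon> :: "'l \<Rightarrow> 'b" +
  fixes S :: "'l \<Rightarrow> 'l"
  assumes antipode_bij: "bij_betw S L L"
    and antipode_add: "g \<in> L \<Longrightarrow> h \<in> L \<Longrightarrow> S (g + h) = S g + S h"
    and antipode_scale: "h \<in> L \<Longrightarrow> S (c *\<^sub>C h) = c *\<^sub>C S h"
    and antipode_one: "S one = one"
    and antipode_mult: "g \<in> L \<Longrightarrow> h \<in> L \<Longrightarrow> S (g \<cdot> h) = S h \<cdot> S g"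
    and antipode_target: "b \<in> B \<Longrightarrow> S (t b) = s b"
    and antipode_inverse: "h \<in> L \<Longrightarrow>
      sweedler L L rel2 (\<lambda>h1 h2.
        sweedler L L rel2 (\<lambda>x y. {x \<otimes> (y \<cdot> h1)}) (\<Delta> (the_inv_into L S h2))) (\<Delta> h) =
      coset rel2 (the_inv_into L S h \<otimes> one)"
    and antipode_direct: "h \<in> L \<Longrightarrow>
      sweedler L L rel2 (\<lambda>h1 h2.
        sweedler L L rel2 (\<lambda>x y. {(x \<cdot> h2) \<otimes> y}) (\<Delta> (S h1))) (\<Delta> h) =
      coset rel2 (one \<otimes> S h)"


section \<open>Coordinate algebras of special orthogonal groups\<close>

text \<open>Matrix indices with the involution \<open>J \<mapsto> J'\<close> for which \<open>Q\<^sub>J\<^sub>K = 1\<close> if \<open>K = J'\<close> and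
  \<open>Q\<^sub>J\<^sub>K = 0\<close> otherwise. \<open>Pos j\<close> and \<open>Neg j\<close> stand for the indices \<open>j\<close> and \<open>n + j\<close>, and
  \<open>None\<close> for the additional index \<open>2n + 1\<close>.\<close>

class quad_index = finite +
  fixes conj_index :: "'a \<Rightarrow> 'a"
  assumes conj_index_conj_index: "conj_index (conj_index i) = i"

datatype 'n even_index = Pos 'n | Neg 'n

type_synonym 'n odd_index = "'n even_index option"

instantiation even_index :: (finite) quad_index
begin
fun conj_index_even_index :: "'a even_index \<Rightarrow> 'a even_index" where
  "conj_index (Pos j) = Neg j"
| "conj_index (Neg j) = Pos j"
instance
proof
  have "x \<in> range Pos \<union> range Neg" for x :: "'a even_index"
    by (cases x) auto
  then have "(UNIV :: 'a even_index set) \<subseteq> range Pos \<union> range Neg" by blast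
  then show "finite (UNIV :: 'a even_index set)" by (rule finite_subset) simp
  show "conj_index (conj_index i) = i" for i :: "'a even_index" by (cases i) auto
qed
end

instantiation option :: (quad_index) quad_index
begin
definition conj_index_option :: "'a option \<Rightarrow> 'a option" where
  "conj_index_option = map_option conj_index"
instance
  by standard (simp add: conj_index_option_def option.map_comp comp_def conj_index_conj_index
      option.map_ident)
end

text \<open>The commutative polynomial ring in the matrix entries: a monomial is a finitely supported
  exponent function.\<close>

type_synonym 'i entry_poly = "('i \<times> 'i \<Rightarrow>\<^sub>0 nat) \<Rightarrow>\<^sub>0 complex"

definition generic_matrix :: "'i::quad_index entry_poly ^ 'i::quad_index ^ 'i::quad_index"
  where "generic_matrix = (\<chi> J K. Poly_Mapping.single (Poly_Mapping.single (J, K) 1) 1)"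

definition Q_matrix :: "'r::comm_ring_1 ^ 'i::quad_index ^ 'i::quad_index"
  where "Q_matrix = (\<chi> J K. if K = conj_index J then 1 else 0)"

global_interpretation ring_ideal: module "(*) :: 'r \<Rightarrow> 'r \<Rightarrow> 'r :: comm_ring_1"
  by unfold_locales (simp_all add: algebra_simps)

text \<open>The ideal generated by a set is its span over the ring.\<close>

definition so_ideal :: "'i::quad_index entry_poly set" where
  "so_ideal = ring_ideal.span (
     {(transpose generic_matrix ** Q_matrix ** generic_matrix - Q_matrix) $ J $ K |J K. True} \<union>
     {(generic_matrix ** Q_matrix ** transpose generic_matrix - Q_matrix) $ J $ K |J K. True} \<union>
     {det generic_matrix - 1})"

lemma so_ideal_add: "p \<in> so_ideal \<Longrightarrow> q \<in> so_ideal \<Longrightarrow> p + q \<in> so_ideal"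
  and so_ideal_diff: "p \<in> so_ideal \<Longrightarrow> q \<in> so_ideal \<Longrightarrow> p - q \<in> so_ideal"
  and so_ideal_uminus: "p \<in> so_ideal \<Longrightarrow> - p \<in> so_ideal"
  and so_ideal_zero: "0 \<in> so_ideal"
  and so_ideal_mult: "p \<in> so_ideal \<Longrightarrow> r * p \<in> so_ideal"
  unfolding so_ideal_def
  by (simp_all add: ring_ideal.span_add ring_ideal.span_diff ring_ideal.span_neg
      ring_ideal.span_zero ring_ideal.span_scale)

lemma scaleC_eq_single_mult: "c *\<^sub>C p = Poly_Mapping.single 0 c * p"
  for p :: "'m::comm_monoid_add \<Rightarrow>\<^sub>0 complex"
  unfolding mult_map_scale_conv_mult[symmetric]
  by (rule poly_mapping_eqI)
     (simp add: scaleC_poly_mapping.rep_eq scaleC_complex_def map.rep_eq when_def)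

lemma so_ideal_scale: "p \<in> so_ideal \<Longrightarrow> c *\<^sub>C p \<in> so_ideal"
  by (simp add: scaleC_eq_single_mult so_ideal_mult)

text \<open>\<open>'n even_index so\<close> and \<open>'n odd_index so\<close> are the coordinate algebras of \<open>SO(2n)\<close> and
  \<open>SO(2n+1)\<close>, with \<open>n = CARD('n)\<close>.\<close>

quotient_type (overloaded) 'i so = "'i::quad_index entry_poly" / "\<lambda>p q. p - q \<in> so_ideal"
  by (rule subspace_equivp)
     (simp add: cvec.subspace_def so_ideal_zero so_ideal_add so_ideal_scale)

instantiation so :: (quad_index) "{comm_ring, one, monoid_mult, cvec}"
begin
lift_definition zero_so :: "'a so" is 0 .
lift_definition one_so :: "'a so" is 1 .
lift_definition plus_so :: "'a so \<Rightarrow> 'a so \<Rightarrow> 'a so" is "(+)"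
  by (simp add: add_diff_add so_ideal_add)
lift_definition minus_so :: "'a so \<Rightarrow> 'a so \<Rightarrow> 'a so" is "(-)"
proof -
  fix p p' q q' :: "'a entry_poly"
  assume "p - p' \<in> so_ideal" "q - q' \<in> so_ideal"
  from so_ideal_diff[OF this] show "p - q - (p' - q') \<in> so_ideal"
    by (simp add: algebra_simps)
qed
lift_definition uminus_so :: "'a so \<Rightarrow> 'a so" is uminus
  by (simp only: minus_diff_minus so_ideal_uminus)
lift_definition times_so :: "'a so \<Rightarrow> 'a so \<Rightarrow> 'a so" is "(*)"
proof -
  fix p p' q q' :: "'a entry_poly"
  assume "p - p' \<in> so_ideal" "q - q' \<in> so_ideal"
  then have "q * (p - p') + p' * (q - q') \<in> so_ideal"
    by (intro so_ideal_add so_ideal_mult)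
  moreover have "q * (p - p') + p' * (q - q') = p * q - p' * q'"
    by (simp only: right_diff_distrib mult.commute[of q p] mult.commute[of q p']
        diff_add_eq add_diff_eq diff_add_cancel diff_diff_eq2 add.commute[of _ "p' * q"] add_diff_cancel_left')
  ultimately show "p * q - p' * q' \<in> so_ideal" by (simp only:)
qed
lift_definition scaleC_so :: "complex \<Rightarrow> 'a so \<Rightarrow> 'a so" is "(*\<^sub>C)"
proof -
  fix c and p q :: "'a entry_poly"
  assume "p - q \<in> so_ideal"
  then have "c *\<^sub>C (p - q) \<in> so_ideal" by (rule so_ideal_scale)
  then show "c *\<^sub>C p - c *\<^sub>C q \<in> so_ideal" by (subst (asm) cvec.scale_right_diff_distrib)
qed
instance
proof
  fix a b c :: "'a so" and k l :: complex
  obtain p where a: "a = abs_so p"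
    by (rule that[of "rep_so a"]) (rule Quotient3_abs_rep[OF Quotient3_so, symmetric])
  obtain q where b: "b = abs_so q"
    by (rule that[of "rep_so b"]) (rule Quotient3_abs_rep[OF Quotient3_so, symmetric])
  obtain r where c: "c = abs_so r"
    by (rule that[of "rep_so c"]) (rule Quotient3_abs_rep[OF Quotient3_so, symmetric])
  note so_simps = a b c zero_so_def one_so_def plus_so.abs_eq minus_so.abs_eq uminus_so.abs_eq
    times_so.abs_eq scaleC_so.abs_eq
  show "a * b * c = a * (b * c)" by (simp only: so_simps mult.assoc)
  show "1 * a = a" "a * 1 = a" by (simp_all only: so_simps mult_1_left mult_1_right)
  show "a * b = b * a" by (simp only: so_simps mult.commute)
  show "a + b + c = a + (b + c)" by (simp only: so_simps add.assoc)
  show "a + b = b + a" by (simp only: so_simps add.commute)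
  show "0 + a = a" by (simp only: so_simps add_0_left)
  show "- a + a = 0" by (simp only: so_simps left_minus)
  show "a - b = a + - b" by (simp only: so_simps diff_conv_add_uminus)
  show "(a + b) * c = a * c + b * c" by (simp only: so_simps distrib_right)
  show "k *\<^sub>C (a + b) = k *\<^sub>C a + k *\<^sub>C b" by (simp only: so_simps scaleC_add_right)
  show "(k + l) *\<^sub>C a = k *\<^sub>C a + l *\<^sub>C a" by (simp only: so_simps scaleC_add_left)
  show "k *\<^sub>C l *\<^sub>C a = (k * l) *\<^sub>C a" by (simp only: so_simps scaleC_scaleC)
  show "1 *\<^sub>C a = a" by (simp only: so_simps scaleC_one)
qed
end

lift_definition gen :: "'i::quad_index \<Rightarrow> 'i \<Rightarrow> 'i so" is "\<lambda>J K. generic_matrix $ J $ K" .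

definition so_coproduct :: "'i::quad_index so \<Rightarrow> 'i so \<otimes> 'i so" where
  "so_coproduct = (THE f. clinear f \<and> f 1 = 1 \<otimes> 1 \<and>
     (\<forall>x y. f (x * y) = tensor_mult (*) (*) (f x) (f y)) \<and>
     (\<forall>J K. f (gen J K) = (\<Sum>M\<in>UNIV. gen J M \<otimes> gen M K)))"


section \<open>The deformed algebras\<close>

fun even_weight :: "'n::finite even_index \<Rightarrow> int ^ 'n" where
  "even_weight (Pos j) = axis j 1"
| "even_weight (Neg j) = - axis j 1"

fun odd_weight :: "'n::finite odd_index \<Rightarrow> int ^ 'n" where
  "odd_weight None = 0"
| "odd_weight (Some J) = even_weight J"

definition bidegree :: "('i \<Rightarrow> int ^ 'n) \<Rightarrow> ('i \<times> 'i \<Rightarrow>\<^sub>0 nat) \<Rightarrow> (int ^ 'n) \<times> (int ^ 'n)" where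
  "bidegree w m =
     (\<Sum>(J, K)\<in>Poly_Mapping.keys m. int (Poly_Mapping.lookup m (J, K)) *s w J,
      \<Sum>(J, K)\<in>Poly_Mapping.keys m. int (Poly_Mapping.lookup m (J, K)) *s w K)"

definition homogeneous ::
    "('i \<Rightarrow> int ^ 'n) \<Rightarrow> int ^ 'n \<Rightarrow> int ^ 'n \<Rightarrow> 'i::quad_index so set" where
  "homogeneous w r1 r2 = abs_so ` {p. \<forall>m\<in>Poly_Mapping.keys p. bidegree w m = (r1, r2)}"

definition lam :: "real ^ 'n ^ 'n \<Rightarrow> int ^ 'n::finite \<Rightarrow> int ^ 'n \<Rightarrow> complex" where
  "lam \<theta> r l = exp (complex_of_real pi * \<i> *
     (\<Sum>j\<in>UNIV. \<Sum>k\<in>UNIV. complex_of_real (\<theta> $ j $ k) * of_int (r $ j) * of_int (l $ k)))"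

definition deformed_mult ::
    "('i \<Rightarrow> int ^ 'n) \<Rightarrow> real ^ 'n ^ 'n::finite \<Rightarrow> 'i::quad_index so \<Rightarrow> 'i so \<Rightarrow> 'i so" where
  "deformed_mult w \<theta> = (THE m. cbilinear m \<and>
     (\<forall>r1 r2 l1 l2. \<forall>x \<in> homogeneous w r1 r2. \<forall>y \<in> homogeneous w l1 l2.
        m x y = (lam \<theta> r1 l1 * inverse (lam \<theta> r2 l2)) *\<^sub>C (x * y)))"

type_synonym 'n algA = "'n odd_index so"
type_synonym 'n algH = "'n even_index so"

definition mulA :: "real ^ 'n ^ 'n \<Rightarrow> 'n::finite algA \<Rightarrow> 'n algA \<Rightarrow> 'n algA"
  where "mulA = deformed_mult odd_weight"

definition mulH :: "real ^ 'n ^ 'n \<Rightarrow> 'n::finite algH \<Rightarrow> 'n algH \<Rightarrow> 'n algH"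
  where "mulH = deformed_mult even_weight"


section \<open>The Hopf--Galois extension\<close>

definition projection :: "real ^ 'n ^ 'n \<Rightarrow> 'n::finite algA \<Rightarrow> 'n algH" where
  "projection \<theta> = (THE f. clinear f \<and> f 1 = 1 \<and>
     (\<forall>x y. f (mulA \<theta> x y) = mulH \<theta> (f x) (f y)) \<and>
     (\<forall>J K. f (gen J K) =
        (case (J, K) of (Some j, Some k) \<Rightarrow> gen j k | (None, None) \<Rightarrow> 1 | _ \<Rightarrow> 0)))"

definition coaction :: "real ^ 'n ^ 'n \<Rightarrow> 'n::finite algA \<Rightarrow> 'n algA \<otimes> 'n algH"
  where "coaction \<theta> a = tensor_map (\<lambda>x. x) (projection \<theta>) (so_coproduct a)"

definition sphere_alg :: "real ^ 'n ^ 'n \<Rightarrow> 'n::finite algA set"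
  where "sphere_alg \<theta> = {b. coaction \<theta> b = b \<otimes> 1}"

definition AB_tensor :: "real ^ 'n ^ 'n \<Rightarrow> ('n::finite algA \<otimes> 'n algA) set set"
  where "AB_tensor \<theta> = balanced_tensor UNIV UNIV (sphere_alg \<theta>) (mulA \<theta>) (mulA \<theta>)"

text \<open>The canonical map, first on the tensor product over the complex numbers and then on
  balanced classes.\<close>

definition canonical_lift ::
    "real ^ 'n ^ 'n \<Rightarrow> 'n::finite algA \<otimes> 'n algA \<Rightarrow> 'n algA \<otimes> 'n algH" where
  "canonical_lift \<theta> =
     tensor_lift (\<lambda>a' a. tensor_lift (\<lambda>a0 a1. mulA \<theta> a' a0 \<otimes> a1) (coaction \<theta> a))"

definition canonical ::
    "real ^ 'n ^ 'n \<Rightarrow> ('n::finite algA \<otimes> 'n algA) set \<Rightarrow> 'n algA \<otimes> 'n algH"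
  where "canonical \<theta> D = the_elem (canonical_lift \<theta> ` D)"

definition translation ::
    "real ^ 'n ^ 'n \<Rightarrow> 'n::finite algH \<Rightarrow> ('n algA \<otimes> 'n algA) set"
  where "translation \<theta> h = the_inv_into (AB_tensor \<theta>) (canonical \<theta>) (1 \<otimes> h)"


section \<open>The Ehresmann--Schauenburg bialgebroid\<close>

type_synonym 'n algAA = "'n algA \<otimes> 'n algA"

definition diagonal_coaction ::
    "real ^ 'n ^ 'n \<Rightarrow> 'n::finite algAA \<Rightarrow> 'n algAA \<otimes> 'n algH" where
  "diagonal_coaction \<theta> = tensor_lift (\<lambda>a a'.
     tensor_lift (\<lambda>a0 a1.
       tensor_lift (\<lambda>b0 b1. (a0 \<otimes> b0) \<otimes> mulH \<theta> a1 b1) (coaction \<theta> a')) (coaction \<theta> a))"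

definition ES :: "real ^ 'n ^ 'n \<Rightarrow> 'n::finite algAA set"
  where "ES \<theta> = {z. diagonal_coaction \<theta> z = z \<otimes> 1}"

definition ES_mult :: "real ^ 'n ^ 'n \<Rightarrow> 'n::finite algAA \<Rightarrow> 'n algAA \<Rightarrow> 'n algAA"
  where "ES_mult \<theta> = tensor_mult (mulA \<theta>) (\<lambda>x y. mulA \<theta> y x)"

definition ES_one :: "'n::finite algAA"
  where "ES_one = 1 \<otimes> 1"

definition ES_source :: "'n::finite algA \<Rightarrow> 'n algAA"
  where "ES_source b = b \<otimes> 1"

definition ES_target :: "'n::finite algA \<Rightarrow> 'n algAA"
  where "ES_target b = 1 \<otimes> b"

definition ES_counit :: "real ^ 'n ^ 'n \<Rightarrow> 'n::finite algAA \<Rightarrow> 'n algA"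
  where "ES_counit \<theta> = tensor_lift (mulA \<theta>)"

text \<open>The formula for the coproduct takes values in \<open>(A \<otimes> A) \<otimes>\<^sub>B (A \<otimes> A) = A \<otimes> (A \<otimes>\<^sub>B A) \<otimes> A\<close>.
  The coproduct of the bialgebroid is the element of the balanced square of the bialgebroid whose
  image under the map induced by the inclusion is given by the formula; on cosets this map is
  enlargement to the coset of the larger space of relations.\<close>

definition AA_rel :: "real ^ 'n ^ 'n \<Rightarrow> ('n::finite algAA \<otimes> 'n algAA) set" where
  "AA_rel \<theta> = balancing UNIV UNIV (sphere_alg \<theta>)
     (\<lambda>x b. ES_mult \<theta> (ES_target b) x) (\<lambda>b y. ES_mult \<theta> (ES_source b) y)"

definition coproduct_formula ::
    "real ^ 'n ^ 'n \<Rightarrow> 'n::finite algAA \<Rightarrow> ('n algAA \<otimes> 'n algAA) set" where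
  "coproduct_formula \<theta> h =
     sweedler UNIV UNIV (AA_rel \<theta>) (\<lambda>a a'.
       sweedler UNIV UNIV (AA_rel \<theta>) (\<lambda>a0 a1.
         sweedler UNIV UNIV (AA_rel \<theta>) (\<lambda>u v. {(a0 \<otimes> u) \<otimes> (v \<otimes> a')}) (translation \<theta> a1))
       {coaction \<theta> a}) {h}"

definition ES_coproduct ::
    "real ^ 'n ^ 'n \<Rightarrow> 'n::finite algAA \<Rightarrow> ('n algAA \<otimes> 'n algAA) set" where
  "ES_coproduct \<theta> h = (THE D.
     D \<in> balanced_tensor (ES \<theta>) (ES \<theta>) (sphere_alg \<theta>)
       (\<lambda>x b. ES_mult \<theta> (ES_target b) x) (\<lambda>b y. ES_mult \<theta> (ES_source b) y) \<and>
     D \<subseteq> coproduct_formula \<theta> h)"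

definition flip :: "'a::cvec \<otimes> 'b::cvec \<Rightarrow> 'b \<otimes> 'a"
  where "flip = tensor_lift (\<lambda>x y. y \<otimes> x)"

end

theory Submission
  imports Defs
begin

text \<open>For a quotient \<open>\<pi> : A \<rightarrow> H\<close> of an involutive Hopf algebra whose kernel is generated by the
  coinvariants \<open>b - \<epsilon>(b)\<close>, everything is explicit. The translation map is
  \<open>\<tau>(\<pi>(a)) = S(a\<^sub>(\<^sub>1\<^sub>)) \<otimes>\<^sub>B a\<^sub>(\<^sub>2\<^sub>)\<close>, and the coproduct of the bialgebroid lifts to
  \<open>x \<otimes> y \<mapsto> (x\<^sub>(\<^sub>1\<^sub>) \<otimes> S(x\<^sub>(\<^sub>2\<^sub>))) \<otimes> (x\<^sub>(\<^sub>3\<^sub>) \<otimes> y)\<close>, with both factors coinvariant. Since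
  \<open>x \<otimes> y \<mapsto> x\<^sub>(\<^sub>1\<^sub>) \<otimes> x\<^sub>(\<^sub>2\<^sub>) y\<close> identifies \<open>\<C>(A,H)\<close> with \<open>A \<otimes> B\<close>, it is free over \<open>B\<close>, and
  \<open>(x \<otimes> y) \<otimes>\<^sub>B (z \<otimes> w) \<mapsto> x \<otimes> y z \<otimes> w\<close> is injective on its balanced square. Under this
  embedding the coproduct of \<open>x \<otimes> y\<close> is \<open>x \<otimes> 1 \<otimes> y\<close>, and the axioms become identities in
  \<open>A \<otimes> A \<otimes> A\<close>; coinvariance of the flipped elements uses \<open>S\<^sup>2 = 1\<close>.

  For the orthogonal groups the Hopf algebra structure comes from the universal property of the
  undeformed coordinate ring. The bigrading is a homomorphism into the group ring of the degrees,
  and the deformation rescales products of homogeneous elements by a bicharacter that cancels in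
  all Hopf algebra identities because \<open>\<theta>\<close> is skew.\<close>

section \<open>Multilinear algebra\<close>

text \<open>Two obstacles shape the development. The axioms live in balanced tensor products, where
  a Sweedler formula need not be well defined. The embedding turns each coset of
  \<open>es_rel\<close> into a fiber of \<open>contract\<close>, so an axiom reduces to a linear map
  on A \<otimes> A \<otimes> A evaluated at x \<otimes> 1 \<otimes> y, and independence of
  decompositions comes for free. Coassociativity is treated differently: linear lifts are compared
  modulo the triple relations. Moreover, coinvariance of an element of a tensor product must be
  converted into a decomposition with coinvariant factors. This is exactness over a field: the
  kernel of id \<otimes> f is spanned by the x \<otimes> y with f y = 0. The kernel condition on
  \<pi> gives injectivity of the canonical map, which determines the translation map. It is proved
  in the commutative ring and passes to the deformation because the ideal has homogeneous
  generators. The twists cancel since the two legs of a coproduct share their middle degree with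
  opposite exponents, the antipode swaps and negates degrees, and the counit is supported where the
  two degrees agree.\<close>

lemma clinear_id: "clinear (\<lambda>x. x)"
  by (rule clinearI) simp_all

lemma clinear_compose: "clinear f \<Longrightarrow> clinear g \<Longrightarrow> clinear (\<lambda>x. f (g x))"
  by (rule clinearI) (simp_all add: clinear_add clinear_scale)

lemma clinear_zero: "clinear f \<Longrightarrow> f 0 = 0"
  using clinear_scale[of f 0 0] by simp

lemma clinear_neg: "clinear f \<Longrightarrow> f (- x) = - f x"
  using clinear_scale[of f "-1" x] by (simp add: cvec.scale_minus_left scaleC_one)

lemma clinear_diff: "clinear f \<Longrightarrow> f (x - y) = f x - f y"
  using clinear_add[of f x "- y"] by (simp add: clinear_neg)

lemma clinear_plus: "clinear f \<Longrightarrow> clinear g \<Longrightarrow> clinear (\<lambda>x. f x + g x)"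
  by (rule clinearI) (simp_all add: clinear_add clinear_scale scaleC_add_right algebra_simps)

lemma clinear_minus: "clinear f \<Longrightarrow> clinear g \<Longrightarrow> clinear (\<lambda>x. f x - g x)"
  by (rule clinearI) (simp_all add: clinear_add clinear_scale cvec.scale_right_diff_distrib algebra_simps)

lemma clinear_setsum: "(\<And>i. i \<in> I \<Longrightarrow> clinear (f i)) \<Longrightarrow> clinear (\<lambda>x. \<Sum>i\<in>I. f i x)"
  by (rule clinearI) (simp_all add: clinear_add clinear_scale sum.distrib cvec.scale_sum_right)

lemma clinear_scaleC_right: "clinear f \<Longrightarrow> clinear (\<lambda>x. c *\<^sub>C f x)"
  by (rule clinearI) (simp_all add: clinear_add clinear_scale scaleC_add_right scaleC_scaleC mult.commute)

lemma clinear_scaleC_left: "clinear f \<Longrightarrow> clinear (\<lambda>x. f x *\<^sub>C v)"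
  by (rule clinearI) (simp_all add: clinear_add clinear_scale scaleC_add_left scaleC_scaleC scaleC_complex_def)

section \<open>Bilinearity, induction and naturality for tensor products\<close>

lemma tensor_add_left: "(x + x') \<otimes> y = x \<otimes> y + x' \<otimes> y"
  unfolding tensor_elem.abs_eq plus_tensor.abs_eq tensor.abs_eq_iff bilinear_relations_def
  by (subst diff_diff_eq[symmetric], rule cvec.span_base, rule UnI1, rule UnI1, rule UnI1) blast

lemma tensor_add_right: "x \<otimes> (y + y') = x \<otimes> y + x \<otimes> y'"
  unfolding tensor_elem.abs_eq plus_tensor.abs_eq tensor.abs_eq_iff bilinear_relations_def
  by (subst diff_diff_eq[symmetric], rule cvec.span_base, rule UnI1, rule UnI1, rule UnI2) blast

lemma scaleC_single: "c *\<^sub>C Poly_Mapping.single k 1 = Poly_Mapping.single k (c::complex)"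
  by (rule poly_mapping_eqI)
    (simp add: scaleC_poly_mapping.rep_eq scaleC_complex_def lookup_single when_def)

lemma tensor_scale_left: "(c *\<^sub>C x) \<otimes> y = c *\<^sub>C (x \<otimes> y)"
  unfolding tensor_elem.abs_eq scaleC_tensor.abs_eq tensor.abs_eq_iff bilinear_relations_def scaleC_single
  by (rule cvec.span_base, rule UnI1, rule UnI2) blast

lemma tensor_scale_right: "x \<otimes> (c *\<^sub>C y) = c *\<^sub>C (x \<otimes> y)"
  unfolding tensor_elem.abs_eq scaleC_tensor.abs_eq tensor.abs_eq_iff bilinear_relations_def scaleC_single
  by (rule cvec.span_base, rule UnI2) blast

lemma clinear_tensor_left: "clinear f \<Longrightarrow> clinear (\<lambda>x. f x \<otimes> y)"
  by (rule clinearI) (simp_all add: clinear_add clinear_scale tensor_add_left tensor_scale_left)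

lemma clinear_tensor_right: "clinear f \<Longrightarrow> clinear (\<lambda>x. y \<otimes> f x)"
  by (rule clinearI) (simp_all add: clinear_add clinear_scale tensor_add_right tensor_scale_right)

lemma cbilinearI: "(\<And>x. clinear (\<lambda>y. f x y)) \<Longrightarrow> (\<And>y. clinear (\<lambda>x. f x y)) \<Longrightarrow> cbilinear f"
  by (simp add: cbilinear_def)

lemma cbilinear_right: "cbilinear f \<Longrightarrow> clinear g \<Longrightarrow> clinear (\<lambda>y. f x (g y))"
  by (rule clinear_compose[of "f x"]) (auto simp: cbilinear_def)

lemma cbilinear_left: "cbilinear f \<Longrightarrow> clinear g \<Longrightarrow> clinear (\<lambda>x. f (g x) y)"
  by (rule clinear_compose[of "\<lambda>x. f x y"]) (auto simp: cbilinear_def)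

lemma clinear_tensor_lift_arg: "cbilinear f \<Longrightarrow> clinear g \<Longrightarrow> clinear (\<lambda>x. tensor_lift f (g x))"
  by (rule clinear_compose[OF clinear_tensor_lift])

text \<open>Scalars are absorbed into the left factor, so sums of pure tensors already exhaust the
  tensor product.\<close>

lemma tensor_induct [case_names pure add]:
  assumes "\<And>x y. P (x \<otimes> y)" "\<And>s t. P s \<Longrightarrow> P t \<Longrightarrow> P (s + t)"
  shows "P t"
proof -
  obtain p where t: "t = abs_tensor p" by (rule abs_tensor_cases)
  have P0: "P 0" using assms(1)[of "0 *\<^sub>C 0" 0] unfolding tensor_scale_left by simp
  have "P (\<Sum>k\<in>K. Poly_Mapping.lookup p k *\<^sub>C (fst k \<otimes> snd k))" for K
    by (induction K rule: infinite_finite_induct)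
      (simp_all add: P0 assms flip: tensor_scale_left)
  then show ?thesis unfolding t abs_tensor_eq_sum .
qed

text \<open>Linearity in a parameter of the integrand. As a member of \<open>lin_intros\<close> it
  settles linearity of nested Sweedler sums.\<close>

lemma clinear_tensor_lift_param:
  assumes "\<And>x. cbilinear (f x)" "\<And>u v. clinear (\<lambda>x. f x u v)"
  shows "clinear (\<lambda>x. tensor_lift (f x) t)"
proof (induction t rule: tensor_induct)
  case (pure x y)
  then show ?case using assms by simp
next
  case (add s t)
  then show ?case by (simp add: clinear_add[OF clinear_tensor_lift[OF assms(1)]] clinear_plus)
qed

lemmas lin_intros = clinear_id clinear_plus clinear_minus clinear_scaleC_right clinear_scaleC_left
  clinear_tensor_left clinear_tensor_right clinear_tensor_lift_arg clinear_tensor_lift_param cbilinearI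

text \<open>Naturality in the target; this is how linear maps are pushed under a Sweedler sum
  throughout.\<close>

lemma tensor_lift_compose:
  assumes "clinear g" "cbilinear f"
  shows "g (tensor_lift f t) = tensor_lift (\<lambda>x y. g (f x y)) t"
proof -
  have "cbilinear (\<lambda>x y. g (f x y))"
    by (intro lin_intros clinear_compose[OF assms(1)] cbilinear_left[OF assms(2)] cbilinear_right[OF assms(2)])
  with assms have "(\<lambda>t. g (tensor_lift f t)) = tensor_lift (\<lambda>x y. g (f x y))"
    by (intro clinear_eqI clinear_compose[OF assms(1)] clinear_tensor_lift) simp_all
  then show ?thesis by (rule fun_cong)
qed

lemma tensor_lift_tensor_elem: "tensor_lift (\<lambda>x y. x \<otimes> y) t = t"
  by (rule fun_cong[of _ "\<lambda>t. t"], rule clinear_eqI)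
    (simp_all add: lin_intros)

lemma tensor_lift_swap:
  assumes "\<And>x y u. clinear (\<lambda>v. E x y u v)" "\<And>x y v. clinear (\<lambda>u. E x y u v)"
    "\<And>x u v. clinear (\<lambda>y. E x y u v)" "\<And>y u v. clinear (\<lambda>x. E x y u v)"
  shows "tensor_lift (\<lambda>x y. tensor_lift (\<lambda>u v. E x y u v) s) t =
    tensor_lift (\<lambda>u v. tensor_lift (\<lambda>x y. E x y u v) t) s"
  by (rule fun_cong[of _ _ t], rule clinear_eqI) (simp_all add: lin_intros assms)

lemma clinear_tensor_map: "clinear f \<Longrightarrow> clinear g \<Longrightarrow> clinear (tensor_map f g)"
  unfolding tensor_map_def
  by (intro clinear_tensor_lift lin_intros; assumption)

lemma tensor_map_tensor: "clinear f \<Longrightarrow> clinear g \<Longrightarrow> tensor_map f g (x \<otimes> y) = f x \<otimes> g y"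
  unfolding tensor_map_def by (subst tensor_lift_tensor) (intro lin_intros; assumption | simp)+

lemma tensor_lift_tensor_map:
  assumes "clinear f" "clinear g" "cbilinear E"
  shows "tensor_lift E (tensor_map f g t) = tensor_lift (\<lambda>x y. E (f x) (g y)) t"
  unfolding tensor_map_def
  using assms(1,2)
  by (subst tensor_lift_compose[OF clinear_tensor_lift[OF assms(3)]])
    (simp_all add: lin_intros assms(3))

lemma clinear_flip: "clinear flip"
  unfolding flip_def by (intro clinear_tensor_lift lin_intros)

lemma flip_tensor: "flip (x \<otimes> y) = y \<otimes> x"
  unfolding flip_def by (simp add: lin_intros)

lemma flip_flip: "flip (flip t) = t"
  by (induction t rule: tensor_induct) (simp_all add: flip_tensor clinear_add[OF clinear_flip])

text \<open>Coefficients are absorbed into the left factor, which is why X is a subspace. The list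
  form is the one that \<open>sweedler\<close> quantifies over.\<close>

lemma in_span_tensor_iff:
  assumes "cvec.subspace X"
  shows "t \<in> cvec.span {x \<otimes> y |x y. x \<in> X \<and> y \<in> Y} \<longleftrightarrow>
    (\<exists>ps. set ps \<subseteq> X \<times> Y \<and> t = (\<Sum>(x, y)\<leftarrow>ps. x \<otimes> y))"
proof
  assume "t \<in> cvec.span {x \<otimes> y |x y. x \<in> X \<and> y \<in> Y}"
  then show "\<exists>ps. set ps \<subseteq> X \<times> Y \<and> t = (\<Sum>(x, y)\<leftarrow>ps. x \<otimes> y)"
  proof (induction rule: cvec.span_induct_alt)
    case base
    show ?case by (rule exI[of _ "[]"]) simp
  next
    case (step c w t)
    then obtain x y ps where "w = x \<otimes> y" "x \<in> X" "y \<in> Y" "set ps \<subseteq> X \<times> Y"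
      "t = (\<Sum>(x, y)\<leftarrow>ps. x \<otimes> y)" by auto
    then show ?case
      by (intro exI[of _ "(c *\<^sub>C x, y) # ps"])
        (simp add: tensor_scale_left cvec.subspace_scale[OF assms])
  qed
next
  assume "\<exists>ps. set ps \<subseteq> X \<times> Y \<and> t = (\<Sum>(x, y)\<leftarrow>ps. x \<otimes> y)"
  then obtain ps where "set ps \<subseteq> X \<times> Y" "t = (\<Sum>(x, y)\<leftarrow>ps. x \<otimes> y)" by auto
  then show "t \<in> cvec.span {x \<otimes> y |x y. x \<in> X \<and> y \<in> Y}"
  proof (induction ps arbitrary: t)
    case (Cons p ps)
    then have "fst p \<otimes> snd p \<in> cvec.span {x \<otimes> y |x y. x \<in> X \<and> y \<in> Y}"
      by (intro cvec.span_base CollectI exI[of _ "fst p"] exI[of _ "snd p"]) auto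
    moreover have "(\<Sum>(x, y)\<leftarrow>ps. x \<otimes> y) \<in> cvec.span {x \<otimes> y |x y. x \<in> X \<and> y \<in> Y}"
      using Cons by simp
    moreover have "t = fst p \<otimes> snd p + (\<Sum>(x, y)\<leftarrow>ps. x \<otimes> y)"
      using Cons.prems(2) by (simp add: case_prod_unfold)
    ultimately show ?case by (simp only: cvec.span_add)
  qed (simp add: cvec.span_zero)
qed

lemma tensor_sum_list: obtains ps where "t = (\<Sum>(x, y)\<leftarrow>ps. x \<otimes> y)"
proof -
  have "t \<in> cvec.span {x \<otimes> y |x y. x \<in> UNIV \<and> y \<in> UNIV}"
    by (induction t rule: tensor_induct) (auto intro: cvec.span_base cvec.span_add)
  then show ?thesis using that unfolding in_span_tensor_iff[OF cvec.subspace_UNIV] by blast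
qed

lemma clinear_sum_list: "clinear f \<Longrightarrow> f (sum_list (map g xs)) = sum_list (map (\<lambda>x. f (g x)) xs)"
  by (induction xs) (simp_all add: clinear_add clinear_zero)

lemma clinear_span:
  assumes "clinear f" "x \<in> cvec.span S" "\<And>y. y \<in> S \<Longrightarrow> f y \<in> K" "cvec.subspace K"
  shows "f x \<in> K"
  using assms(2)
proof (induction rule: cvec.span_induct_alt)
  case base
  then show ?case using assms by (simp add: clinear_zero cvec.subspace_0)
next
  case (step c x y)
  then show ?case using assms
    by (simp add: clinear_add clinear_scale cvec.subspace_add cvec.subspace_scale)
qed

lemma clinear_eq_on_span:
  assumes "clinear f" "clinear g" "x \<in> cvec.span S" "\<And>y. y \<in> S \<Longrightarrow> f y = g y"
  shows "f x = g x"
  using clinear_span[OF clinear_minus[OF assms(1,2)] assms(3), of "{0}"] assms(4)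
  by (simp add: cvec.subspace_single_0)

lemma clinear_tensor_range:
  assumes "clinear f" "\<And>x y. f (x \<otimes> y) \<in> K" "cvec.subspace K"
  shows "f t \<in> K"
  by (induction t rule: tensor_induct)
    (use assms in \<open>simp_all add: clinear_add cvec.subspace_add\<close>)

text \<open>A linear right inverse of f on its range exists because the scalars form a
  field.\<close>

lemma generalized_inverse:
  fixes f :: "'a::cvec \<Rightarrow> 'b::cvec"
  assumes "clinear f"
  obtains g where "clinear g" "\<And>x. f (g (f x)) = f x"
proof -
  interpret vector_space_pair "scaleC :: complex \<Rightarrow> 'a \<Rightarrow> 'a" "scaleC :: complex \<Rightarrow> 'b \<Rightarrow> 'b"
    by unfold_locales
  from linear_exists_right_inverse_on[OF assms cvec.subspace_UNIV] that show ?thesis by auto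
qed

text \<open>Exactness of the tensor product over a field: with \<open>f g f = f\<close>, the map \<open>1 - g f\<close> projects
  onto the kernel of \<open>f\<close>, so that an element of the kernel of \<open>1 \<otimes> f\<close> is fixed by \<open>1 \<otimes> (1 - g f)\<close>.\<close>

lemma tensor_kernel:
  fixes f :: "'a::cvec \<Rightarrow> 'b::cvec" and t :: "'c::cvec \<otimes> 'a"
  assumes "clinear f" "tensor_map (\<lambda>x. x) f t = 0"
  shows "t \<in> cvec.span {x \<otimes> y |x y. f y = 0}"
proof -
  obtain g where g: "clinear g" "\<And>x. f (g (f x)) = f x" by (rule generalized_inverse[OF assms(1)]) auto
  define p where "p y = y - g (f y)" for y
  have p: "clinear p" unfolding p_def by (intro lin_intros clinear_compose[OF g(1)] assms(1))
  have tensor_p: "x \<otimes> p y = x \<otimes> y - x \<otimes> g (f y)" for x :: 'c and y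
    by (simp add: p_def clinear_diff[OF clinear_tensor_right[OF clinear_id]])
  have "tensor_map (\<lambda>x. x) p t = t - tensor_map (\<lambda>x. x) g (tensor_map (\<lambda>x. x) f t)" for t :: "'c \<otimes> 'a"
    by (rule fun_cong[of _ "\<lambda>t. t - _ t"], rule clinear_eqI)
      (simp_all add: tensor_map_tensor p g assms(1) lin_intros clinear_tensor_map
        clinear_compose[OF clinear_tensor_map[OF clinear_id g(1)]]
        tensor_p)
  then have fixed: "t = tensor_map (\<lambda>x. x) p t"
    by (simp add: assms(2) clinear_zero[OF clinear_tensor_map] g(1) clinear_id)
  have "tensor_map (\<lambda>x. x) p t \<in> cvec.span {x \<otimes> y |x y. f y = 0}" for t :: "'c \<otimes> 'a"
  proof (rule clinear_tensor_range[OF clinear_tensor_map[OF clinear_id p]])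
    fix x :: 'c and y
    have "f (p y) = 0" by (simp add: p_def g clinear_diff[OF assms(1)])
    then show "tensor_map (\<lambda>x. x) p (x \<otimes> y) \<in> cvec.span {x \<otimes> y |x y. f y = 0}"
      unfolding tensor_map_tensor[OF clinear_id p] by (blast intro: cvec.span_base)
  qed (rule cvec.subspace_span)
  then show ?thesis by (subst fixed)
qed

section \<open>Cosets and evaluation of Sweedler sums\<close>

lemma coset_eq: "cvec.subspace K \<Longrightarrow> coset K x = {y. y - x \<in> K}"
  by (auto simp: coset_def intro!: exI[of _ "_ - x"])

lemma coset_eq_iff: "cvec.subspace K \<Longrightarrow> coset K x = coset K y \<longleftrightarrow> x - y \<in> K"
proof
  assume K: "cvec.subspace K" and "coset K x = coset K y"
  then have "x \<in> coset K y" using cvec.subspace_0[OF K] by (auto simp: coset_eq)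
  then show "x - y \<in> K" by (simp add: coset_eq K)
next
  assume K: "cvec.subspace K" and *: "x - y \<in> K"
  have "z - x \<in> K \<longleftrightarrow> z - y \<in> K" for z
    using cvec.subspace_add[OF K *, of "z - x"] cvec.subspace_diff[OF K _ *, of "z - y"]
    by (auto simp: algebra_simps)
  then show "coset K x = coset K y" by (simp add: coset_eq K)
qed

lemma coset_self: "cvec.subspace K \<Longrightarrow> x \<in> coset K x"
  by (simp add: coset_eq cvec.subspace_0)

lemma list_all2_choose:
  assumes "\<And>x. x \<in> set xs \<Longrightarrow> \<exists>z. P x z"
  shows "\<exists>zs. list_all2 P xs zs"
  using assms by (induction xs) (auto simp: list_all2_Cons1)

lemma sum_list_diff_subspace:
  assumes "cvec.subspace K" "list_all2 (\<lambda>x z. z - f x \<in> K) xs zs"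
  shows "sum_list zs - sum_list (map f xs) \<in> K"
  using assms(2)
proof (induction rule: list_all2_induct)
  case Nil
  then show ?case by (simp add: cvec.subspace_0[OF assms(1)])
next
  case (Cons x xs z zs)
  from cvec.subspace_add[OF assms(1) Cons(1,3)] show ?case by (simp add: algebra_simps)
qed

text \<open>The linear map F records one representative for each value of f. Constancy of F on D
  modulo K makes the decomposition irrelevant, nonemptiness of f makes at least one sum available,
  and the free summand from K fills the coset.\<close>

lemma sweedler_coset:
  assumes X: "cvec.subspace X" and K: "cvec.subspace K" and F: "clinear F"
    and f: "\<And>x y. x \<in> X \<Longrightarrow> y \<in> Y \<Longrightarrow> f x y \<noteq> {} \<and> f x y \<subseteq> coset K (F (x \<otimes> y))"
    and d: "d \<in> D" "d \<in> cvec.span {x \<otimes> y |x y. x \<in> X \<and> y \<in> Y}"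
    and D: "\<And>d'. d' \<in> D \<Longrightarrow> F d' - F d \<in> K"
  shows "sweedler X Y K f D = coset K (F d)"
proof (intro equalityI subsetI)
  have sum: "sum_list zs - F (\<Sum>(x, y)\<leftarrow>ps. x \<otimes> y) \<in> K"
    if "set ps \<subseteq> X \<times> Y" "list_all2 (\<lambda>(x, y) z. z \<in> f x y) ps zs" for ps zs
  proof -
    have "list_all2 (\<lambda>p z. z - F (fst p \<otimes> snd p) \<in> K) ps zs"
      using that(2) by (rule list.rel_mono_strong) (use that(1) f in \<open>force simp: coset_eq[OF K]\<close>)
    from sum_list_diff_subspace[OF K this] show ?thesis
      by (simp add: clinear_sum_list[OF F] case_prod_beta)
  qed
  fix w
  {
    assume "w \<in> sweedler X Y K f D"
    then obtain ps zs k where w: "w = sum_list zs + k" "set ps \<subseteq> X \<times> Y"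
      "(\<Sum>(x, y)\<leftarrow>ps. x \<otimes> y) \<in> D" "list_all2 (\<lambda>(x, y) z. z \<in> f x y) ps zs" "k \<in> K"
      unfolding sweedler_def by blast
    from cvec.subspace_add[OF K cvec.subspace_add[OF K sum[OF w(2,4)] D[OF w(3)]] w(5)]
    show "w \<in> coset K (F d)" by (simp add: coset_eq[OF K] w(1) algebra_simps)
  }
  assume w: "w \<in> coset K (F d)"
  from d(2) obtain ps where ps: "set ps \<subseteq> X \<times> Y" "d = (\<Sum>(x, y)\<leftarrow>ps. x \<otimes> y)"
    unfolding in_span_tensor_iff[OF X] by blast
  have "\<exists>zs. list_all2 (\<lambda>(x, y) z. z \<in> f x y) ps zs"
    by (rule list_all2_choose) (use ps(1) f in fastforce)
  then obtain zs where zs: "list_all2 (\<lambda>(x, y) z. z \<in> f x y) ps zs" ..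
  from w sum[OF ps(1) zs] have "w - sum_list zs \<in> K"
    using cvec.subspace_diff[OF K] by (fastforce simp: coset_eq[OF K] ps(2))
  then show "w \<in> sweedler X Y K f D"
    unfolding sweedler_def using ps zs d(1)
    by (auto intro!: exI[of _ ps] exI[of _ zs] exI[of _ "w - sum_list zs"])
qed

text \<open>If the relations of the target are the kernel of \<open>\<rho>\<close> on \<open>W\<close>, cosets are recorded by their
  value under \<open>\<rho>\<close>, and no linear choice of representatives is needed.\<close>

lemma sweedler_fiber:
  assumes X: "cvec.subspace X" and W: "cvec.subspace W" and \<rho>: "clinear \<rho>" and F: "clinear F"
    and f: "\<And>x y. x \<in> X \<Longrightarrow> y \<in> Y \<Longrightarrow> f x y \<noteq> {} \<and> f x y \<subseteq> {w \<in> W. \<rho> w = F (x \<otimes> y)}"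
    and d: "d \<in> D" "d \<in> cvec.span {x \<otimes> y |x y. x \<in> X \<and> y \<in> Y}"
    and D: "\<And>d'. d' \<in> D \<Longrightarrow> F d' = r"
  shows "sweedler X Y {w \<in> W. \<rho> w = 0} f D = {w \<in> W. \<rho> w = r}"
proof (intro equalityI subsetI)
  have sum: "sum_list zs \<in> W \<and> \<rho> (sum_list zs) = F (\<Sum>(x, y)\<leftarrow>ps. x \<otimes> y)"
    if "set ps \<subseteq> X \<times> Y" "list_all2 (\<lambda>(x, y) z. z \<in> f x y) ps zs" for ps zs
    using that(2,1)
  proof (induction rule: list_all2_induct)
    case Nil
    then show ?case by (simp add: clinear_zero[OF \<rho>] clinear_zero[OF F] cvec.subspace_0[OF W])
  next
    case (Cons p ps z zs)
    then show ?case using f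
      by (fastforce simp: clinear_add[OF \<rho>] clinear_add[OF F] intro: cvec.subspace_add[OF W])
  qed
  fix w
  {
    assume "w \<in> sweedler X Y {w \<in> W. \<rho> w = 0} f D"
    then obtain ps zs k where w: "w = sum_list zs + k" "set ps \<subseteq> X \<times> Y"
      "(\<Sum>(x, y)\<leftarrow>ps. x \<otimes> y) \<in> D" "list_all2 (\<lambda>(x, y) z. z \<in> f x y) ps zs" "k \<in> W" "\<rho> k = 0"
      unfolding sweedler_def by blast
    with sum[OF w(2,4)] D[OF w(3)] show "w \<in> {w \<in> W. \<rho> w = r}"
      by (simp add: clinear_add[OF \<rho>] cvec.subspace_add[OF W])
  }
  assume w: "w \<in> {w \<in> W. \<rho> w = r}"
  from d(2) obtain ps where ps: "set ps \<subseteq> X \<times> Y" "d = (\<Sum>(x, y)\<leftarrow>ps. x \<otimes> y)"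
    unfolding in_span_tensor_iff[OF X] by blast
  have "\<exists>zs. list_all2 (\<lambda>(x, y) z. z \<in> f x y) ps zs"
    by (rule list_all2_choose) (use ps(1) f in fastforce)
  then obtain zs where zs: "list_all2 (\<lambda>(x, y) z. z \<in> f x y) ps zs" ..
  from sum[OF ps(1) zs] D[OF d(1)] w
  have "w - sum_list zs \<in> W \<and> \<rho> (w - sum_list zs) = 0"
    by (simp add: ps(2) clinear_diff[OF \<rho>] cvec.subspace_diff[OF W])
  then show "w \<in> sweedler X Y {w \<in> W. \<rho> w = 0} f D"
    unfolding sweedler_def using ps zs d(1)
    by (auto intro!: exI[of _ ps] exI[of _ zs] exI[of _ "w - sum_list zs"])
qed

lemma tensor_lift_tensor_lift:
  "cbilinear f \<Longrightarrow> cbilinear g \<Longrightarrow>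
    tensor_lift f (tensor_lift g t) = tensor_lift (\<lambda>x y. tensor_lift f (g x y)) t"
  by (rule tensor_lift_compose[OF clinear_tensor_lift])

lemma tensor_lift_tensor_left: "cbilinear f \<Longrightarrow> tensor_lift f t \<otimes> z = tensor_lift (\<lambda>x y. f x y \<otimes> z) t"
  by (rule tensor_lift_compose[OF clinear_tensor_left[OF clinear_id]])

lemma tensor_lift_tensor_right: "cbilinear f \<Longrightarrow> z \<otimes> tensor_lift f t = tensor_lift (\<lambda>x y. z \<otimes> f x y) t"
  by (rule tensor_lift_compose[OF clinear_tensor_right[OF clinear_id]])

lemma cbilinear_tensor_mult:
  assumes "cbilinear m" "cbilinear m'"
  shows "cbilinear (tensor_mult m m')"
  unfolding tensor_mult_def
  by (simp add: lin_intros cbilinear_left[OF assms(1)] cbilinear_right[OF assms(1)]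
      cbilinear_left[OF assms(2)] cbilinear_right[OF assms(2)])

lemma tensor_mult_tensor:
  assumes "cbilinear m" "cbilinear m'"
  shows "tensor_mult m m' (x \<otimes> x') (y \<otimes> y') = m x y \<otimes> m' x' y'"
  unfolding tensor_mult_def
  by (simp add: lin_intros cbilinear_left[OF assms(1)] cbilinear_right[OF assms(1)]
      cbilinear_left[OF assms(2)] cbilinear_right[OF assms(2)])

lemma cbilinear_add:
  assumes "cbilinear m"
  shows "m (x + x') y = m x y + m x' y" "m x (y + y') = m x y + m x y'"
  using clinear_add[OF cbilinear_left[OF assms clinear_id]]
    clinear_add[OF cbilinear_right[OF assms clinear_id]] by auto

lemma cbilinear_scale:
  assumes "cbilinear m"
  shows "m (c *\<^sub>C x) y = c *\<^sub>C m x y" "m x (c *\<^sub>C y) = c *\<^sub>C m x y"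
  using clinear_scale[OF cbilinear_left[OF assms clinear_id]]
    clinear_scale[OF cbilinear_right[OF assms clinear_id]] by auto

lemma tensor_mult_assoc:
  assumes m: "cbilinear m" "cbilinear m'"
    and assoc: "\<And>x y z. m (m x y) z = m x (m y z)" "\<And>x y z. m' (m' x y) z = m' x (m' y z)"
  shows "tensor_mult m m' (tensor_mult m m' u v) w = tensor_mult m m' u (tensor_mult m m' v w)"
proof (induction u rule: tensor_induct)
  case (pure x x')
  show ?case
  proof (induction v rule: tensor_induct)
    case (pure y y')
    show ?case
      by (induction w rule: tensor_induct)
        (simp_all add: tensor_mult_tensor m assoc cbilinear_add[OF cbilinear_tensor_mult[OF m]])
  qed (simp add: cbilinear_add[OF cbilinear_tensor_mult[OF m]])
qed (simp add: cbilinear_add[OF cbilinear_tensor_mult[OF m]])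

lemma tensor_lift_minus:
  assumes "cbilinear f" "cbilinear g"
  shows "tensor_lift (\<lambda>x y. f x y - g x y) t = tensor_lift f t - tensor_lift g t"
proof -
  note lin = lin_intros clinear_tensor_lift cbilinear_left[OF assms(1)] cbilinear_right[OF assms(1)]
    cbilinear_left[OF assms(2)] cbilinear_right[OF assms(2)]
  show ?thesis
    by (rule fun_cong[of _ "\<lambda>t. tensor_lift f t - tensor_lift g t"], rule clinear_eqI)
      (simp_all add: lin assms)
qed

text \<open>An upper bound on the Sweedler set: it is enough that \<rho> vanishes on K, without K
  being its kernel. This suits relations on all of A \<otimes> A, whose quotient is not described
  explicitly.\<close>

lemma sweedler_value:
  assumes z: "z \<in> sweedler X Y K f D" and \<rho>: "clinear \<rho>" and F: "clinear F"
    and f: "\<And>x y w. w \<in> f x y \<Longrightarrow> \<rho> w = F (x \<otimes> y)"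
    and K: "\<And>k. k \<in> K \<Longrightarrow> \<rho> k = 0" and D: "\<And>d. d \<in> D \<Longrightarrow> F d = r"
  shows "\<rho> z = r"
proof -
  from z obtain ps zs k where w: "z = sum_list zs + k"
    "(\<Sum>(x, y)\<leftarrow>ps. x \<otimes> y) \<in> D" "list_all2 (\<lambda>(x, y) z. z \<in> f x y) ps zs" "k \<in> K"
    unfolding sweedler_def by blast
  have "\<rho> (sum_list zs) = F (\<Sum>(x, y)\<leftarrow>ps. x \<otimes> y)"
    using w(3)
    by (induction rule: list_all2_induct)
      (auto simp: clinear_zero[OF \<rho>] clinear_zero[OF F] clinear_add[OF \<rho>] clinear_add[OF F] f)
  then show ?thesis using w(1,2,4) D K by (simp add: clinear_add[OF \<rho>])
qed

text \<open>The counterpart of \<open>sweedler_value\<close>. The maps \<alpha> and \<beta> let a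
  decomposition be transported from another tensor product, for instance from A \<otimes> A to A
  \<otimes> H along \<open>proj\<close>.\<close>

lemma sweedler_memI:
  assumes T: "clinear T" and f: "\<And>p q. T (p \<otimes> q) \<in> f (\<alpha> p) (\<beta> q)"
    and \<alpha>: "clinear \<alpha>" and \<beta>: "clinear \<beta>" and D: "tensor_map \<alpha> \<beta> d \<in> D" and k: "k \<in> K"
  shows "T d + k \<in> sweedler UNIV UNIV K f D"
proof -
  obtain ps where d: "d = (\<Sum>(p, q)\<leftarrow>ps. p \<otimes> q)" by (rule tensor_sum_list)
  have "tensor_map \<alpha> \<beta> d = (\<Sum>(x, y)\<leftarrow>map (\<lambda>(p, q). (\<alpha> p, \<beta> q)) ps. x \<otimes> y)"
    unfolding d
    by (subst clinear_sum_list[OF clinear_tensor_map[OF \<alpha> \<beta>]])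
      (simp add: case_prod_unfold tensor_map_tensor \<alpha> \<beta> comp_def)
  moreover have "T d = sum_list (map (\<lambda>(p, q). T (p \<otimes> q)) ps)"
    unfolding d by (subst clinear_sum_list[OF T]) (simp add: case_prod_unfold)
  moreover have "list_all2 (\<lambda>(x, y) z. z \<in> f x y) (map (\<lambda>(p, q). (\<alpha> p, \<beta> q)) ps)
      (map (\<lambda>(p, q). T (p \<otimes> q)) ps)"
    by (induction ps) (auto simp: f)
  ultimately show ?thesis
    unfolding sweedler_def using D k
    by (intro CollectI exI[of _ "map (\<lambda>(p, q). (\<alpha> p, \<beta> q)) ps"]
        exI[of _ "map (\<lambda>(p, q). T (p \<otimes> q)) ps"] exI[of _ k]) simp
qed

lemma bilinear_tensor_eqI:
  assumes "cbilinear E" "cbilinear F" "\<And>x y z w. E (x \<otimes> y) (z \<otimes> w) = F (x \<otimes> y) (z \<otimes> w)"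
  shows "E u v = F u v"
proof (induction u rule: tensor_induct)
  case (pure x y)
  show ?case
    by (induction v rule: tensor_induct)
      (simp_all add: assms(3) cbilinear_add[OF assms(1)] cbilinear_add[OF assms(2)])
qed (simp add: cbilinear_add[OF assms(1)] cbilinear_add[OF assms(2)])

definition tensor_lift3 ::
    "('a::cvec \<Rightarrow> 'b::cvec \<Rightarrow> 'c::cvec \<Rightarrow> 'd::cvec) \<Rightarrow> 'a \<otimes> 'b \<otimes> 'c \<Rightarrow> 'd" where
  "tensor_lift3 f = tensor_lift (\<lambda>a t. tensor_lift (\<lambda>b c. f a b c) t)"

lemma
  assumes "\<And>b c. clinear (\<lambda>a. f a b c)" "\<And>a c. clinear (\<lambda>b. f a b c)" "\<And>a b. clinear (\<lambda>c. f a b c)"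
  shows clinear_tensor_lift3: "clinear (tensor_lift3 f)"
    and tensor_lift3_tensor: "tensor_lift3 f (a \<otimes> b \<otimes> c) = f a b c"
  unfolding tensor_lift3_def by (simp_all add: clinear_tensor_lift lin_intros assms)

lemma sweedler_nonempty:
  assumes "cvec.subspace X" "d \<in> D" "d \<in> cvec.span {x \<otimes> y |x y. x \<in> X \<and> y \<in> Y}"
    "\<And>x y. x \<in> X \<Longrightarrow> y \<in> Y \<Longrightarrow> f x y \<noteq> {}" "0 \<in> K"
  shows "sweedler X Y K f D \<noteq> {}"
proof -
  from assms(3) obtain ps where ps: "set ps \<subseteq> X \<times> Y" "d = (\<Sum>(x, y)\<leftarrow>ps. x \<otimes> y)"
    unfolding in_span_tensor_iff[OF assms(1)] by blast
  have "\<exists>zs. list_all2 (\<lambda>(x, y) z. z \<in> f x y) ps zs"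
    by (rule list_all2_choose) (use ps(1) assms(4) in fastforce)
  then obtain zs where "list_all2 (\<lambda>(x, y) z. z \<in> f x y) ps zs" ..
  with ps assms(2,5) have "sum_list zs + 0 \<in> sweedler X Y K f D"
    unfolding sweedler_def by blast
  then show ?thesis by blast
qed

section \<open>Quotients of involutive Hopf algebras\<close>

text \<open>Of H only the algebra and the counit are recorded, since every coaction below is the
  coproduct of A followed by \<open>proj\<close> on one leg. The antipode of A is involutive by
  axiom, which is what makes the flip preserve coinvariants.\<close>

locale hopf_quotient =
  fixes mul :: "'a::{cvec, one} \<Rightarrow> 'a \<Rightarrow> 'a"  (infixl \<open>\<cdot>\<close> 75)
    and comult :: "'a \<Rightarrow> 'a \<otimes> 'a"
    and counit :: "'a \<Rightarrow> complex"
    and antipode :: "'a \<Rightarrow> 'a"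
    and mulH :: "'h::{cvec, one} \<Rightarrow> 'h \<Rightarrow> 'h"  (infixl \<open>\<star>\<close> 75)
    and counitH :: "'h \<Rightarrow> complex"
    and proj :: "'a \<Rightarrow> 'h"
  assumes mul_bilinear: "cbilinear mul"
    and mul_assoc: "(x \<cdot> y) \<cdot> z = x \<cdot> (y \<cdot> z)"
    and mul_one [simp]: "1 \<cdot> x = x" "x \<cdot> 1 = x"
    and comult_linear: "clinear comult"
    and comult_one: "comult 1 = 1 \<otimes> 1"
    and comult_mul: "comult (x \<cdot> y) = tensor_mult mul mul (comult x) (comult y)"
    and coassoc: "tensor_lift (\<lambda>u v. tensor_lift (\<lambda>p q. p \<otimes> q \<otimes> v) (comult u)) (comult x) =
      tensor_lift (\<lambda>u v. u \<otimes> comult v) (comult x)"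
    and counit_linear: "clinear counit"
    and counit_left: "tensor_lift (\<lambda>u v. counit u *\<^sub>C v) (comult x) = x"
    and counit_right: "tensor_lift (\<lambda>u v. counit v *\<^sub>C u) (comult x) = x"
    and antipode_linear: "clinear antipode"
    and antipode_left: "tensor_lift (\<lambda>u v. antipode u \<cdot> v) (comult x) = counit x *\<^sub>C 1"
    and antipode_right: "tensor_lift (\<lambda>u v. u \<cdot> antipode v) (comult x) = counit x *\<^sub>C 1"
    and antipode_one: "antipode 1 = 1"
    and antipode_mul: "antipode (x \<cdot> y) = antipode y \<cdot> antipode x"
    and antipode_antipode [simp]: "antipode (antipode x) = x"
    and comult_antipode:
      "comult (antipode x) = tensor_lift (\<lambda>u v. antipode v \<otimes> antipode u) (comult x)"
    and mulH_bilinear: "cbilinear mulH"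
    and mulH_assoc: "(h \<star> k) \<star> l = h \<star> (k \<star> l)"
    and mulH_one [simp]: "1 \<star> h = h" "h \<star> 1 = h"
    and counitH_linear: "clinear counitH"
    and proj_linear: "clinear proj"
    and proj_one [simp]: "proj 1 = 1"
    and proj_mul: "proj (x \<cdot> y) = proj x \<star> proj y"
    and proj_surj: "surj proj"
    and counitH_proj [simp]: "counitH (proj x) = counit x"
begin

section \<open>Coactions, coinvariants and the product of the bialgebroid\<close>

definition coact :: "'a \<Rightarrow> 'a \<otimes> 'h"
  where "coact a = tensor_map (\<lambda>x. x) proj (comult a)"

definition base :: "'a set"
  where "base = {b. coact b = b \<otimes> 1}"

definition diag :: "'a \<otimes> 'a \<Rightarrow> ('a \<otimes> 'a) \<otimes> 'h" where
  "diag = tensor_lift (\<lambda>a a'.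
     tensor_lift (\<lambda>a0 a1.
       tensor_lift (\<lambda>b0 b1. (a0 \<otimes> b0) \<otimes> (a1 \<star> b1)) (coact a')) (coact a))"

definition es :: "('a \<otimes> 'a) set"
  where "es = {z. diag z = z \<otimes> 1}"

definition es_mul :: "'a \<otimes> 'a \<Rightarrow> 'a \<otimes> 'a \<Rightarrow> 'a \<otimes> 'a"  (infixl \<open>\<odot>\<close> 75)
  where "es_mul = tensor_mult mul (\<lambda>x y. y \<cdot> x)"

text \<open>Sweedler notation: \<open>sw E x\<close> is the sum of E(x_1, x_2) over the legs of the
  coproduct of x.\<close>

abbreviation sw :: "('a \<Rightarrow> 'a \<Rightarrow> 'c::cvec) \<Rightarrow> 'a \<Rightarrow> 'c"
  where "sw E x \<equiv> tensor_lift E (comult x)"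

lemma mul_op_bilinear: "cbilinear (\<lambda>x y. y \<cdot> x)"
  using mul_bilinear by (simp add: cbilinear_def)

lemma es_mul_bilinear: "cbilinear es_mul"
  unfolding es_mul_def by (rule cbilinear_tensor_mult[OF mul_bilinear mul_op_bilinear])

lemma es_mul_tensor [simp]: "(x \<otimes> y) \<odot> (z \<otimes> w) = (x \<cdot> z) \<otimes> (w \<cdot> y)"
  unfolding es_mul_def by (rule tensor_mult_tensor[OF mul_bilinear mul_op_bilinear])

lemmas lin = lin_intros
  cbilinear_left[OF mul_bilinear] cbilinear_right[OF mul_bilinear]
  cbilinear_left[OF mulH_bilinear] cbilinear_right[OF mulH_bilinear]
  cbilinear_left[OF es_mul_bilinear] cbilinear_right[OF es_mul_bilinear]
  clinear_compose[OF comult_linear] clinear_compose[OF counit_linear]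
  clinear_compose[OF antipode_linear] clinear_compose[OF counitH_linear]
  clinear_compose[OF proj_linear]

lemma coact_linear: "clinear coact"
  unfolding coact_def by (intro clinear_compose[OF clinear_tensor_map] lin proj_linear)

lemma tensor_lift_coact: "cbilinear E \<Longrightarrow> tensor_lift E (coact x) = sw (\<lambda>u v. E u (proj v)) x"
  unfolding coact_def by (rule tensor_lift_tensor_map[OF clinear_id proj_linear])

lemma coact_eq: "coact x = sw (\<lambda>u v. u \<otimes> proj v) x"
  by (simp add: coact_def tensor_map_def)

lemma coact_one [simp]: "coact 1 = 1 \<otimes> 1"
  by (simp add: coact_eq comult_one lin)

section \<open>Sweedler calculus in A\<close>

lemma sw_mul:
  assumes E: "cbilinear E"
  shows "sw E (x \<cdot> y) = sw (\<lambda>x1 x2. sw (\<lambda>y1 y2. E (x1 \<cdot> y1) (x2 \<cdot> y2)) y) x"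
  unfolding comult_mul tensor_mult_def
  by (simp add: tensor_lift_tensor_lift lin E)

lemma sw_antipode:
  assumes E: "cbilinear E"
  shows "sw E (antipode x) = sw (\<lambda>u v. E (antipode v) (antipode u)) x"
  unfolding comult_antipode by (simp add: tensor_lift_tensor_lift lin E)

text \<open>Composing \<open>coassoc\<close> with the map induced by a trilinear E gives the form in
  which Sweedler legs are regrouped, so that a leg and the antipode of its neighbour come to stand
  under one coproduct.\<close>

lemma sw_coassoc:
  assumes E: "\<And>q r. clinear (\<lambda>p. E p q r)" "\<And>p r. clinear (\<lambda>q. E p q r)" "\<And>p q. clinear (\<lambda>r. E p q r)"
  shows "sw (\<lambda>u r. sw (\<lambda>p q. E p q r) u) x = sw (\<lambda>p v. sw (\<lambda>q r. E p q r) v) x"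
proof -
  define T where "T = tensor_lift (\<lambda>p t. tensor_lift (\<lambda>q r. E p q r) t)"
  have T: "clinear T" unfolding T_def by (simp add: lin E clinear_tensor_lift)
  have T_tensor: "T (p \<otimes> t) = tensor_lift (\<lambda>q r. E p q r) t" for p t
    unfolding T_def by (simp add: lin E)
  have "T (sw (\<lambda>u v. sw (\<lambda>p q. p \<otimes> q \<otimes> v) u) x) = T (sw (\<lambda>u v. u \<otimes> comult v) x)"
    by (simp only: coassoc)
  then show ?thesis
    by (simp add: tensor_lift_compose[OF T] lin T_tensor E comult_linear)
qed

lemma sw_counit:
  assumes f: "clinear f"
  shows "sw (\<lambda>u v. counit u *\<^sub>C f v) x = f x" "sw (\<lambda>u v. counit v *\<^sub>C f u) x = f x"
  using tensor_lift_compose[OF f, of "\<lambda>u v. counit u *\<^sub>C v" "comult x"]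
    tensor_lift_compose[OF f, of "\<lambda>u v. counit v *\<^sub>C u" "comult x"]
  by (simp_all add: lin counit_linear counit_left counit_right clinear_scale[OF f])

lemma sw_antipode_cancel:
  fixes f :: "'a \<Rightarrow> 'b::cvec"
  assumes f: "clinear f"
  shows "sw (\<lambda>u v. f (antipode u \<cdot> v)) x = counit x *\<^sub>C f 1"
    and "sw (\<lambda>u v. f (u \<cdot> antipode v)) x = counit x *\<^sub>C f 1"
    and "sw (\<lambda>u v. f (antipode v \<cdot> u)) x = counit x *\<^sub>C f 1"
proof -
  have *: "sw (\<lambda>u v. f (antipode u \<cdot> v)) x = counit x *\<^sub>C f 1" if "clinear f" for f :: "'a \<Rightarrow> 'b"
    using tensor_lift_compose[OF that, of "\<lambda>u v. antipode u \<cdot> v" "comult x"]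
    by (simp add: lin antipode_linear antipode_left clinear_scale[OF that])
  from f show "sw (\<lambda>u v. f (antipode u \<cdot> v)) x = counit x *\<^sub>C f 1" by (rule *)
  show "sw (\<lambda>u v. f (u \<cdot> antipode v)) x = counit x *\<^sub>C f 1"
    using tensor_lift_compose[OF f, of "\<lambda>u v. u \<cdot> antipode v" "comult x"]
    by (simp add: lin antipode_linear antipode_right clinear_scale[OF f])
  \<comment> \<open>Involutivity enters here: S(S(u) v) = S(v) u, so this identity is the first one
    for the functional f composed with S.\<close>
  show "sw (\<lambda>u v. f (antipode v \<cdot> u)) x = counit x *\<^sub>C f 1"
    using *[of "\<lambda>z. f (antipode z)"]
    by (simp add: lin clinear_compose[OF f] antipode_linear antipode_mul antipode_one)
qed

lemmas lin' = lin clinear_compose[OF coact_linear]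

lemma diag_linear: "clinear diag"
  unfolding diag_def by (rule clinear_tensor_lift) (simp add: lin')

lemma diag_tensor:
  "diag (x \<otimes> y) = sw (\<lambda>x1 x2. sw (\<lambda>y1 y2. (x1 \<otimes> y1) \<otimes> (proj x2 \<star> proj y2)) y) x"
  unfolding diag_def by (simp add: lin' tensor_lift_coact)

lemma es_subspace: "cvec.subspace es"
  by (simp add: es_def cvec.subspace_def clinear_zero[OF diag_linear] clinear_add[OF diag_linear]
      clinear_scale[OF diag_linear] tensor_add_left tensor_scale_left
      clinear_zero[OF clinear_tensor_left[OF clinear_id]])

lemma base_subspace: "cvec.subspace base"
  by (simp add: base_def cvec.subspace_def clinear_zero[OF coact_linear] clinear_add[OF coact_linear]
      clinear_scale[OF coact_linear] tensor_add_left tensor_scale_left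
      clinear_zero[OF clinear_tensor_left[OF clinear_id]])

lemma one_base: "1 \<in> base"
  by (simp add: base_def)

lemma source_es: "b \<in> base \<Longrightarrow> b \<otimes> 1 \<in> es"
  unfolding es_def diag_def by (simp add: lin' base_def)

lemma target_es: "b \<in> base \<Longrightarrow> 1 \<otimes> b \<in> es"
  unfolding es_def diag_def by (simp add: lin' base_def)

lemma coact_mul: "coact (x \<cdot> y) = sw (\<lambda>x1 x2. sw (\<lambda>y1 y2. (x1 \<cdot> y1) \<otimes> (proj x2 \<star> proj y2)) y) x"
  by (simp add: coact_eq sw_mul lin proj_linear proj_mul)

lemma es_mul_assoc: "(u \<odot> v) \<odot> w = u \<odot> (v \<odot> w)"
  unfolding es_mul_def
  by (rule tensor_mult_assoc[OF mul_bilinear mul_op_bilinear]) (simp_all add: mul_assoc)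

lemma es_mul_one [simp]: "(1 \<otimes> 1) \<odot> u = u" "u \<odot> (1 \<otimes> 1) = u"
  by (induction u rule: tensor_induct) (simp_all add: cbilinear_add[OF es_mul_bilinear])

text \<open>The opposite product in the second factor puts the H-leg of z between those of u: the
  H-leg of (x \<otimes> y) \<odot> z is that of x, then that of z, then that of y. For coinvariant z
  the middle one is 1.\<close>

lemma diag_es_mul:
  assumes "z \<in> es"
  shows "diag (u \<odot> z) = tensor_map (\<lambda>w. w \<odot> z) (\<lambda>h. h) (diag u)"
proof -
  have eq: "diag ((x \<otimes> y) \<odot> v) = sw (\<lambda>x1 x2. tensor_lift (\<lambda>w h. sw (\<lambda>y1 y2.
      ((x1 \<otimes> y1) \<odot> w) \<otimes> (proj x2 \<star> (h \<star> proj y2))) y) (diag v)) x" for x y v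
    by (rule fun_cong[of _ _ v], rule clinear_eqI)
      (simp_all add: lin' clinear_compose[OF diag_linear] diag_linear diag_tensor sw_mul proj_linear
        tensor_lift_tensor_lift proj_mul mulH_assoc)
  show ?thesis
    by (rule fun_cong[of _ _ u], rule clinear_eqI)
      (use assms in \<open>simp_all add: lin' clinear_compose[OF diag_linear] eq es_def diag_linear
        clinear_compose[OF clinear_tensor_map] diag_tensor tensor_lift_compose[OF clinear_tensor_map]
        tensor_map_tensor proj_linear\<close>)
qed

lemma es_mul_closed: "u \<in> es \<Longrightarrow> v \<in> es \<Longrightarrow> u \<odot> v \<in> es"
  using diag_es_mul[of v u] by (simp add: es_def tensor_map_tensor lin)

definition mult :: "'a \<otimes> 'a \<Rightarrow> 'a"
  where "mult = tensor_lift mul"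

lemma mult_linear: "clinear mult"
  unfolding mult_def by (rule clinear_tensor_lift[OF mul_bilinear])

lemma mult_tensor [simp]: "mult (x \<otimes> y) = x \<cdot> y"
  unfolding mult_def by (simp add: mul_bilinear)

text \<open>Multiplication A \<otimes> A \<rightarrow> A is H-colinear because \<open>coact\<close>
  is multiplicative.\<close>

lemma mult_base:
  assumes "z \<in> es"
  shows "mult z \<in> base"
proof -
  have eq: "coact (mult v) = tensor_map mult (\<lambda>h. h) (diag v)" for v
    by (rule fun_cong[of _ _ v], rule clinear_eqI)
      (simp_all add: lin' clinear_compose[OF diag_linear] mult_linear clinear_compose[OF mult_linear]
        coact_mul diag_tensor tensor_map_tensor diag_linear proj_linear
        clinear_compose[OF clinear_tensor_map] tensor_lift_compose[OF clinear_tensor_map])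
  then show ?thesis
    using assms by (simp add: es_def base_def tensor_map_tensor lin mult_linear)
qed

lemma mul_base: "b \<in> base \<Longrightarrow> c \<in> base \<Longrightarrow> b \<cdot> c \<in> base"
  using mult_base[OF es_mul_closed[OF source_es target_es], of b c] by simp

section \<open>Coinvariants of A \<otimes> A described by A \<otimes> B\<close>

definition cmap :: "'a \<Rightarrow> 'a \<otimes> 'a"
  where "cmap a = sw (\<lambda>u v. u \<otimes> antipode v) a"

lemma cmap_linear: "clinear cmap"
  unfolding cmap_def by (simp add: lin antipode_linear comult_linear)

text \<open>The antipode reverses the legs of its argument, so the H-leg of a_1 \<otimes> S(a_2) is
  the image of a product x S(y) of neighbouring legs, which collapses to a counit.\<close>

lemma cmap_es: "cmap a \<in> es"
proof -
  have "diag (cmap a) = sw (\<lambda>u v. sw (\<lambda>p q. sw (\<lambda>r s.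
      (p \<otimes> antipode s) \<otimes> proj (q \<cdot> antipode r)) v) u) a"
    by (simp add: cmap_def tensor_lift_compose[OF diag_linear] lin antipode_linear diag_tensor
        sw_antipode proj_linear proj_mul)
  also have "\<dots> = sw (\<lambda>p w. sw (\<lambda>u s. sw (\<lambda>q r.
      (p \<otimes> antipode s) \<otimes> proj (q \<cdot> antipode r)) u) w) a"
    by (simp add: sw_coassoc lin antipode_linear comult_linear)
  also have "\<dots> = cmap a \<otimes> 1"
  proof -
    have "sw (\<lambda>q r. (p \<otimes> antipode s) \<otimes> proj (q \<cdot> antipode r)) u =
        counit u *\<^sub>C ((p \<otimes> antipode s) \<otimes> 1)" for p s u :: 'a
      by (subst sw_antipode_cancel(2)[where f = "\<lambda>z. (p \<otimes> antipode s) \<otimes> proj z"])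
        (simp_all add: lin proj_linear)
    moreover have "sw (\<lambda>u s. counit u *\<^sub>C ((p \<otimes> antipode s) \<otimes> 1)) w = (p \<otimes> antipode w) \<otimes> (1 :: 'h)" for p w :: 'a
      by (rule sw_counit(1)) (simp add: lin antipode_linear)
    ultimately show ?thesis
      by (simp add: cmap_def tensor_lift_tensor_left lin antipode_linear)
  qed
  finally show ?thesis by (simp add: es_def)
qed

definition left_coact :: "'a \<otimes> 'a \<Rightarrow> 'a \<otimes> 'a \<otimes> 'a"
  where "left_coact = tensor_lift (\<lambda>x y. sw (\<lambda>u v. u \<otimes> v \<otimes> y) x)"

lemma left_coact_linear: "clinear left_coact"
  unfolding left_coact_def by (simp add: clinear_tensor_lift lin comult_linear)

lemma left_coact_tensor: "left_coact (x \<otimes> y) = sw (\<lambda>u v. u \<otimes> v \<otimes> y) x"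
  unfolding left_coact_def by (simp add: lin comult_linear)

text \<open>Comultiplying the first factor on the left commutes with the diagonal coaction of H on
  the right. Hence \<open>left_coact z\<close> is killed by id \<otimes> (\<open>diag\<close> minus
  the trivial coaction), and exactness places it in A \<otimes> \<open>es\<close>.\<close>

lemma left_coact_es:
  assumes "z \<in> es"
  shows "left_coact z \<in> cvec.span {a \<otimes> c |a c. c \<in> es}"
proof -
  \<comment> \<open>The left coaction on the first component of (A \<otimes> A) \<otimes> H, with H
    as spectator.\<close>
  define \<Lambda> where "\<Lambda> = tensor_lift (\<lambda>w k. tensor_lift (\<lambda>x y. sw (\<lambda>u v. u \<otimes> (v \<otimes> (y :: 'a)) \<otimes> (k :: 'h)) x) w)"
  have \<Lambda>: "clinear \<Lambda>" unfolding \<Lambda>_def by (simp add: clinear_tensor_lift lin comult_linear)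
  have \<Lambda>_tensor: "\<Lambda> ((x \<otimes> y) \<otimes> k) = sw (\<lambda>u v. u \<otimes> (v \<otimes> y) \<otimes> k) x" for x y k
    unfolding \<Lambda>_def by (simp add: lin comult_linear)
  define K where "K c = diag c - c \<otimes> (1 :: 'h)" for c
  have K: "clinear K" unfolding K_def by (simp add: lin diag_linear)
  have K_tensor: "a \<otimes> K c = a \<otimes> diag c - a \<otimes> (c \<otimes> 1)" for a :: 'a and c
    unfolding K_def by (rule clinear_diff[OF clinear_tensor_right[OF clinear_id]])
  have "\<Lambda> (diag v) = tensor_map (\<lambda>x. x) diag (left_coact v)" for v
  proof (rule fun_cong[of _ _ v], rule clinear_eqI)
    fix x y
    have "\<Lambda> (diag (x \<otimes> y)) = sw (\<lambda>x1 x2. sw (\<lambda>y1 y2. sw (\<lambda>u v.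
        u \<otimes> (v \<otimes> y1) \<otimes> (proj x2 \<star> proj y2)) x1) y) x"
      by (simp add: diag_tensor tensor_lift_compose[OF \<Lambda>] lin proj_linear \<Lambda>_tensor)
    also have "\<dots> = sw (\<lambda>x1 x2. sw (\<lambda>u v. sw (\<lambda>y1 y2.
        u \<otimes> (v \<otimes> y1) \<otimes> (proj x2 \<star> proj y2)) y) x1) x"
      by (intro arg_cong2[where f = tensor_lift] ext refl tensor_lift_swap) (simp_all add: lin proj_linear)
    also have "\<dots> = tensor_map (\<lambda>x. x) diag (left_coact (x \<otimes> y))"
      by (simp add: sw_coassoc lin proj_linear left_coact_tensor
          tensor_lift_compose[OF clinear_tensor_map] diag_linear comult_linear tensor_map_tensor diag_tensor
          tensor_lift_tensor_right)
    finally show "\<Lambda> (diag (x \<otimes> y)) = tensor_map (\<lambda>x. x) diag (left_coact (x \<otimes> y))" .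
  qed (simp_all add: clinear_compose[OF \<Lambda>] diag_linear clinear_compose[OF clinear_tensor_map] lin
      left_coact_linear)
  moreover have "\<Lambda> (v \<otimes> 1) = tensor_map (\<lambda>x. x) (\<lambda>c. c \<otimes> 1) (left_coact v)" for v
    by (rule fun_cong[of _ _ v], rule clinear_eqI)
      (simp_all add: clinear_compose[OF \<Lambda>] lin clinear_compose[OF clinear_tensor_map] \<Lambda>_tensor
        left_coact_linear left_coact_tensor tensor_lift_compose[OF clinear_tensor_map] tensor_map_tensor)
  moreover have "tensor_map (\<lambda>x. x) K t = tensor_map (\<lambda>x. x) diag t - tensor_map (\<lambda>x. x) (\<lambda>c. c \<otimes> 1) t"
    for t :: "'a \<otimes> 'a \<otimes> 'a"
    by (rule fun_cong[of _ _ t], rule clinear_eqI)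
      (simp_all add: lin clinear_tensor_map K diag_linear tensor_map_tensor K_tensor)
  ultimately have "tensor_map (\<lambda>x. x) K (left_coact z) = \<Lambda> (diag z) - \<Lambda> (z \<otimes> 1)" by simp
  also have "\<dots> = 0" using assms by (simp add: es_def)
  finally have "left_coact z \<in> cvec.span {x \<otimes> y |x y. K y = 0}" by (rule tensor_kernel[OF K])
  then show ?thesis by (simp add: K_def es_def)
qed

text \<open>Factoring through \<open>left_coact\<close> makes it visible that coinvariants go to A
  \<otimes> B: the second leg is coinvariant before it is multiplied out.\<close>

definition shear :: "'a \<otimes> 'a \<Rightarrow> 'a \<otimes> 'a"
  where "shear z = tensor_map (\<lambda>x. x) mult (left_coact z)"

definition unshear :: "'a \<otimes> 'a \<Rightarrow> 'a \<otimes> 'a"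
  where "unshear = tensor_lift (\<lambda>a b. (1 \<otimes> b) \<odot> cmap a)"

lemma unshear_linear: "clinear unshear"
  unfolding unshear_def by (simp add: clinear_tensor_lift lin cmap_linear)

lemma unshear_tensor: "unshear (a \<otimes> b) = (1 \<otimes> b) \<odot> cmap a"
  unfolding unshear_def by (simp add: lin cmap_linear)

lemma target_cmap: "(1 \<otimes> b) \<odot> cmap a = sw (\<lambda>u v. u \<otimes> (antipode v \<cdot> b)) a"
  by (simp add: cmap_def tensor_lift_compose[OF cbilinear_right[OF es_mul_bilinear clinear_id]]
      lin antipode_linear)

lemma shear_tensor: "shear (x \<otimes> y) = sw (\<lambda>u v. u \<otimes> (v \<cdot> y)) x"
  by (simp add: shear_def left_coact_tensor tensor_lift_compose[OF clinear_tensor_map]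
      lin mult_linear tensor_map_tensor)

lemma shear_linear: "clinear shear"
  unfolding shear_def
  by (rule clinear_compose[OF clinear_tensor_map[OF clinear_id mult_linear] left_coact_linear])

lemma sw_cancel_12:
  assumes "\<And>r. clinear (\<lambda>p. E p r)" "\<And>p. clinear (\<lambda>r. E p r)"
  shows "sw (\<lambda>p w. sw (\<lambda>q r. E p (antipode q \<cdot> (r \<cdot> y))) w) x = E x y"
    and "sw (\<lambda>p w. sw (\<lambda>q r. E p (q \<cdot> (antipode r \<cdot> y))) w) x = E x y"
proof -
  have E: "clinear (\<lambda>z. E p (z \<cdot> y))" for p
    by (rule clinear_compose[OF assms(2)]) (simp add: lin)
  have "sw (\<lambda>q r. E p (antipode q \<cdot> (r \<cdot> y))) w = counit w *\<^sub>C E p y"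
    "sw (\<lambda>q r. E p (q \<cdot> (antipode r \<cdot> y))) w = counit w *\<^sub>C E p y" for p w
    using sw_antipode_cancel(1)[OF E, of p w] sw_antipode_cancel(2)[OF E, of p w]
    by (simp_all add: mul_assoc)
  then show "sw (\<lambda>p w. sw (\<lambda>q r. E p (antipode q \<cdot> (r \<cdot> y))) w) x = E x y"
    "sw (\<lambda>p w. sw (\<lambda>q r. E p (q \<cdot> (antipode r \<cdot> y))) w) x = E x y"
    using sw_counit(2)[of "\<lambda>p. E p y" x] assms(1) by simp_all
qed

lemma unshear_shear: "unshear (shear z) = z"
proof (rule fun_cong[of _ _ z], rule clinear_eqI)
  fix x y
  have "unshear (shear (x \<otimes> y)) = sw (\<lambda>p w. sw (\<lambda>q r. p \<otimes> (antipode q \<cdot> (r \<cdot> y))) w) x"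
    by (simp add: shear_tensor tensor_lift_compose[OF unshear_linear] lin unshear_tensor target_cmap
        sw_coassoc antipode_linear)
  also have "\<dots> = x \<otimes> y"
    by (rule sw_cancel_12) (simp_all add: lin)
  finally show "unshear (shear (x \<otimes> y)) = x \<otimes> y" .
qed (simp_all add: clinear_compose[OF unshear_linear] shear_linear clinear_id)

lemma shear_es: "z \<in> es \<Longrightarrow> shear z \<in> cvec.span {a \<otimes> b |a b. b \<in> base}"
  unfolding shear_def
proof (rule clinear_span[OF clinear_tensor_map left_coact_es])
  fix y assume "y \<in> {a \<otimes> c |a c. c \<in> es}"
  then show "tensor_map (\<lambda>x. x) mult y \<in> cvec.span {a \<otimes> b |a b. b \<in> base}"
    by (auto simp: tensor_map_tensor mult_linear clinear_id) (blast intro: cvec.span_base mult_base)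
qed (simp_all add: clinear_id mult_linear)

text \<open>The antipode in \<open>unshear (a \<otimes> b) = a\<^sub>(\<^sub>1\<^sub>) \<otimes> S(a\<^sub>(\<^sub>2\<^sub>)) b\<close> is involutive, so that also
  \<open>S(a\<^sub>(\<^sub>2\<^sub>)) a\<^sub>(\<^sub>1\<^sub>) = \<epsilon>(a)\<close>; this makes the flipped element coinvariant.\<close>

lemma flip_es:
  assumes "z \<in> es"
  shows "flip z \<in> es"
proof -
  have gen: "diag (flip (unshear (a \<otimes> b))) = flip (unshear (a \<otimes> b)) \<otimes> 1" if b: "b \<in> base" for a b
  proof -
    have "diag (flip (unshear (a \<otimes> b))) = sw (\<lambda>u v. sw (\<lambda>r s. sw (\<lambda>p q.
        ((antipode s \<cdot> b) \<otimes> p) \<otimes> proj (antipode r \<cdot> q)) u) v) a"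
    proof -
      \<comment> \<open>The coinvariant b contributes only 1 to the H-leg.\<close>
      have coact: "coact (x \<cdot> b) = sw (\<lambda>x1 x2. (x1 \<cdot> b) \<otimes> proj x2) x" for x
      proof -
        have "coact (x \<cdot> b) = sw (\<lambda>x1 x2. tensor_lift (\<lambda>y1 y2. (x1 \<cdot> y1) \<otimes> (proj x2 \<star> y2)) (coact b)) x"
          by (simp add: coact_mul tensor_lift_coact lin proj_linear)
        also have "\<dots> = sw (\<lambda>x1 x2. (x1 \<cdot> b) \<otimes> proj x2) x"
          using b by (simp add: base_def lin)
        finally show ?thesis .
      qed
      have "diag (y \<otimes> x) = tensor_lift (\<lambda>y1 y2. sw (\<lambda>x1 x2. (y1 \<otimes> x1) \<otimes> (y2 \<star> proj x2)) x) (coact y)" for x y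
        by (simp add: diag_tensor tensor_lift_coact lin proj_linear)
      then show ?thesis
        by (simp add: unshear_tensor target_cmap tensor_lift_compose[OF clinear_flip] lin antipode_linear
          flip_tensor tensor_lift_compose[OF diag_linear] coact tensor_lift_tensor_lift proj_linear
          sw_antipode proj_mul)
    qed
    also have "\<dots> = sw (\<lambda>u v. sw (\<lambda>p q. sw (\<lambda>r s.
        ((antipode s \<cdot> b) \<otimes> p) \<otimes> proj (antipode r \<cdot> q)) v) u) a"
      by (intro arg_cong2[where f = tensor_lift] ext refl tensor_lift_swap)
        (simp_all add: lin antipode_linear proj_linear)
    also have "\<dots> = sw (\<lambda>p w. sw (\<lambda>u s. sw (\<lambda>q r.
        ((antipode s \<cdot> b) \<otimes> p) \<otimes> proj (antipode r \<cdot> q)) u) w) a"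
      by (simp add: sw_coassoc lin antipode_linear comult_linear proj_linear)
    also have "\<dots> = flip (unshear (a \<otimes> b)) \<otimes> 1"
    proof -
      have "sw (\<lambda>q r. ((antipode s \<cdot> b) \<otimes> p) \<otimes> proj (antipode r \<cdot> q)) u =
          counit u *\<^sub>C (((antipode s \<cdot> b) \<otimes> p) \<otimes> 1)" for p s u :: 'a
        by (subst sw_antipode_cancel(3)[where f = "\<lambda>z. ((antipode s \<cdot> b) \<otimes> p) \<otimes> proj z"])
          (simp_all add: lin proj_linear)
      moreover have "sw (\<lambda>u s. counit u *\<^sub>C (((antipode s \<cdot> b) \<otimes> p) \<otimes> 1)) w =
          ((antipode w \<cdot> b) \<otimes> p) \<otimes> (1 :: 'h)" for p w :: 'a
        by (rule sw_counit(1)) (simp add: lin antipode_linear)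
      ultimately show ?thesis
        by (simp add: unshear_tensor target_cmap tensor_lift_compose[OF clinear_flip] lin antipode_linear
          flip_tensor tensor_lift_tensor_left)
    qed
    finally show ?thesis .
  qed
  \<comment> \<open>Every z in \<open>es\<close> is the unshearing of \<open>shear z\<close>, which
    lies in the span of the a \<otimes> b with b in \<open>base\<close>; the generators treated
    above therefore suffice.\<close>
  have "(\<lambda>w. diag (flip (unshear w)) - flip (unshear w) \<otimes> 1) (shear z) \<in> {0}"
  proof (rule clinear_span[OF _ shear_es[OF assms]])
    show "clinear (\<lambda>w. diag (flip (unshear w)) - flip (unshear w) \<otimes> 1)"
      by (simp add: lin clinear_compose[OF diag_linear] clinear_compose[OF clinear_flip] unshear_linear)
  qed (auto simp: gen cvec.subspace_single_0)
  then show ?thesis by (simp add: unshear_shear es_def)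
qed

section \<open>The balanced square of the bialgebroid and its embedding\<close>

definition es_rel :: "(('a \<otimes> 'a) \<otimes> 'a \<otimes> 'a) set" where
  "es_rel = balancing es es base (\<lambda>x b. (1 \<otimes> b) \<odot> x) (\<lambda>b y. (b \<otimes> 1) \<odot> y)"

definition es2 :: "(('a \<otimes> 'a) \<otimes> 'a \<otimes> 'a) set"
  where "es2 = cvec.span {x \<otimes> y |x y. x \<in> es \<and> y \<in> es}"

text \<open>Multiplication of the inner factors embeds the balanced square of the bialgebroid into
  \<open>A \<otimes> A \<otimes> A\<close>.\<close>

definition contract :: "('a \<otimes> 'a) \<otimes> 'a \<otimes> 'a \<Rightarrow> 'a \<otimes> 'a \<otimes> 'a" where
  "contract = tensor_lift (\<lambda>u v. tensor_lift (\<lambda>x y. tensor_lift (\<lambda>z w. x \<otimes> (y \<cdot> z) \<otimes> w) v) u)"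

lemma contract_linear: "clinear contract"
  unfolding contract_def by (simp add: clinear_tensor_lift lin)

lemma contract_tensor: "contract ((x \<otimes> y) \<otimes> z \<otimes> w) = x \<otimes> (y \<cdot> z) \<otimes> w"
  unfolding contract_def by (simp add: lin)

lemma es2_subspace: "cvec.subspace es2"
  by (simp add: es2_def)

lemma es2I: "x \<in> es \<Longrightarrow> y \<in> es \<Longrightarrow> x \<otimes> y \<in> es2"
  unfolding es2_def by (rule cvec.span_base) blast

lemma es_rel_subspace: "cvec.subspace es_rel"
  by (simp add: es_rel_def balancing_def)

lemma contract_balanced: "contract (((1 \<otimes> b) \<odot> u) \<otimes> v) = contract (u \<otimes> ((b \<otimes> 1) \<odot> v))"
proof (induction u rule: tensor_induct)
  case (pure x y)
  show ?case
    by (induction v rule: tensor_induct)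
      (simp_all add: contract_tensor mul_assoc cbilinear_add[OF es_mul_bilinear] tensor_add_right
        clinear_add[OF contract_linear])
qed (simp add: cbilinear_add[OF es_mul_bilinear] tensor_add_left clinear_add[OF contract_linear])

text \<open>One inclusion is balancedness of the inner product. For the other, the map Q inverts
  \<open>contract\<close> modulo \<open>es_rel\<close> on tensors of coinvariants, so an element
  with vanishing contraction is itself a relation.\<close>

lemma es_rel_eq: "es_rel = {d \<in> es2. contract d = 0}"
proof (intro equalityI subsetI)
  fix d assume "d \<in> es_rel"
  then have d: "d \<in> cvec.span {((1 \<otimes> b) \<odot> x) \<otimes> y - x \<otimes> ((b \<otimes> 1) \<odot> y) |x y b. x \<in> es \<and> y \<in> es \<and> b \<in> base}"
    by (simp add: es_rel_def balancing_def)
  have "d \<in> es2"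
    by (rule clinear_span[OF clinear_id d])
      (auto intro!: cvec.subspace_diff[OF es2_subspace] es2I es_mul_closed source_es target_es es2_subspace)
  moreover have "contract d \<in> {0}"
    by (rule clinear_span[OF contract_linear d])
      (auto simp: clinear_diff[OF contract_linear] contract_balanced cvec.subspace_single_0)
  ultimately show "d \<in> {d \<in> es2. contract d = 0}" by simp
next
  \<comment> \<open>Unshearing writes x \<otimes> y as the target of x_2 y acting on
    \<open>cmap x_1\<close>. Moving the coefficient x_2 y across the balanced tensor sign turns (x
    \<otimes> y) \<otimes> (z \<otimes> w) into \<open>cmap x_1\<close> \<otimes> (x_2 y z \<otimes>
    w), which involves y and z only through y z.\<close>
  define Q where "Q = tensor_lift (\<lambda>a t. tensor_lift (\<lambda>q w.
    sw (\<lambda>a1 a2. cmap a1 \<otimes> (a2 \<cdot> q) \<otimes> (w :: 'a)) a) t)"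
  have Q: "clinear Q" unfolding Q_def by (simp add: clinear_tensor_lift lin clinear_compose[OF cmap_linear] comult_linear)
  have Q_tensor: "Q (a \<otimes> q \<otimes> w) = sw (\<lambda>a1 a2. cmap a1 \<otimes> (a2 \<cdot> q) \<otimes> w) a" for a q w
    unfolding Q_def by (simp add: lin clinear_compose[OF cmap_linear] comult_linear)
  \<comment> \<open>On a generator of \<open>es\<close> over \<open>base\<close>, applying Q after
    \<open>contract\<close> has just the effect of moving b from the left tensor factor to the right
    one.\<close>
  have pure: "Q (contract (unshear (a \<otimes> b) \<otimes> v)) = cmap a \<otimes> ((b \<otimes> 1) \<odot> v)" for a b v
  proof (rule fun_cong[of _ _ v], rule clinear_eqI)
    fix z w :: 'a
    have "unshear (a \<otimes> b) \<otimes> z \<otimes> w = sw (\<lambda>u v. (u \<otimes> (antipode v \<cdot> b)) \<otimes> z \<otimes> w) a"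
      by (simp add: unshear_tensor target_cmap tensor_lift_tensor_left lin antipode_linear)
    then have "Q (contract (unshear (a \<otimes> b) \<otimes> z \<otimes> w)) =
        sw (\<lambda>p w'. sw (\<lambda>q r. cmap p \<otimes> (q \<cdot> (antipode r \<cdot> (b \<cdot> z))) \<otimes> w) w') a"
      by (simp add: tensor_lift_compose[OF contract_linear] lin antipode_linear contract_tensor
        tensor_lift_compose[OF Q] Q_tensor sw_coassoc clinear_compose[OF cmap_linear] cmap_linear mul_assoc)
    also have "\<dots> = cmap a \<otimes> (b \<cdot> z) \<otimes> w"
      by (rule sw_cancel_12(2)) (simp_all add: lin cmap_linear)
    finally show "Q (contract (unshear (a \<otimes> b) \<otimes> z \<otimes> w)) = cmap a \<otimes> ((b \<otimes> 1) \<odot> (z \<otimes> w))" by simp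
  qed (simp_all add: lin clinear_compose[OF Q] clinear_compose[OF contract_linear])
  have section_rel: "u \<otimes> v - Q (contract (u \<otimes> v)) \<in> es_rel" if "u \<in> es" "v \<in> es" for u v
  proof -
    have "(\<lambda>w. unshear w \<otimes> v - Q (contract (unshear w \<otimes> v))) (shear u) \<in> es_rel"
    proof (rule clinear_span[OF _ shear_es[OF that(1)]])
      show "clinear (\<lambda>w. unshear w \<otimes> v - Q (contract (unshear w \<otimes> v)))"
        by (simp add: lin clinear_compose[OF Q] clinear_compose[OF contract_linear] unshear_linear)
      fix y :: "'a \<otimes> 'a" assume "y \<in> {a \<otimes> b |a b. b \<in> base}"
      then obtain a b where y: "y = a \<otimes> b" "b \<in> base" by blast
      then show "unshear y \<otimes> v - Q (contract (unshear y \<otimes> v)) \<in> es_rel"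
        unfolding y(1) pure unfolding unshear_tensor es_rel_def balancing_def
        by (intro cvec.span_base CollectI exI[of _ "cmap a"] exI[of _ v] exI[of _ b])
          (simp add: that(2) cmap_es)
    qed (rule es_rel_subspace)
    then show ?thesis by (simp add: unshear_shear)
  qed
  fix d assume d: "d \<in> {d \<in> es2. contract d = 0}"
  have "d - Q (contract d) \<in> es_rel"
  proof (rule clinear_span[where f = "\<lambda>d. d - Q (contract d)" and x = d])
    show "clinear (\<lambda>d. d - Q (contract d))"
      by (intro lin clinear_compose[OF Q contract_linear])
    show "d \<in> cvec.span {x \<otimes> y |x y. x \<in> es \<and> y \<in> es}"
      using d by (simp add: es2_def)
  qed (use section_rel es_rel_subspace in blast)+
  with d show "d \<in> es_rel" by (simp add: clinear_zero[OF Q])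
qed

definition cop_lift :: "'a \<otimes> 'a \<Rightarrow> ('a \<otimes> 'a) \<otimes> 'a \<otimes> 'a"
  where "cop_lift z = tensor_map cmap (\<lambda>x. x) (left_coact z)"

definition insert_one :: "'a \<otimes> 'a \<Rightarrow> 'a \<otimes> 'a \<otimes> 'a"
  where "insert_one = tensor_lift (\<lambda>x y. x \<otimes> 1 \<otimes> y)"

lemma insert_one_linear: "clinear insert_one"
  unfolding insert_one_def by (simp add: clinear_tensor_lift lin)

lemma insert_one_tensor: "insert_one (x \<otimes> y) = x \<otimes> 1 \<otimes> y"
  unfolding insert_one_def by (simp add: lin)

lemma cop_lift_linear: "clinear cop_lift"
  unfolding cop_lift_def
  by (rule clinear_compose[OF clinear_tensor_map[OF cmap_linear clinear_id] left_coact_linear])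

lemma cop_lift_tensor: "cop_lift (x \<otimes> y) = sw (\<lambda>u v. cmap u \<otimes> v \<otimes> y) x"
  by (simp add: cop_lift_def left_coact_tensor tensor_lift_compose[OF clinear_tensor_map]
      lin cmap_linear tensor_map_tensor)

text \<open>\<open>left_coact\<close> leaves a coinvariant in the right factor, and
  \<open>cmap\<close> produces one in the left factor from an arbitrary leg.\<close>

lemma cop_lift_es2: "z \<in> es \<Longrightarrow> cop_lift z \<in> es2"
  unfolding cop_lift_def
proof (rule clinear_span[OF clinear_tensor_map left_coact_es])
  fix y :: "'a \<otimes> 'a \<otimes> 'a" assume "y \<in> {a \<otimes> c |a c. c \<in> es}"
  then show "tensor_map cmap (\<lambda>x. x) y \<in> es2"
    by (auto simp: tensor_map_tensor cmap_linear clinear_id cmap_es intro!: es2I)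
qed (simp_all add: clinear_id cmap_linear es2_subspace)

text \<open>The inner legs of x meet as S(x_2) x_3 and cancel.\<close>

lemma contract_cop_lift: "contract (cop_lift z) = insert_one z"
proof (rule fun_cong[of _ _ z], rule clinear_eqI)
  fix x y
  have "contract (cop_lift (x \<otimes> y)) = sw (\<lambda>p w. sw (\<lambda>q r. p \<otimes> (antipode q \<cdot> (r \<cdot> 1)) \<otimes> y) w) x"
    by (simp add: cop_lift_tensor cmap_def tensor_lift_tensor_left lin tensor_lift_compose[OF contract_linear]
        contract_tensor sw_coassoc antipode_linear comult_linear)
  also have "\<dots> = insert_one (x \<otimes> y)"
    unfolding insert_one_tensor by (rule sw_cancel_12) (simp_all add: lin)
  finally show "contract (cop_lift (x \<otimes> y)) = insert_one (x \<otimes> y)" .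
qed (simp_all add: clinear_compose[OF contract_linear] cop_lift_linear insert_one_linear)

subsection \<open>The canonical map\<close>

definition AB_rel :: "('a \<otimes> 'a) set"
  where "AB_rel = balancing UNIV UNIV base mul mul"

definition AB :: "('a \<otimes> 'a) set set"
  where "AB = balanced_tensor UNIV UNIV base mul mul"

definition can_lift :: "'a \<otimes> 'a \<Rightarrow> 'a \<otimes> 'h" where
  "can_lift = tensor_lift (\<lambda>a' a. tensor_lift (\<lambda>a0 a1. (a' \<cdot> a0) \<otimes> a1) (coact a))"

definition can :: "('a \<otimes> 'a) set \<Rightarrow> 'a \<otimes> 'h"
  where "can D = the_elem (can_lift ` D)"

definition transl :: "'h \<Rightarrow> ('a \<otimes> 'a) set"
  where "transl h = the_inv_into AB can (1 \<otimes> h)"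

definition full_rel :: "(('a \<otimes> 'a) \<otimes> 'a \<otimes> 'a) set" where
  "full_rel = balancing UNIV UNIV base (\<lambda>x b. (1 \<otimes> b) \<odot> x) (\<lambda>b y. (b \<otimes> 1) \<odot> y)"

definition cop_formula :: "'a \<otimes> 'a \<Rightarrow> (('a \<otimes> 'a) \<otimes> 'a \<otimes> 'a) set" where
  "cop_formula h =
     sweedler UNIV UNIV full_rel (\<lambda>a a'.
       sweedler UNIV UNIV full_rel (\<lambda>a0 a1.
         sweedler UNIV UNIV full_rel (\<lambda>u v. {(a0 \<otimes> u) \<otimes> (v \<otimes> a')}) (transl a1))
       {coact a}) {h}"

definition cop :: "'a \<otimes> 'a \<Rightarrow> (('a \<otimes> 'a) \<otimes> 'a \<otimes> 'a) set" where
  "cop h = (THE D.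
     D \<in> balanced_tensor es es base (\<lambda>x b. (1 \<otimes> b) \<odot> x) (\<lambda>b y. (b \<otimes> 1) \<odot> y) \<and>
     D \<subseteq> cop_formula h)"

lemma AB_rel_subspace: "cvec.subspace AB_rel"
  by (simp add: AB_rel_def balancing_def)

lemma AB_relI: "b \<in> base \<Longrightarrow> (x \<cdot> b) \<otimes> y - x \<otimes> (b \<cdot> y) \<in> AB_rel"
  unfolding AB_rel_def balancing_def by (rule cvec.span_base) blast

lemma AB_eq: "AB = range (coset AB_rel)"
proof -
  have "t \<in> cvec.span {x \<otimes> y |x y. x \<in> UNIV \<and> y \<in> UNIV}" for t :: "'a \<otimes> 'a"
    by (induction t rule: tensor_induct) (auto intro: cvec.span_base cvec.span_add)
  then have "cvec.span {x \<otimes> y |x y. x \<in> UNIV \<and> y \<in> UNIV} = (UNIV :: ('a \<otimes> 'a) set)" by blast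
  then show ?thesis
    unfolding AB_def balanced_tensor_def AB_rel_def by simp
qed

lemma can_lift_linear: "clinear can_lift"
  unfolding can_lift_def by (simp add: clinear_tensor_lift lin')

lemma can_lift_tensor: "can_lift (x \<otimes> y) = sw (\<lambda>u v. (x \<cdot> u) \<otimes> proj v) y"
  unfolding can_lift_def by (simp add: lin' tensor_lift_coact)

lemma coact_base_mul:
  assumes "b \<in> base"
  shows "coact (b \<cdot> y) = sw (\<lambda>u v. (b \<cdot> u) \<otimes> proj v) y"
proof -
  have "coact (b \<cdot> y) = tensor_lift (\<lambda>b0 b1. sw (\<lambda>u v. (b0 \<cdot> u) \<otimes> (b1 \<star> proj v)) y) (coact b)"
    by (simp add: coact_mul tensor_lift_coact lin proj_linear)
  with assms show ?thesis by (simp add: base_def lin proj_linear)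
qed

lemma can_lift_AB_rel: "d \<in> AB_rel \<Longrightarrow> can_lift d = 0"
proof -
  assume d: "d \<in> AB_rel"
  have "can_lift ((x \<cdot> b) \<otimes> y) = can_lift (x \<otimes> (b \<cdot> y))" if "b \<in> base" for x b y
  proof -
    have "can_lift (x \<otimes> (b \<cdot> y)) = tensor_lift (\<lambda>a0 a1. (x \<cdot> a0) \<otimes> a1) (coact (b \<cdot> y))"
      unfolding can_lift_def by (simp add: lin')
    then show ?thesis
      by (simp add: can_lift_tensor coact_base_mul[OF that] tensor_lift_tensor_lift lin proj_linear mul_assoc)
  qed
  then have "can_lift d \<in> {0}"
    using d unfolding AB_rel_def balancing_def
    by (intro clinear_span[OF can_lift_linear, of d])
      (auto simp: clinear_diff[OF can_lift_linear] cvec.subspace_single_0)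
  then show ?thesis by simp
qed

lemma can_coset: "can (coset AB_rel d) = can_lift d"
proof -
  have "can_lift ` coset AB_rel d = {can_lift d}"
  proof -
    have "can_lift e = can_lift d" if "e \<in> coset AB_rel d" for e
      using that can_lift_AB_rel[of "e - d"]
      by (simp add: coset_eq[OF AB_rel_subspace] clinear_diff[OF can_lift_linear])
    then show ?thesis using coset_self[OF AB_rel_subspace, of d] by blast
  qed
  then show ?thesis by (simp add: can_def)
qed

text \<open>By coassociativity, coacting on the second leg of the coproduct of b equals
  comultiplying the first leg of \<open>coact b\<close>, which is b \<otimes> 1. The second leg is
  thus coinvariant in the sense of \<open>tensor_kernel\<close>.\<close>

lemma comult_base:
  assumes "b \<in> base"
  shows "comult b \<in> cvec.span {u \<otimes> c |u c. c \<in> base}"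
proof -
  define K where "K c = coact c - c \<otimes> (1 :: 'h)" for c
  have K: "clinear K" unfolding K_def by (simp add: lin coact_linear)
  have K_tensor: "a \<otimes> K c = a \<otimes> coact c - a \<otimes> (c \<otimes> 1)" for a c :: 'a
    unfolding K_def by (rule clinear_diff[OF clinear_tensor_right[OF clinear_id]])
  have split: "tensor_map (\<lambda>x. x) K t = tensor_map (\<lambda>x. x) coact t - tensor_map (\<lambda>x. x) (\<lambda>c. c \<otimes> 1) t"
    for t :: "'a \<otimes> 'a"
    by (rule fun_cong[of _ _ t], rule clinear_eqI)
      (simp_all add: lin clinear_tensor_map K coact_linear tensor_map_tensor K_tensor)
  have "tensor_map (\<lambda>x. x) coact (comult b) = sw (\<lambda>u v. sw (\<lambda>p q. u \<otimes> p \<otimes> proj q) v) b"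
    by (simp add: tensor_map_def coact_eq tensor_lift_tensor_right lin proj_linear)
  also have "\<dots> = tensor_lift (\<lambda>u k. sw (\<lambda>p q. p \<otimes> q \<otimes> k) u) (coact b)"
    by (simp add: tensor_lift_coact sw_coassoc lin proj_linear comult_linear)
  also have "\<dots> = tensor_map (\<lambda>x. x) (\<lambda>c. c \<otimes> 1) (comult b)"
    using assms by (simp add: base_def lin comult_linear tensor_map_def)
  finally have "tensor_map (\<lambda>x. x) K (comult b) = 0" by (simp add: split)
  from tensor_kernel[OF K this] show ?thesis by (simp add: K_def base_def)
qed

end

text \<open>The condition says that ker \<pi> is contained in B^+ A, where B^+ is the augmentation
  ideal of B: the spanning elements are (b - \<epsilon>(b)) y.\<close>

locale hopf_galois_quotient = hopf_quotient +
  assumes proj_kernel: "proj x = 0 \<Longrightarrow> x \<in> cvec.span {b \<cdot> y - counit b *\<^sub>C y |b y. b \<in> base}"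
begin

text \<open>The canonical map becomes bijective when \<open>H\<close> is replaced by \<open>A\<close>, with inverse
  \<open>x \<otimes> y \<mapsto> x S(y\<^sub>(\<^sub>1\<^sub>)) \<otimes> y\<^sub>(\<^sub>2\<^sub>)\<close>; modulo \<open>AB_rel\<close> this inverse annihilates \<open>A \<otimes> ker \<pi>\<close>.\<close>

lemma can_lift_kernel:
  assumes "can_lift d = 0"
  shows "d \<in> AB_rel"
proof -
  define can_A where "can_A = tensor_lift (\<lambda>x y. sw (\<lambda>u v. (x \<cdot> u) \<otimes> v) y)"
  define \<Psi> where "\<Psi> = tensor_lift (\<lambda>x y. sw (\<lambda>u v. (x \<cdot> antipode u) \<otimes> v) y)"
  have can_A: "clinear can_A" "can_A (x \<otimes> y) = sw (\<lambda>u v. (x \<cdot> u) \<otimes> v) y" for x y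
    unfolding can_A_def by (simp_all add: clinear_tensor_lift lin comult_linear)
  have \<Psi>: "clinear \<Psi>" "\<Psi> (x \<otimes> y) = sw (\<lambda>u v. (x \<cdot> antipode u) \<otimes> v) y" for x y
    unfolding \<Psi>_def by (simp_all add: clinear_tensor_lift lin comult_linear antipode_linear)
  have "can_lift t = tensor_map (\<lambda>x. x) proj (can_A t)" for t
    by (rule fun_cong[of _ _ t], rule clinear_eqI)
      (simp_all add: lin can_lift_linear clinear_compose[OF clinear_tensor_map] proj_linear can_A
        can_lift_tensor tensor_lift_compose[OF clinear_tensor_map] tensor_map_tensor)
  \<comment> \<open>\<open>can_lift\<close> is \<open>can_A\<close> followed by id \<otimes> \<pi>,
    so exactness applies to \<open>proj\<close>.\<close>
  with assms have ker: "can_A d \<in> cvec.span {x \<otimes> y |x y. proj y = 0}"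
    by (intro tensor_kernel[OF proj_linear]) simp
  have inv: "\<Psi> (can_A t) = t" for t
  proof (rule fun_cong[of _ _ t], rule clinear_eqI)
    fix x y
    have "\<Psi> (can_A (x \<otimes> y)) = sw (\<lambda>u v. sw (\<lambda>p q. (x \<cdot> (u \<cdot> antipode p)) \<otimes> q) v) y"
      by (simp add: can_A \<Psi> tensor_lift_compose[OF \<Psi>(1)] lin mul_assoc)
    also have "\<dots> = sw (\<lambda>w q. sw (\<lambda>u p. (x \<cdot> (u \<cdot> antipode p)) \<otimes> q) w) y"
      by (simp add: sw_coassoc lin antipode_linear)
    also have "\<dots> = x \<otimes> y"
    proof -
      have "sw (\<lambda>u p. (x \<cdot> (u \<cdot> antipode p)) \<otimes> q) w = counit w *\<^sub>C (x \<otimes> q)" for w q :: 'a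
        by (subst sw_antipode_cancel(2)[where f = "\<lambda>z. (x \<cdot> z) \<otimes> q"]) (simp_all add: lin)
      then show ?thesis by (simp add: sw_counit lin)
    qed
    finally show "\<Psi> (can_A (x \<otimes> y)) = x \<otimes> y" .
  qed (simp_all add: clinear_compose[OF \<Psi>(1)] can_A clinear_id)
  have gen: "\<Psi> (a \<otimes> (b \<cdot> y - counit b *\<^sub>C y)) \<in> AB_rel" if b: "b \<in> base" for a b y
  proof -
    \<comment> \<open>On the coproduct of b the first term gives \<epsilon>(b) \<Psi>(a \<otimes>
      y), because S(b_1) b_2 = \<epsilon>(b), and the second gives \<Psi>(a \<otimes> b y), because
      S is anti-multiplicative. For c in \<open>base\<close> the two terms differ by moving c across
      the balanced tensor.\<close>
    define G where "G = tensor_lift (\<lambda>u c. sw (\<lambda>p q.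
      (a \<cdot> (antipode p \<cdot> (antipode u \<cdot> c))) \<otimes> q - (a \<cdot> (antipode p \<cdot> antipode u)) \<otimes> (c \<cdot> q)) y)"
    have G: "clinear G" "G (u \<otimes> c) = sw (\<lambda>p q. (a \<cdot> (antipode p \<cdot> (antipode u \<cdot> c))) \<otimes> q -
        (a \<cdot> (antipode p \<cdot> antipode u)) \<otimes> (c \<cdot> q)) y" for u c
      unfolding G_def by (simp_all add: clinear_tensor_lift lin antipode_linear)
    have "G (comult b) \<in> AB_rel"
    proof (rule clinear_span[OF G(1) comult_base[OF b]])
      fix z :: "'a \<otimes> 'a" assume "z \<in> {u \<otimes> c |u c. c \<in> base}"
      then obtain u c where z: "z = u \<otimes> c" "c \<in> base" by blast
      show "G z \<in> AB_rel" unfolding z(1) G(2)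
      proof (rule clinear_tensor_range[OF clinear_tensor_lift])
        fix p q
        have "(a \<cdot> (antipode p \<cdot> antipode u) \<cdot> c) \<otimes> q - (a \<cdot> (antipode p \<cdot> antipode u)) \<otimes> (c \<cdot> q) \<in> AB_rel"
          by (rule AB_relI[OF z(2)])
        then show "tensor_lift (\<lambda>p q. (a \<cdot> (antipode p \<cdot> (antipode u \<cdot> c))) \<otimes> q -
            (a \<cdot> (antipode p \<cdot> antipode u)) \<otimes> (c \<cdot> q)) (p \<otimes> q) \<in> AB_rel"
          by (simp add: lin antipode_linear mul_assoc)
      qed (simp_all add: lin antipode_linear AB_rel_subspace)
    qed (rule AB_rel_subspace)
    moreover have "G (comult b) = counit b *\<^sub>C \<Psi> (a \<otimes> y) - \<Psi> (a \<otimes> (b \<cdot> y))"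
    proof -
      have "G t = tensor_lift (\<lambda>u c. sw (\<lambda>p q. (a \<cdot> (antipode p \<cdot> (antipode u \<cdot> c))) \<otimes> q) y) t
          - tensor_lift (\<lambda>u c. sw (\<lambda>p q. (a \<cdot> (antipode p \<cdot> antipode u)) \<otimes> (c \<cdot> q)) y) t" for t
        by (rule fun_cong[of _ _ t], rule clinear_eqI)
          (simp_all add: lin antipode_linear G clinear_diff[OF clinear_tensor_left[OF clinear_id]]
            clinear_tensor_lift tensor_lift_minus)
      moreover have "sw (\<lambda>u c. sw (\<lambda>p q. (a \<cdot> (antipode p \<cdot> (antipode u \<cdot> c))) \<otimes> q) y) b =
          counit b *\<^sub>C \<Psi> (a \<otimes> y)"
        by (subst sw_antipode_cancel(1)[where f = "\<lambda>z. sw (\<lambda>p q. (a \<cdot> (antipode p \<cdot> z)) \<otimes> q) y"])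
          (simp_all add: lin antipode_linear \<Psi>)
      moreover have "\<Psi> (a \<otimes> (b \<cdot> y)) = sw (\<lambda>u c. sw (\<lambda>p q. (a \<cdot> (antipode p \<cdot> antipode u)) \<otimes> (c \<cdot> q)) y) b"
        by (simp add: \<Psi> sw_mul lin antipode_linear antipode_mul)
      ultimately show ?thesis by simp
    qed
    ultimately have "counit b *\<^sub>C \<Psi> (a \<otimes> y) - \<Psi> (a \<otimes> (b \<cdot> y)) \<in> AB_rel" by simp
    from cvec.subspace_neg[OF AB_rel_subspace this] show ?thesis
      by (simp add: clinear_diff[OF clinear_compose[OF \<Psi>(1) clinear_tensor_right[OF clinear_id]]]
          clinear_scale[OF clinear_compose[OF \<Psi>(1) clinear_tensor_right[OF clinear_id]]])
  qed
  have "\<Psi> (can_A d) \<in> AB_rel"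
  proof (rule clinear_span[OF \<Psi>(1) ker])
    fix z :: "'a \<otimes> 'a" assume "z \<in> {x \<otimes> y |x y. proj y = 0}"
    then obtain x y where z: "z = x \<otimes> y" "proj y = 0" by blast
    show "\<Psi> z \<in> AB_rel"
      unfolding z(1)
      by (rule clinear_span[OF clinear_compose[OF \<Psi>(1) clinear_tensor_right[OF clinear_id]] proj_kernel[OF z(2)]])
        (auto simp: gen AB_rel_subspace)
  qed (rule AB_rel_subspace)
  then show ?thesis by (simp add: inv)
qed

lemma inj_can: "inj_on can AB"
proof (rule inj_onI)
  fix D E assume "D \<in> AB" "E \<in> AB" "can D = can E"
  then obtain d e where de: "D = coset AB_rel d" "E = coset AB_rel e" "can_lift d = can_lift e"
    by (auto simp: AB_eq can_coset)
  then have "d - e \<in> AB_rel" by (intro can_lift_kernel) (simp add: clinear_diff[OF can_lift_linear])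
  with de show "D = E" by (simp add: coset_eq_iff[OF AB_rel_subspace])
qed

lemma can_lift_transl: "can_lift (sw (\<lambda>u v. antipode u \<otimes> v) a) = 1 \<otimes> proj a"
proof -
  have "can_lift (sw (\<lambda>u v. antipode u \<otimes> v) a) = sw (\<lambda>u v. sw (\<lambda>p q. (antipode u \<cdot> p) \<otimes> proj q) v) a"
    by (simp add: tensor_lift_compose[OF can_lift_linear] lin antipode_linear can_lift_tensor)
  also have "\<dots> = sw (\<lambda>w q. sw (\<lambda>u p. (antipode u \<cdot> p) \<otimes> proj q) w) a"
    by (simp add: sw_coassoc lin antipode_linear proj_linear comult_linear)
  also have "\<dots> = 1 \<otimes> proj a"
  proof -
    have "sw (\<lambda>u p. (antipode u \<cdot> p) \<otimes> proj q) w = counit w *\<^sub>C (1 \<otimes> proj q)" for w q :: 'a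
      by (subst sw_antipode_cancel(1)[where f = "\<lambda>z. z \<otimes> proj q"]) (simp_all add: lin)
    then show ?thesis by (simp add: sw_counit lin proj_linear)
  qed
  finally show ?thesis .
qed

text \<open>Injectivity of \<open>can\<close> makes any preimage of 1 \<otimes> \<pi>(a) the
  translation class, whichever lift a of the element of H is taken.\<close>

lemma transl_proj: "transl (proj a) = coset AB_rel (sw (\<lambda>u v. antipode u \<otimes> v) a)"
  unfolding transl_def
  by (intro the_inv_into_f_eq[OF inj_can]) (simp_all add: can_coset AB_eq can_lift_transl)

text \<open>Multiplication is \<open>can_lift\<close> followed by the counit of H on the second leg,
  so it takes the same value on every representative of the translation class.\<close>

lemma mult_transl:
  assumes "d \<in> transl h"
  shows "mult d = counitH h *\<^sub>C 1"
proof -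
  from proj_surj obtain a where h: "h = proj a" by (metis surjD)
  have "can_lift d = 1 \<otimes> h"
  proof -
    obtain D where D: "transl h = coset AB_rel D" by (simp add: h transl_proj)
    then have "d - D \<in> AB_rel" using assms by (simp add: coset_eq[OF AB_rel_subspace])
    then have "coset AB_rel d = transl h" by (simp add: D coset_eq_iff[OF AB_rel_subspace])
    then have "can_lift d = can (transl h)" by (simp flip: can_coset)
    also have "\<dots> = 1 \<otimes> h" by (simp add: h transl_proj can_coset can_lift_transl)
    finally show ?thesis .
  qed
  moreover have "mult t = tensor_lift (\<lambda>x k. counitH k *\<^sub>C x) (can_lift t)" for t
    by (rule fun_cong[of _ _ t], rule clinear_eqI)
      (simp_all add: mult_linear lin can_lift_linear counitH_linear can_lift_tensor tensor_lift_tensor_lift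
        proj_linear sw_counit)
  ultimately show ?thesis by (simp add: lin counitH_linear)
qed

subsection \<open>The bialgebroid structure\<close>

lemma contract_full_rel: "k \<in> full_rel \<Longrightarrow> contract k = 0"
proof -
  assume "k \<in> full_rel"
  then have "contract k \<in> {0}"
    unfolding full_rel_def balancing_def
    by (rule clinear_span[OF contract_linear])
      (auto simp: clinear_diff[OF contract_linear] contract_balanced cvec.subspace_single_0)
  then show ?thesis by simp
qed

lemma full_rel_subspace: "cvec.subspace full_rel"
  by (simp add: full_rel_def balancing_def)

lemma es_rel_full_rel: "es_rel \<subseteq> full_rel"
  unfolding es_rel_def full_rel_def balancing_def by (rule cvec.span_mono) blast

text \<open>A translation class multiplies to the counit of its argument, and the coaction followed
  by that counit is the identity. All choices in the formula therefore have the same contraction;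
  this yields uniqueness of the coproduct.\<close>

lemma cop_formula_value:
  assumes "z \<in> cop_formula h"
  shows "contract z = insert_one h"
  using assms unfolding cop_formula_def
proof (rule sweedler_value[OF _ contract_linear insert_one_linear _ contract_full_rel])
  fix x y w
  assume "w \<in> sweedler UNIV UNIV full_rel (\<lambda>a0 a1.
    sweedler UNIV UNIV full_rel (\<lambda>u v. {(a0 \<otimes> u) \<otimes> v \<otimes> y}) (transl a1)) {coact x}"
  then show "contract w = insert_one (x \<otimes> y)"
  proof (rule sweedler_value[OF _ contract_linear, where F = "tensor_lift (\<lambda>p k. p \<otimes> (counitH k *\<^sub>C 1) \<otimes> y)"])
    show "clinear (tensor_lift (\<lambda>p k. p \<otimes> (counitH k *\<^sub>C 1) \<otimes> y))"
      by (simp add: clinear_tensor_lift lin counitH_linear)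
    fix p k w
    assume "w \<in> sweedler UNIV UNIV full_rel (\<lambda>u v. {(p \<otimes> u) \<otimes> v \<otimes> y}) (transl k)"
    then show "contract w = tensor_lift (\<lambda>p k. p \<otimes> (counitH k *\<^sub>C 1) \<otimes> y) (p \<otimes> k)"
    proof (rule sweedler_value[OF _ contract_linear, where F = "\<lambda>t. p \<otimes> mult t \<otimes> y"])
      show "clinear (\<lambda>t. p \<otimes> mult t \<otimes> y)" by (simp add: lin mult_linear)
    qed (auto simp: contract_tensor contract_full_rel mult_transl lin counitH_linear)
  next
    fix d assume "d \<in> {coact x}"
    then have "tensor_lift (\<lambda>p k. p \<otimes> (counitH k *\<^sub>C 1) \<otimes> y) d =
        sw (\<lambda>u v. counit v *\<^sub>C (u \<otimes> 1 \<otimes> y)) x"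
      by (simp add: tensor_lift_coact lin counitH_linear tensor_scale_left tensor_scale_right)
    then show "tensor_lift (\<lambda>p k. p \<otimes> (counitH k *\<^sub>C 1) \<otimes> y) d = insert_one (x \<otimes> y)"
      by (simp add: sw_counit lin insert_one_tensor)
  qed (auto simp: contract_full_rel)
qed auto

text \<open>The nested choices in the formula are made from legs of x inside A: \<open>proj\<close>
  carries the second leg to H, and \<open>transl_proj\<close> supplies a representative of its
  translation.\<close>

lemma cop_lift_formula:
  assumes k: "k \<in> full_rel"
  shows "cop_lift h + k \<in> cop_formula h"
  unfolding cop_formula_def
proof (rule sweedler_memI[OF cop_lift_linear _ clinear_id clinear_id])
  have zero: "0 \<in> full_rel" by (rule cvec.subspace_0[OF full_rel_subspace])
  fix x y :: 'a
  define T where "T = tensor_lift (\<lambda>p q. sw (\<lambda>u v. ((p :: 'a) \<otimes> antipode u) \<otimes> v \<otimes> y) q)"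
  have T: "clinear T" "T (p \<otimes> q) = sw (\<lambda>u v. (p \<otimes> antipode u) \<otimes> v \<otimes> y) q" for p q
    unfolding T_def by (simp_all add: clinear_tensor_lift lin antipode_linear comult_linear)
  have "T (comult x) + 0 \<in> sweedler UNIV UNIV full_rel (\<lambda>a0 a1.
    sweedler UNIV UNIV full_rel (\<lambda>u v. {(a0 \<otimes> u) \<otimes> v \<otimes> y}) (transl a1)) {coact x}"
  proof (rule sweedler_memI[OF T(1) _ clinear_id proj_linear _ zero])
    fix p q
    have "tensor_lift (\<lambda>u v. (p \<otimes> u) \<otimes> v \<otimes> y) (sw (\<lambda>u v. antipode u \<otimes> v) q) + 0
      \<in> sweedler UNIV UNIV full_rel (\<lambda>u v. {(p \<otimes> u) \<otimes> v \<otimes> y}) (transl (proj q))"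
    proof (rule sweedler_memI[OF _ _ clinear_id clinear_id _ zero])
      show "tensor_map (\<lambda>x. x) (\<lambda>x. x) (sw (\<lambda>u v. antipode u \<otimes> v) q) \<in> transl (proj q)"
        by (simp add: tensor_map_def tensor_lift_tensor_elem transl_proj coset_self[OF AB_rel_subspace])
    qed (simp_all add: clinear_tensor_lift lin)
    then show "T (p \<otimes> q) \<in> sweedler UNIV UNIV full_rel (\<lambda>u v. {(p \<otimes> u) \<otimes> v \<otimes> y}) (transl (proj q))"
      by (simp add: T tensor_lift_tensor_lift lin antipode_linear)
  qed (simp add: coact_def)
  moreover have "T (comult x) = cop_lift (x \<otimes> y)"
    by (simp add: T_def cop_lift_tensor cmap_def tensor_lift_tensor_left lin antipode_linear sw_coassoc)
  ultimately show "cop_lift (x \<otimes> y) \<in> sweedler UNIV UNIV full_rel (\<lambda>a0 a1.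
    sweedler UNIV UNIV full_rel (\<lambda>u v. {(a0 \<otimes> u) \<otimes> v \<otimes> y}) (transl a1)) {coact x}" by simp
qed (simp_all add: tensor_map_def tensor_lift_tensor_elem k)

abbreviation fiber :: "'a \<otimes> 'a \<otimes> 'a \<Rightarrow> (('a \<otimes> 'a) \<otimes> 'a \<otimes> 'a) set"
  where "fiber r \<equiv> {d \<in> es2. contract d = r}"

text \<open>Since \<open>es_rel\<close> is the kernel of \<open>contract\<close> on
  \<open>es2\<close>, classes in the balanced square are its fibers.\<close>

lemma coset_es_rel: "d \<in> es2 \<Longrightarrow> coset es_rel d = fiber (contract d)"
proof -
  assume d: "d \<in> es2"
  have "e - d \<in> es2 \<longleftrightarrow> e \<in> es2" for e
    using cvec.subspace_add[OF es2_subspace _ d, of "e - d"] cvec.subspace_diff[OF es2_subspace _ d, of e]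
    by auto
  then show ?thesis
    unfolding coset_eq[OF es_rel_subspace] unfolding es_rel_eq
    by (simp add: clinear_diff[OF contract_linear])
qed

text \<open>Existence: the relations over \<open>es\<close> are among those over A \<otimes> A, so
  the whole coset of \<open>cop_lift h\<close> satisfies the formula. Uniqueness: the formula fixes
  the contraction, and classes over \<open>es\<close> are determined by it.\<close>

lemma cop_coset:
  assumes "h \<in> es"
  shows "cop h = coset es_rel (cop_lift h)"
  unfolding cop_def
proof (rule the_equality)
  show "coset es_rel (cop_lift h) \<in> balanced_tensor es es base (\<lambda>x b. (1 \<otimes> b) \<odot> x) (\<lambda>b y. (b \<otimes> 1) \<odot> y) \<and>
     coset es_rel (cop_lift h) \<subseteq> cop_formula h"
    using cop_lift_es2[OF assms] cop_lift_formula es_rel_full_rel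
    by (auto simp: balanced_tensor_def es2_def es_rel_def coset_def)
next
  fix D
  assume D: "D \<in> balanced_tensor es es base (\<lambda>x b. (1 \<otimes> b) \<odot> x) (\<lambda>b y. (b \<otimes> 1) \<odot> y) \<and> D \<subseteq> cop_formula h"
  then obtain d where d: "D = coset es_rel d" "d \<in> es2"
    by (auto simp: balanced_tensor_def es2_def es_rel_def)
  have "d \<in> cop_formula h"
    using D d(1) coset_self[OF es_rel_subspace] by blast
  then have "contract d = insert_one h" by (rule cop_formula_value)
  with d cop_lift_es2[OF assms] show "D = coset es_rel (cop_lift h)"
    by (simp add: coset_es_rel contract_cop_lift)
qed

lemma cop_fiber: "h \<in> es \<Longrightarrow> cop h = fiber (insert_one h)"
  by (simp add: cop_coset coset_es_rel cop_lift_es2 contract_cop_lift)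

lemma cop_lift_cop: "h \<in> es \<Longrightarrow> cop_lift h \<in> cop h"
  by (simp add: cop_coset coset_self[OF es_rel_subspace])

text \<open>The evaluation principle for the axioms: if f depends on u \<otimes> v only through its
  contraction, via a linear F, then its Sweedler sum over the coproduct of h is F at h with 1
  inserted in the middle.\<close>

lemma sweedler_cop:
  assumes F: "clinear F" and h: "h \<in> es"
    and f: "\<And>u v. u \<in> es \<Longrightarrow> v \<in> es \<Longrightarrow> f u v \<noteq> {} \<and> f u v \<subseteq> fiber (F (contract (u \<otimes> v)))"
  shows "sweedler es es es_rel f (cop h) = fiber (F (insert_one h))"
  unfolding es_rel_eq
  by (rule sweedler_fiber[OF es_subspace es2_subspace contract_linear clinear_compose[OF F contract_linear] f
        cop_lift_cop[OF h] cop_lift_es2[OF h, unfolded es2_def]])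
    (simp_all add: cop_fiber h)

lemma sweedler_cop_pure:
  assumes F: "clinear F" and h: "h \<in> es"
    and f: "\<And>u v. u \<in> es \<Longrightarrow> v \<in> es \<Longrightarrow> \<phi> u v \<in> es2 \<and> contract (\<phi> u v) = F (contract (u \<otimes> v))"
  shows "sweedler es es es_rel (\<lambda>u v. {\<phi> u v}) (cop h) = fiber (F (insert_one h))"
  by (rule sweedler_cop[OF F h]) (use f in auto)

text \<open>The counit axioms take values in an honest vector space, so \<rho> in
  \<open>sweedler_fiber\<close> is the identity and the fibers are singletons.\<close>

lemma sweedler_cop_value:
  assumes F: "clinear F" and h: "h \<in> es"
    and f: "\<And>u v. u \<in> es \<Longrightarrow> v \<in> es \<Longrightarrow> \<phi> u v = F (contract (u \<otimes> v))"
  shows "sweedler es es {0} (\<lambda>u v. {\<phi> u v}) (cop h) = {F (insert_one h)}"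
proof -
  have "sweedler es es {w \<in> UNIV. w = 0} (\<lambda>u v. {\<phi> u v}) (cop h) = {w \<in> UNIV. w = F (insert_one h)}"
    by (rule sweedler_fiber[OF es_subspace cvec.subspace_UNIV clinear_id clinear_compose[OF F contract_linear] _
        cop_lift_cop[OF h] cop_lift_es2[OF h, unfolded es2_def]])
      (simp_all add: cop_fiber h f)
  then show ?thesis by simp
qed

lemma bialgebroid_rel2:
  "bialgebroid_data.rel2 base es es_mul (\<lambda>b. b \<otimes> 1) (\<lambda>b. 1 \<otimes> b) = es_rel"
  by (simp add: bialgebroid_data.rel2_def es_rel_def)

lemma contract_mul_pure: "contract (((x \<otimes> y) \<odot> (p \<otimes> q)) \<otimes> ((z \<otimes> w) \<odot> (r \<otimes> s))) =
    (x \<cdot> p) \<otimes> (q \<cdot> (y \<cdot> (z \<cdot> r))) \<otimes> (s \<cdot> w)"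
  by (simp add: contract_tensor mul_assoc)

lemmas lin_contract = lin clinear_compose[OF contract_linear] clinear_compose[OF clinear_tensor_lift3]
  clinear_tensor_lift3 mult_linear clinear_compose[OF mult_linear]

section \<open>Bimodule, Takeuchi, multiplicativity and counit axioms\<close>

lemma cop_add:
  assumes g: "g \<in> es" and h: "h \<in> es"
  shows "cop (g + h) = {u + v |u v. u \<in> cop g \<and> v \<in> cop h}"
proof (intro equalityI subsetI)
  have gh: "g + h \<in> es" by (rule cvec.subspace_add[OF es_subspace g h])
  fix w
  {
    assume "w \<in> cop (g + h)"
    then have "w - cop_lift h \<in> cop g"
      by (simp add: cop_fiber gh g clinear_diff[OF contract_linear] contract_cop_lift
          clinear_add[OF insert_one_linear] cvec.subspace_diff[OF es2_subspace] cop_lift_es2 h)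
    with cop_lift_cop[OF h] show "w \<in> {u + v |u v. u \<in> cop g \<and> v \<in> cop h}"
      by (intro CollectI exI[of _ "w - cop_lift h"] exI[of _ "cop_lift h"]) simp
  }
  assume "w \<in> {u + v |u v. u \<in> cop g \<and> v \<in> cop h}"
  then show "w \<in> cop (g + h)"
    by (auto simp: cop_fiber gh g h clinear_add[OF contract_linear] clinear_add[OF insert_one_linear]
        cvec.subspace_add[OF es2_subspace])
qed

lemma cop_bimodule:
  assumes h: "h \<in> es" and ab: "a \<in> base" "b \<in> base"
  shows "cop ((a \<otimes> 1) \<odot> (1 \<otimes> b) \<odot> h) =
    sweedler es es es_rel (\<lambda>x y. {((a \<otimes> 1) \<odot> x) \<otimes> ((1 \<otimes> b) \<odot> y)}) (cop h)"
proof -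
  define F where "F = tensor_lift3 (\<lambda>p q r. (a \<cdot> p) \<otimes> (q :: 'a) \<otimes> (r \<cdot> b))"
  have F: "clinear F" "F (p \<otimes> q \<otimes> r) = (a \<cdot> p) \<otimes> q \<otimes> (r \<cdot> b)" for p q r
    unfolding F_def by (simp_all add: clinear_tensor_lift3 tensor_lift3_tensor lin)
  have "contract (((a \<otimes> 1) \<odot> u) \<otimes> ((1 \<otimes> b) \<odot> v)) = F (contract (u \<otimes> v))" for u v
    by (rule bilinear_tensor_eqI[of _ _ u v]) (simp_all add: lin_contract clinear_compose[OF F(1)] F contract_tensor)
  moreover have "insert_one ((a \<otimes> 1) \<odot> (1 \<otimes> b) \<odot> v) = F (insert_one v)" for v
    by (rule fun_cong[of _ _ v], rule clinear_eqI)
      (simp_all add: lin clinear_compose[OF F(1)] clinear_compose[OF insert_one_linear] F insert_one_tensor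
        insert_one_linear)
  ultimately show ?thesis
    using assms es_mul_closed[OF es_mul_closed[OF source_es target_es]]
    by (subst sweedler_cop_pure[OF F(1) h]) (auto simp: cop_fiber es2I es_mul_closed source_es target_es)
qed

text \<open>After contraction the two sides multiply the middle entry by b from the left and from
  the right; on a coproduct that entry is 1.\<close>

lemma cop_takeuchi:
  assumes h: "h \<in> es" and b: "b \<in> base"
  shows "sweedler es es es_rel (\<lambda>x y. {(x \<odot> (1 \<otimes> b)) \<otimes> y}) (cop h) =
    sweedler es es es_rel (\<lambda>x y. {x \<otimes> (y \<odot> (b \<otimes> 1))}) (cop h)"
proof -
  define F where "F = tensor_lift3 (\<lambda>p q r. (p :: 'a) \<otimes> (b \<cdot> q) \<otimes> (r :: 'a))"
  define G where "G = tensor_lift3 (\<lambda>p q r. (p :: 'a) \<otimes> (q \<cdot> b) \<otimes> (r :: 'a))"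
  have F: "clinear F" "F (p \<otimes> q \<otimes> r) = p \<otimes> (b \<cdot> q) \<otimes> r" for p q r
    unfolding F_def by (simp_all add: clinear_tensor_lift3 tensor_lift3_tensor lin)
  have G: "clinear G" "G (p \<otimes> q \<otimes> r) = p \<otimes> (q \<cdot> b) \<otimes> r" for p q r
    unfolding G_def by (simp_all add: clinear_tensor_lift3 tensor_lift3_tensor lin)
  have F_eq: "contract ((u \<odot> (1 \<otimes> b)) \<otimes> v) = F (contract (u \<otimes> v))" for u v
    by (rule bilinear_tensor_eqI[of _ _ u v]) (simp_all add: lin_contract clinear_compose[OF F(1)] F contract_tensor mul_assoc)
  have G_eq: "contract (u \<otimes> (v \<odot> (b \<otimes> 1))) = G (contract (u \<otimes> v))" for u v
    by (rule bilinear_tensor_eqI[of _ _ u v]) (simp_all add: lin_contract clinear_compose[OF G(1)] G contract_tensor mul_assoc)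
  have "F (insert_one h) = G (insert_one h)"
    by (rule fun_cong[of _ _ h], rule clinear_eqI)
      (simp_all add: clinear_compose[OF F(1)] clinear_compose[OF G(1)] insert_one_linear F G insert_one_tensor)
  then show ?thesis
    using b by (simp add: sweedler_cop_pure[OF F(1) h] sweedler_cop_pure[OF G(1) h] F_eq G_eq
        es2I es_mul_closed source_es target_es)
qed

lemma cop_one: "cop (1 \<otimes> 1) = coset es_rel ((1 \<otimes> 1) \<otimes> (1 \<otimes> 1))"
  by (simp add: cop_fiber coset_es_rel es2I source_es one_base contract_tensor insert_one_tensor)

lemma cop_mul:
  assumes g: "g \<in> es" and h: "h \<in> es"
  shows "cop (g \<odot> h) = sweedler es es es_rel (\<lambda>u v.
    sweedler es es es_rel (\<lambda>x y. {(x \<odot> u) \<otimes> (y \<odot> v)}) (cop g)) (cop h)"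
proof -
  \<comment> \<open>Right multiplication by u \<otimes> v descends to contractions: the inner
    factors of x \<otimes> y stay adjacent, flanked by the inner factors of u and v.\<close>
  define G where "G u v = tensor_lift3 (\<lambda>a b c. tensor_lift (\<lambda>p q. tensor_lift (\<lambda>z w.
    (a \<cdot> p) \<otimes> (q \<cdot> (b \<cdot> z)) \<otimes> (w \<cdot> c)) v) u)" for u v
  have G: "clinear (G u v)" "G u v (a \<otimes> b \<otimes> c) = tensor_lift (\<lambda>p q. tensor_lift (\<lambda>z w.
    (a \<cdot> p) \<otimes> (q \<cdot> (b \<cdot> z)) \<otimes> (w \<cdot> c)) v) u" for u v a b c
    unfolding G_def by (simp_all add: clinear_tensor_lift3 tensor_lift3_tensor lin)
  \<comment> \<open>When the inner sum over the coproduct of g has put 1 in the middle, the result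
    involves u and v only through their contraction. J g is this dependence, which makes the outer
    sum accessible to \<open>sweedler_cop\<close>.\<close>
  define J where "J g = tensor_lift3 (\<lambda>a b c. tensor_lift (\<lambda>x y. (x \<cdot> a) \<otimes> (b :: 'a) \<otimes> (c \<cdot> y)) g)" for g
  have J: "clinear (J g)" "J g (a \<otimes> b \<otimes> c) = tensor_lift (\<lambda>x y. (x \<cdot> a) \<otimes> b \<otimes> (c \<cdot> y)) g" for g a b c
    unfolding J_def by (simp_all add: clinear_tensor_lift3 tensor_lift3_tensor lin)
  have G_eq: "contract ((x \<odot> u) \<otimes> (y \<odot> v)) = G u v (contract (x \<otimes> y))" for x y u v
  proof (rule bilinear_tensor_eqI[of _ _ x y])
    fix x y z w :: 'a
    show "contract (((x \<otimes> y) \<odot> u) \<otimes> ((z \<otimes> w) \<odot> v)) = G u v (contract ((x \<otimes> y) \<otimes> z \<otimes> w))"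
      by (rule bilinear_tensor_eqI[of _ _ u v])
        (simp_all add: lin_contract G contract_mul_pure contract_tensor mul_assoc)
  qed (simp_all add: lin_contract clinear_compose[OF G(1)])
  have J_left: "clinear (\<lambda>g. J g t)" for t
    unfolding J_def tensor_lift3_def by (simp add: lin)
  have J_eq: "G u v (insert_one g) = J g (contract (u \<otimes> v))" for u v
  proof (rule fun_cong[of _ _ g], rule clinear_eqI)
    fix x y
    show "G u v (insert_one (x \<otimes> y)) = J (x \<otimes> y) (contract (u \<otimes> v))"
      by (rule bilinear_tensor_eqI[of _ _ u v]) (simp_all add: lin_contract G J insert_one_tensor contract_tensor
          clinear_compose[OF J(1)])
  qed (simp_all add: clinear_compose[OF G(1)] insert_one_linear J_left)
  have J_one: "J g (insert_one h) = insert_one (g \<odot> h)"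
    by (rule bilinear_tensor_eqI[of _ _ g h])
      (simp_all add: J lin insert_one_tensor clinear_compose[OF insert_one_linear]
        clinear_compose[OF J(1)] insert_one_linear J_left)
  have inner: "sweedler es es es_rel (\<lambda>x y. {(x \<odot> u) \<otimes> (y \<odot> v)}) (cop g) = fiber (J g (contract (u \<otimes> v)))"
    if "u \<in> es" "v \<in> es" for u v
    using that by (simp add: sweedler_cop_pure[OF G(1) g] G_eq es2I es_mul_closed J_eq)
  \<comment> \<open>A fiber over an arbitrary element could be empty; this one is the value of a
    Sweedler sum that has at least one decomposition.\<close>
  have nonempty: "fiber (J g (contract (u \<otimes> v))) \<noteq> {}" if "u \<in> es" "v \<in> es" for u v
  proof -
    have "sweedler es es es_rel (\<lambda>x y. {(x \<odot> u) \<otimes> (y \<odot> v)}) (cop g) \<noteq> {}"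
      using that by (intro sweedler_nonempty[OF es_subspace cop_lift_cop[OF g] cop_lift_es2[OF g, unfolded es2_def]])
        (auto simp: cvec.subspace_0[OF es_rel_subspace])
    then show ?thesis by (simp add: inner that)
  qed
  have "sweedler es es es_rel (\<lambda>u v. sweedler es es es_rel (\<lambda>x y. {(x \<odot> u) \<otimes> (y \<odot> v)}) (cop g)) (cop h) =
      fiber (J g (insert_one h))"
    by (rule sweedler_cop[OF J(1) h]) (simp only: inner nonempty subset_refl simp_thms)
  then show ?thesis by (simp add: J_one cop_fiber[of "g \<odot> h"] es_mul_closed g h)
qed

lemma counit_left:
  assumes h: "h \<in> es"
  shows "sweedler es es {0} (\<lambda>x y. {(mult x \<otimes> 1) \<odot> y}) (cop h) = {h}"
proof -
  define F where "F = tensor_lift3 (\<lambda>a b c. (a \<cdot> b) \<otimes> (c :: 'a))"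
  have F: "clinear F" "F (p \<otimes> q \<otimes> r) = (p \<cdot> q) \<otimes> r" for p q r
    unfolding F_def by (simp_all add: clinear_tensor_lift3 tensor_lift3_tensor lin)
  have "(mult u \<otimes> 1) \<odot> v = F (contract (u \<otimes> v))" for u v
    by (rule bilinear_tensor_eqI[of _ _ u v]) (simp_all add: lin_contract clinear_compose[OF F(1)] F contract_tensor mul_assoc)
  moreover have "F (insert_one h) = h"
    by (rule fun_cong[of _ _ h], rule clinear_eqI)
      (simp_all add: clinear_compose[OF F(1)] insert_one_linear F insert_one_tensor clinear_id)
  ultimately show ?thesis by (simp add: sweedler_cop_value[OF F(1) h])
qed

lemma counit_right:
  assumes h: "h \<in> es"
  shows "sweedler es es {0} (\<lambda>x y. {(1 \<otimes> mult y) \<odot> x}) (cop h) = {h}"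
proof -
  define F where "F = tensor_lift3 (\<lambda>a b c. (a :: 'a) \<otimes> (b \<cdot> c))"
  have F: "clinear F" "F (p \<otimes> q \<otimes> r) = p \<otimes> (q \<cdot> r)" for p q r
    unfolding F_def by (simp_all add: clinear_tensor_lift3 tensor_lift3_tensor lin)
  have "(1 \<otimes> mult v) \<odot> u = F (contract (u \<otimes> v))" for u v
    by (rule bilinear_tensor_eqI[of _ _ u v]) (simp_all add: lin_contract clinear_compose[OF F(1)] F contract_tensor mul_assoc)
  moreover have "F (insert_one h) = h"
    by (rule fun_cong[of _ _ h], rule clinear_eqI)
      (simp_all add: clinear_compose[OF F(1)] insert_one_linear F insert_one_tensor clinear_id)
  ultimately show ?thesis by (simp add: sweedler_cop_value[OF F(1) h])
qed

section \<open>The antipode axioms for the flip\<close>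

lemma the_inv_into_flip: "h \<in> es \<Longrightarrow> the_inv_into es flip h = flip h"
  by (rule the_inv_into_f_eq) (auto simp: inj_on_def flip_es flip_flip dest: arg_cong[of _ _ flip])

text \<open>With h_1 = x \<otimes> y and h_2 = z \<otimes> w the inner sum has contraction w
  \<otimes> x \<otimes> y z, the cyclic shift P of x \<otimes> y z \<otimes> w. Hence the full sum
  is P at x \<otimes> 1 \<otimes> y for h = x \<otimes> y, namely y \<otimes> x \<otimes> 1.\<close>

lemma cop_flip_left:
  assumes h: "h \<in> es"
  shows "sweedler es es es_rel (\<lambda>h1 h2.
      sweedler es es es_rel (\<lambda>x y. {x \<otimes> (y \<odot> h1)}) (cop (the_inv_into es flip h2))) (cop h) =
    coset es_rel (the_inv_into es flip h \<otimes> (1 \<otimes> 1))"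
proof -
  define G where "G w = tensor_lift3 (\<lambda>a b c. tensor_lift (\<lambda>p q. (a :: 'a) \<otimes> (b \<cdot> p) \<otimes> (q \<cdot> c)) w)" for w
  have G: "clinear (G w)" "G w (a \<otimes> b \<otimes> c) = tensor_lift (\<lambda>p q. a \<otimes> (b \<cdot> p) \<otimes> (q \<cdot> c)) w" for w a b c
    unfolding G_def by (simp_all add: clinear_tensor_lift3 tensor_lift3_tensor lin)
  have G_left: "clinear (\<lambda>w. G w t)" for t
    unfolding G_def tensor_lift3_def by (simp add: lin)
  define P where "P = tensor_lift3 (\<lambda>a b c. (c :: 'a) \<otimes> (a :: 'a) \<otimes> (b :: 'a))"
  have P: "clinear P" "P (a \<otimes> b \<otimes> c) = c \<otimes> a \<otimes> b" for a b c
    unfolding P_def by (simp_all add: clinear_tensor_lift3 tensor_lift3_tensor lin)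
  have G_eq: "contract (x \<otimes> (y \<odot> w)) = G w (contract (x \<otimes> y))" for x y w
  proof (rule fun_cong[of _ _ w], rule clinear_eqI)
    fix p q
    show "contract (x \<otimes> (y \<odot> (p \<otimes> q))) = G (p \<otimes> q) (contract (x \<otimes> y))"
      by (rule bilinear_tensor_eqI[of _ _ x y]) (simp_all add: lin_contract clinear_compose[OF G(1)] G contract_tensor mul_assoc)
  qed (simp_all add: lin_contract G_left)
  have P_eq: "G u (insert_one (flip v)) = P (contract (u \<otimes> v))" for u v
    by (rule bilinear_tensor_eqI[of _ _ u v])
      (simp_all add: lin_contract G_left clinear_compose[OF G(1)] clinear_compose[OF insert_one_linear]
        clinear_flip clinear_compose[OF P(1)] flip_tensor insert_one_tensor G P contract_tensor)
  have inner: "sweedler es es es_rel (\<lambda>x y. {x \<otimes> (y \<odot> u)}) (cop (the_inv_into es flip v)) =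
      fiber (P (contract (u \<otimes> v)))" if "u \<in> es" "v \<in> es" for u v
    using that by (simp add: the_inv_into_flip sweedler_cop_pure[OF G(1)] flip_es G_eq es2I es_mul_closed P_eq)
  have nonempty: "fiber (P (contract (u \<otimes> v))) \<noteq> {}" if uv: "u \<in> es" "v \<in> es" for u v
    unfolding inner[OF uv, symmetric] the_inv_into_flip[OF uv(2)]
    by (intro sweedler_nonempty[OF es_subspace cop_lift_cop cop_lift_es2[unfolded es2_def]])
      (auto simp: cvec.subspace_0[OF es_rel_subspace] flip_es uv)
  have "P (insert_one h) = contract (flip h \<otimes> (1 \<otimes> 1))"
    by (rule fun_cong[of _ _ h], rule clinear_eqI)
      (simp_all add: clinear_compose[OF P(1)] insert_one_linear lin_contract clinear_flip P insert_one_tensor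
        flip_tensor contract_tensor)
  then have "coset es_rel (flip h \<otimes> (1 \<otimes> 1)) = fiber (P (insert_one h))"
    using source_es[OF one_base] by (simp add: coset_es_rel es2I flip_es h)
  then show ?thesis
    unfolding the_inv_into_flip[OF h]
    by (subst sweedler_cop[OF P(1) h]) (use inner nonempty in auto)
qed

text \<open>The same computation with the inverse cyclic shift: the inner sum contracts to y z
  \<otimes> w \<otimes> x, and the total to 1 \<otimes> y \<otimes> x.\<close>

lemma cop_flip_right:
  assumes h: "h \<in> es"
  shows "sweedler es es es_rel (\<lambda>h1 h2.
      sweedler es es es_rel (\<lambda>x y. {(x \<odot> h2) \<otimes> y}) (cop (flip h1))) (cop h) =
    coset es_rel ((1 \<otimes> 1) \<otimes> flip h)"
proof -
  define G where "G w = tensor_lift3 (\<lambda>a b c. tensor_lift (\<lambda>p q. (a \<cdot> p) \<otimes> (q \<cdot> b) \<otimes> (c :: 'a)) w)" for w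
  have G: "clinear (G w)" "G w (a \<otimes> b \<otimes> c) = tensor_lift (\<lambda>p q. (a \<cdot> p) \<otimes> (q \<cdot> b) \<otimes> c) w" for w a b c
    unfolding G_def by (simp_all add: clinear_tensor_lift3 tensor_lift3_tensor lin)
  have G_left: "clinear (\<lambda>w. G w t)" for t
    unfolding G_def tensor_lift3_def by (simp add: lin)
  define P where "P = tensor_lift3 (\<lambda>a b c. (b :: 'a) \<otimes> (c :: 'a) \<otimes> (a :: 'a))"
  have P: "clinear P" "P (a \<otimes> b \<otimes> c) = b \<otimes> c \<otimes> a" for a b c
    unfolding P_def by (simp_all add: clinear_tensor_lift3 tensor_lift3_tensor lin)
  have G_eq: "contract ((x \<odot> w) \<otimes> y) = G w (contract (x \<otimes> y))" for x y w
  proof (rule fun_cong[of _ _ w], rule clinear_eqI)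
    fix p q
    show "contract ((x \<odot> (p \<otimes> q)) \<otimes> y) = G (p \<otimes> q) (contract (x \<otimes> y))"
      by (rule bilinear_tensor_eqI[of _ _ x y]) (simp_all add: lin_contract clinear_compose[OF G(1)] G contract_tensor mul_assoc)
  qed (simp_all add: lin_contract G_left)
  have P_eq: "G v (insert_one (flip u)) = P (contract (u \<otimes> v))" for u v
    by (rule bilinear_tensor_eqI[of _ _ u v])
      (simp_all add: lin_contract G_left clinear_compose[OF G(1)] clinear_compose[OF insert_one_linear]
        clinear_flip clinear_compose[OF P(1)] flip_tensor insert_one_tensor G P contract_tensor)
  have inner: "sweedler es es es_rel (\<lambda>x y. {(x \<odot> v) \<otimes> y}) (cop (flip u)) =
      fiber (P (contract (u \<otimes> v)))" if "u \<in> es" "v \<in> es" for u v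
    using that by (simp add: sweedler_cop_pure[OF G(1)] flip_es G_eq es2I es_mul_closed P_eq)
  have nonempty: "fiber (P (contract (u \<otimes> v))) \<noteq> {}" if uv: "u \<in> es" "v \<in> es" for u v
    unfolding inner[OF uv, symmetric]
    by (intro sweedler_nonempty[OF es_subspace cop_lift_cop cop_lift_es2[unfolded es2_def]])
      (auto simp: cvec.subspace_0[OF es_rel_subspace] flip_es uv)
  have "P (insert_one h) = contract ((1 \<otimes> 1) \<otimes> flip h)"
    by (rule fun_cong[of _ _ h], rule clinear_eqI)
      (simp_all add: clinear_compose[OF P(1)] insert_one_linear lin_contract clinear_flip P insert_one_tensor
        flip_tensor contract_tensor)
  then have "coset es_rel ((1 \<otimes> 1) \<otimes> flip h) = fiber (P (insert_one h))"
    using source_es[OF one_base] by (simp add: coset_es_rel es2I flip_es h)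
  then show ?thesis
    by (subst sweedler_cop[OF P(1) h]) (use inner nonempty in auto)
qed

section \<open>Coassociativity\<close>

lemma cop_lift_target: "cop_lift ((1 \<otimes> b) \<odot> z) = tensor_map (\<lambda>x. x) (\<lambda>y. (1 \<otimes> b) \<odot> y) (cop_lift z)"
  by (rule fun_cong[of _ _ z], rule clinear_eqI)
    (simp_all add: clinear_compose[OF cop_lift_linear] clinear_compose[OF clinear_tensor_map] lin cop_lift_linear
      cop_lift_tensor tensor_lift_compose[OF clinear_tensor_map] cmap_linear tensor_map_tensor)

text \<open>In contrast to the target, only a congruence: on the left the element b is comultiplied
  along with z, on the right it is not. The two lifts agree after contraction.\<close>

lemma cop_lift_source:
  assumes "b \<in> base" "z \<in> es"
  shows "cop_lift ((b \<otimes> 1) \<odot> z) - tensor_map (\<lambda>x. (b \<otimes> 1) \<odot> x) (\<lambda>y. y) (cop_lift z) \<in> es_rel"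
proof -
  define T where "T = tensor_map (\<lambda>x. (b \<otimes> 1) \<odot> x) (\<lambda>y. y :: 'a \<otimes> 'a)"
  have T: "clinear T" "T (x \<otimes> y) = ((b \<otimes> 1) \<odot> x) \<otimes> y" for x y
    unfolding T_def by (simp_all add: clinear_tensor_map tensor_map_tensor lin)
  have T_es2: "T d \<in> es2" if "d \<in> es2" for d
    by (rule clinear_span[OF T(1) that[unfolded es2_def] _ es2_subspace])
      (auto simp: T intro!: es2I es_mul_closed source_es assms(1))
  define F where "F = tensor_lift3 (\<lambda>p q r. (b \<cdot> p) \<otimes> (q :: 'a) \<otimes> (r :: 'a))"
  have F: "clinear F" "F (p \<otimes> q \<otimes> r) = (b \<cdot> p) \<otimes> q \<otimes> r" for p q r
    unfolding F_def by (simp_all add: clinear_tensor_lift3 tensor_lift3_tensor lin)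
  have "contract (T (u \<otimes> v)) = F (contract (u \<otimes> v))" for u v
    unfolding T by (rule bilinear_tensor_eqI[of _ _ u v]) (simp_all add: lin_contract clinear_compose[OF F(1)] F contract_tensor)
  then have "contract (T d) = F (contract d)" for d
    by (intro fun_cong[where x = d and f = "\<lambda>d. contract (T d)"] clinear_eqI)
      (simp_all add: clinear_compose[OF contract_linear T(1)] clinear_compose[OF F(1) contract_linear])
  moreover have "insert_one ((b \<otimes> 1) \<odot> z) = F (insert_one z)"
    by (rule fun_cong[of _ _ z], rule clinear_eqI)
      (simp_all add: lin clinear_compose[OF F(1)] clinear_compose[OF insert_one_linear] F insert_one_tensor
        insert_one_linear)
  ultimately show ?thesis
    unfolding es_rel_eq T_def[symmetric]
    using assms by (simp add: cvec.subspace_diff[OF es2_subspace] T_es2 cop_lift_es2 es_mul_closed source_es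
        clinear_diff[OF contract_linear] contract_cop_lift)
qed

definition es_rel3 :: "(('a \<otimes> 'a) \<otimes> ('a \<otimes> 'a) \<otimes> 'a \<otimes> 'a) set" where
  "es_rel3 = bialgebroid_data.rel3 base es es_mul (\<lambda>b. b \<otimes> 1) (\<lambda>b. 1 \<otimes> b)"

lemma es_rel3I1: "x \<in> es \<Longrightarrow> y \<in> es \<Longrightarrow> z \<in> es \<Longrightarrow> b \<in> base \<Longrightarrow>
    ((1 \<otimes> b) \<odot> x) \<otimes> y \<otimes> z - x \<otimes> ((b \<otimes> 1) \<odot> y) \<otimes> z \<in> es_rel3"
  unfolding es_rel3_def bialgebroid_data.rel3_def by (rule cvec.span_base, rule UnI1) blast

lemma es_rel3I2: "x \<in> es \<Longrightarrow> y \<in> es \<Longrightarrow> z \<in> es \<Longrightarrow> b \<in> base \<Longrightarrow>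
    x \<otimes> ((1 \<otimes> b) \<odot> y) \<otimes> z - x \<otimes> y \<otimes> ((b \<otimes> 1) \<odot> z) \<in> es_rel3"
  unfolding es_rel3_def bialgebroid_data.rel3_def by (rule cvec.span_base, rule UnI2) blast

lemma es_rel3_subspace: "cvec.subspace es_rel3"
  by (simp add: es_rel3_def bialgebroid_data.rel3_def)

text \<open>The iterated coproducts have linear lifts F and G that agree exactly on
  \<open>cop_lift h\<close>, by coassociativity in A. What remains is that F and G carry
  \<open>es_rel\<close> into the triple relations and that the choice of representatives of inner
  coproducts is immaterial modulo these.\<close>

lemma cop_coassoc:
  assumes h: "h \<in> es"
  shows "sweedler es es es_rel3 (\<lambda>x y. {tensor_lift (\<lambda>u v. u \<otimes> v \<otimes> y) d |d. d \<in> cop x}) (cop h) =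
    sweedler es es es_rel3 (\<lambda>x y. {x \<otimes> d |d. d \<in> cop y}) (cop h)"
proof -
  define F where "F = tensor_lift (\<lambda>x y. tensor_lift (\<lambda>u v. u \<otimes> v \<otimes> (y :: 'a \<otimes> 'a)) (cop_lift x))"
  define G where "G = tensor_map (\<lambda>x. x :: 'a \<otimes> 'a) cop_lift"
  have F: "clinear F" "F (x \<otimes> y) = tensor_lift (\<lambda>u v. u \<otimes> v \<otimes> y) (cop_lift x)" for x y
    unfolding F_def by (simp_all add: clinear_tensor_lift lin cop_lift_linear)
  have G: "clinear G" "G (x \<otimes> y) = x \<otimes> cop_lift y" for x y
    unfolding G_def by (simp_all add: clinear_tensor_map tensor_map_tensor lin cop_lift_linear)
  have cop_diff: "d - cop_lift z \<in> es_rel" if "z \<in> es" "d \<in> cop z" for z d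
    using that by (simp add: cop_coset coset_eq[OF es_rel_subspace])
  have left: "tensor_lift (\<lambda>u v. u \<otimes> v \<otimes> y) k \<in> es_rel3" if "k \<in> es_rel" "y \<in> es" for y k
    using that(1) unfolding es_rel_def balancing_def
    by (rule clinear_span[rotated])
      (auto simp: clinear_tensor_lift lin clinear_diff[OF clinear_tensor_lift] es_rel3I1 that(2) es_rel3_subspace)
  have right: "x \<otimes> k \<in> es_rel3" if "k \<in> es_rel" "x \<in> es" for x k
    using that(1) unfolding es_rel_def balancing_def
    by (rule clinear_span[rotated])
      (auto simp: lin clinear_diff[OF clinear_tensor_right[OF clinear_id]] es_rel3I2 that(2) es_rel3_subspace)
  have F_rel: "F k \<in> es_rel3" if "k \<in> es_rel" for k
    using that unfolding es_rel_def balancing_def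
  proof (rule clinear_span[OF F(1)])
    fix z assume "z \<in> {((1 \<otimes> b) \<odot> x) \<otimes> y - x \<otimes> ((b \<otimes> 1) \<odot> y) |x y b. x \<in> es \<and> y \<in> es \<and> b \<in> base}"
    then obtain x y b where z: "z = ((1 \<otimes> b) \<odot> x) \<otimes> y - x \<otimes> ((b \<otimes> 1) \<odot> y)" "x \<in> es" "y \<in> es" "b \<in> base"
      by blast
    have "F z = tensor_lift (\<lambda>u v. u \<otimes> ((1 \<otimes> b) \<odot> v) \<otimes> y - u \<otimes> v \<otimes> ((b \<otimes> 1) \<odot> y)) (cop_lift x)"
      by (simp add: z(1) clinear_diff[OF F(1)] F cop_lift_target tensor_lift_tensor_map lin tensor_lift_minus)
    also have "\<dots> \<in> es_rel3"
      by (rule clinear_span[OF clinear_tensor_lift cop_lift_es2[OF z(2), unfolded es2_def]])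
        (auto simp: lin es_rel3I2 z(3,4) es_rel3_subspace)
    finally show "F z \<in> es_rel3" .
  qed (rule es_rel3_subspace)
  have G_rel: "G k \<in> es_rel3" if "k \<in> es_rel" for k
    using that unfolding es_rel_def balancing_def
  proof (rule clinear_span[OF G(1)])
    fix z assume "z \<in> {((1 \<otimes> b) \<odot> x) \<otimes> y - x \<otimes> ((b \<otimes> 1) \<odot> y) |x y b. x \<in> es \<and> y \<in> es \<and> b \<in> base}"
    then obtain x y b where z: "z = ((1 \<otimes> b) \<odot> x) \<otimes> y - x \<otimes> ((b \<otimes> 1) \<odot> y)" "x \<in> es" "y \<in> es" "b \<in> base"
      by blast
    define T where "T = tensor_map (\<lambda>x. (b \<otimes> 1) \<odot> x) (\<lambda>y. y :: 'a \<otimes> 'a)"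
    have T: "clinear T" "T (p \<otimes> q) = ((b \<otimes> 1) \<odot> p) \<otimes> q" for p q
      unfolding T_def by (simp_all add: clinear_tensor_map tensor_map_tensor lin)
    have "(\<lambda>t. ((1 \<otimes> b) \<odot> x) \<otimes> t - x \<otimes> T t) (cop_lift y) \<in> es_rel3"
    proof (rule clinear_span[OF _ cop_lift_es2[OF z(3), unfolded es2_def]])
      show "clinear (\<lambda>t. ((1 \<otimes> b) \<odot> x) \<otimes> t - x \<otimes> T t)"
        by (simp add: lin clinear_compose[OF T(1)])
    qed (auto simp: T es_rel3I1 z(2,4) es_rel3_subspace)
    \<comment> \<open>The defect of \<open>cop_lift\<close> with respect to the source lies in
      \<open>es_rel\<close> and is absorbed by the triple relations.\<close>
    moreover have "x \<otimes> (cop_lift ((b \<otimes> 1) \<odot> y) - T (cop_lift y)) \<in> es_rel3"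
      unfolding T_def by (intro right cop_lift_source z)
    ultimately have "((1 \<otimes> b) \<odot> x) \<otimes> cop_lift y - x \<otimes> T (cop_lift y) -
        x \<otimes> (cop_lift ((b \<otimes> 1) \<odot> y) - T (cop_lift y)) \<in> es_rel3"
      using cvec.subspace_diff[OF es_rel3_subspace] by blast
    then show "G z \<in> es_rel3"
      by (simp add: z(1) clinear_diff[OF G(1)] G clinear_diff[OF clinear_tensor_right[OF clinear_id]])
  qed (rule es_rel3_subspace)
  have F_eq: "sweedler es es es_rel3 (\<lambda>x y. {tensor_lift (\<lambda>u v. u \<otimes> v \<otimes> y) d |d. d \<in> cop x}) (cop h) =
      coset es_rel3 (F (cop_lift h))"
  proof (rule sweedler_coset[OF es_subspace es_rel3_subspace F(1) _ cop_lift_cop[OF h]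
        cop_lift_es2[OF h, unfolded es2_def]])
    fix x y assume xy: "x \<in> es" "y \<in> es"
    have "tensor_lift (\<lambda>u v. u \<otimes> v \<otimes> y) d - F (x \<otimes> y) \<in> es_rel3" if "d \<in> cop x" for d
      using left[OF cop_diff[OF xy(1) that] xy(2)]
      by (simp add: F clinear_diff[OF clinear_tensor_lift] lin)
    then show "{tensor_lift (\<lambda>u v. u \<otimes> v \<otimes> y) d |d. d \<in> cop x} \<noteq> {} \<and>
        {tensor_lift (\<lambda>u v. u \<otimes> v \<otimes> y) d |d. d \<in> cop x} \<subseteq> coset es_rel3 (F (x \<otimes> y))"
      using cop_lift_cop[OF xy(1)] by (auto simp: coset_eq[OF es_rel3_subspace])
  next
    fix d assume "d \<in> cop h"
    from F_rel[OF cop_diff[OF h this]] show "F d - F (cop_lift h) \<in> es_rel3"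
      by (simp add: clinear_diff[OF F(1)])
  qed
  have G_eq: "sweedler es es es_rel3 (\<lambda>x y. {x \<otimes> d |d. d \<in> cop y}) (cop h) =
      coset es_rel3 (G (cop_lift h))"
  proof (rule sweedler_coset[OF es_subspace es_rel3_subspace G(1) _ cop_lift_cop[OF h]
        cop_lift_es2[OF h, unfolded es2_def]])
    fix x y assume xy: "x \<in> es" "y \<in> es"
    have "x \<otimes> d - G (x \<otimes> y) \<in> es_rel3" if "d \<in> cop y" for d
      using right[OF cop_diff[OF xy(2) that] xy(1)]
      by (simp add: G clinear_diff[OF clinear_tensor_right[OF clinear_id]])
    then show "{x \<otimes> d |d. d \<in> cop y} \<noteq> {} \<and> {x \<otimes> d |d. d \<in> cop y} \<subseteq> coset es_rel3 (G (x \<otimes> y))"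
      using cop_lift_cop[OF xy(2)] by (auto simp: coset_eq[OF es_rel3_subspace])
  next
    fix d assume "d \<in> cop h"
    from G_rel[OF cop_diff[OF h this]] show "G d - G (cop_lift h) \<in> es_rel3"
      by (simp add: clinear_diff[OF G(1)])
  qed
  have "F (cop_lift h) = G (cop_lift h)"
  proof (rule fun_cong[of _ _ h], rule clinear_eqI)
    fix x y
    \<comment> \<open>\<open>cmap\<close> is comultiplicative, so that F gives
      \<open>cmap x_1\<close> \<otimes> \<open>cmap x_2\<close> \<otimes> (x_3 \<otimes> y), which
      is also the value of G.\<close>
    have cop_cmap: "cop_lift (cmap u) = sw (\<lambda>p w. cmap p \<otimes> cmap w) u" for u
    proof -
      have "cop_lift (cmap u) = sw (\<lambda>p w. sw (\<lambda>q v. cmap p \<otimes> q \<otimes> antipode v) w) u"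
        by (simp add: cmap_def[of u] tensor_lift_compose[OF cop_lift_linear] lin antipode_linear cop_lift_tensor
            sw_coassoc clinear_compose[OF cmap_linear])
      then show ?thesis
        by (simp add: cmap_def[of "_ :: 'a"] tensor_lift_tensor_right lin antipode_linear)
    qed
    have "F (cop_lift (x \<otimes> y)) = sw (\<lambda>u v. sw (\<lambda>p w. cmap p \<otimes> cmap w \<otimes> v \<otimes> y) u) x"
      by (simp add: cop_lift_tensor tensor_lift_compose[OF F(1)] lin cmap_linear F cop_cmap tensor_lift_tensor_lift
          clinear_compose[OF cmap_linear])
    also have "\<dots> = G (cop_lift (x \<otimes> y))"
      by (simp add: sw_coassoc lin cmap_linear cop_lift_tensor tensor_lift_compose[OF G(1)] G tensor_lift_tensor_right
          clinear_compose[OF cmap_linear])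
    finally show "F (cop_lift (x \<otimes> y)) = G (cop_lift (x \<otimes> y))" .
  qed (simp_all add: clinear_compose[OF F(1)] clinear_compose[OF G(1)] cop_lift_linear)
  then show ?thesis by (simp add: F_eq G_eq)
qed

lemma mult_es_mul_source: "mult (u \<odot> (mult v \<otimes> 1)) = mult (u \<odot> v)"
  and mult_es_mul_target: "mult (u \<odot> (1 \<otimes> mult v)) = mult (u \<odot> v)"
  by (rule bilinear_tensor_eqI[of _ _ u v], simp_all add: lin_contract mul_assoc)+

lemma mult_bimodule: "mult ((a \<otimes> 1) \<odot> (1 \<otimes> b) \<odot> h) = a \<cdot> mult h \<cdot> b"
  by (rule fun_cong[of _ _ h], rule clinear_eqI) (simp_all add: lin_contract mul_assoc)

lemma flip_es_mul: "flip (u \<odot> v) = flip v \<odot> flip u"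
  by (rule bilinear_tensor_eqI[of _ _ u v]) (simp_all add: lin clinear_compose[OF clinear_flip] clinear_flip flip_tensor)

lemma bij_flip: "bij_betw flip es es"
  by (rule bij_betw_byWitness[of _ flip]) (auto simp: flip_flip flip_es)

theorem flip_hopf_algebroid:
  "hopf_algebroid base mul 1 es es_mul (1 \<otimes> 1) (\<lambda>b. b \<otimes> 1) (\<lambda>b. 1 \<otimes> b) cop mult flip"
proof (intro hopf_algebroid.intro left_bialgebroid.intro hopf_algebroid_axioms.intro,
    unfold bialgebroid_rel2 es_rel3_def[symmetric])
  show "algebra_on base mul 1"
    by unfold_locales
      (simp_all add: base_subspace one_base mul_base mul_assoc cbilinear_add[OF mul_bilinear]
        cbilinear_scale[OF mul_bilinear])
  show "algebra_on es es_mul (1 \<otimes> 1)"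
    by unfold_locales
      (simp_all add: es_subspace source_es one_base es_mul_closed es_mul_assoc cbilinear_add[OF es_mul_bilinear]
        cbilinear_scale[OF es_mul_bilinear])
  show "cop h \<in> bialgebroid_data.tens2 base es es_mul (\<lambda>b. b \<otimes> 1) (\<lambda>b. 1 \<otimes> b)" if "h \<in> es" for h
    using cop_lift_es2[OF that]
    by (simp add: bialgebroid_data.tens2_def balanced_tensor_def cop_coset that es2_def es_rel_def)
qed (simp_all add: cop_bimodule[simplified] mult_bimodule[simplified] source_es target_es tensor_add_left tensor_add_right tensor_scale_left tensor_scale_right
    cop_add cop_bimodule mult_base clinear_add[OF mult_linear] mult_bimodule cop_coassoc counit_left
    counit_right cop_takeuchi cop_one cop_mul mult_es_mul_source mult_es_mul_target bij_flip
    clinear_add[OF clinear_flip] clinear_scale[OF clinear_flip] flip_tensor flip_es_mul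
    cop_flip_left cop_flip_right)

end

section \<open>Commutative algebras and the universal property of \<open>\<O>(SO)\<close>\<close>

class comm_calg = comm_ring_1 + cvec +
  assumes scaleC_mult_left: "(c *\<^sub>C x) * y = c *\<^sub>C (x * y)"

lemma scaleC_mult_right: "x * (c *\<^sub>C y) = c *\<^sub>C (x * y :: 'a::comm_calg)"
  using scaleC_mult_left[of c y x] by (simp add: mult.commute)

instance complex :: comm_calg
  by standard (simp add: scaleC_complex_def)

lemma scaleC_eq_mult: "c *\<^sub>C x = (c *\<^sub>C 1) * (x :: 'a::comm_calg)"
  by (simp add: scaleC_mult_left)

lemma scaleC_poly_mapping_eq_mult:
  "c *\<^sub>C p = Poly_Mapping.single 0 (c *\<^sub>C 1) * (p :: 'm::comm_monoid_add \<Rightarrow>\<^sub>0 'a::comm_calg)"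
  unfolding mult_map_scale_conv_mult[symmetric]
  by (rule poly_mapping_eqI)
     (simp add: scaleC_poly_mapping.rep_eq map.rep_eq when_def scaleC_eq_mult[symmetric])

instance poly_mapping :: (comm_monoid_add, comm_calg) comm_calg
  by standard (simp only: scaleC_poly_mapping_eq_mult mult.assoc)

lemma cbilinear_times: "cbilinear ((*) :: 'a::comm_calg \<Rightarrow> 'a \<Rightarrow> 'a)"
  by (intro cbilinearI clinearI) (simp_all only: distrib_left distrib_right scaleC_mult_left scaleC_mult_right)

text \<open>For nontriviality of the tensor product of algebras: the product of two such functionals
  separates 1 \<otimes> 1 from 0.\<close>

lemma unital_functional:
  obtains \<phi> :: "'a::comm_calg \<Rightarrow> complex" where "clinear \<phi>" "\<phi> 1 = 1"
proof -
  interpret vector_space_pair "scaleC :: complex \<Rightarrow> 'a \<Rightarrow> 'a" "scaleC :: complex \<Rightarrow> complex \<Rightarrow> complex"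
    by unfold_locales
  have "cvec.independent {1 :: 'a}" by (simp add: cvec.dependent_single)
  from linear_independent_extend[OF this, of "\<lambda>_. 1"] that show ?thesis by auto
qed

instantiation tensor :: (comm_calg, comm_calg) comm_calg
begin
definition one_tensor :: "'a \<otimes> 'b" where "1 = 1 \<otimes> 1"
definition times_tensor :: "'a \<otimes> 'b \<Rightarrow> 'a \<otimes> 'b \<Rightarrow> 'a \<otimes> 'b" where "(*) = tensor_mult (*) (*)"
instance
proof
  fix a b c :: "'a \<otimes> 'b" and k :: complex
  note bil = cbilinear_tensor_mult[OF cbilinear_times cbilinear_times]
  show "a * b * c = a * (b * c)"
    unfolding times_tensor_def
    by (rule tensor_mult_assoc[OF cbilinear_times cbilinear_times]) (simp_all only: mult.assoc)
  show "a * b = b * a"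
    unfolding times_tensor_def
  proof (induction a rule: tensor_induct)
    case (pure x y)
    show ?case
      by (induction b rule: tensor_induct)
        (simp_all only: cbilinear_add[OF bil] tensor_mult_tensor[OF cbilinear_times cbilinear_times] mult.commute)
  qed (simp only: cbilinear_add[OF bil])
  show "1 * a = a"
    unfolding times_tensor_def one_tensor_def
    by (induction a rule: tensor_induct)
      (simp_all only: cbilinear_add[OF bil] tensor_mult_tensor[OF cbilinear_times cbilinear_times] mult_1)
  show "(a + b) * c = a * c + b * c" "k *\<^sub>C a * b = k *\<^sub>C (a * b)"
    unfolding times_tensor_def by (simp_all only: cbilinear_add[OF bil] cbilinear_scale[OF bil])
  obtain \<phi> :: "'a \<Rightarrow> complex" where \<phi>: "clinear \<phi>" "\<phi> 1 = 1" by (rule unital_functional)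
  obtain \<psi> :: "'b \<Rightarrow> complex" where \<psi>: "clinear \<psi>" "\<psi> 1 = 1" by (rule unital_functional)
  define F where "F = tensor_lift (\<lambda>x y. \<phi> x *\<^sub>C \<psi> y)"
  have F: "clinear F" "F (x \<otimes> y) = \<phi> x *\<^sub>C \<psi> y" for x y
    unfolding F_def by (simp_all add: clinear_tensor_lift lin_intros \<phi> \<psi>)
  have "F 1 \<noteq> F 0"
    by (simp add: one_tensor_def F \<phi> \<psi> clinear_zero[OF F(1)] scaleC_complex_def)
  then show "(0 :: 'a \<otimes> 'b) \<noteq> 1" by auto
qed
end

lemma tensor_times: "(x \<otimes> y) * (z \<otimes> w) = (x * z) \<otimes> (y * w)"
  unfolding times_tensor_def by (rule tensor_mult_tensor[OF cbilinear_times cbilinear_times])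

definition alg_hom :: "('a::{times, one, cvec} \<Rightarrow> 'b::{times, one, cvec}) \<Rightarrow> bool"
  where "alg_hom f \<longleftrightarrow> clinear f \<and> f 1 = 1 \<and> (\<forall>x y. f (x * y) = f x * f y)"

lemma alg_homI: "clinear f \<Longrightarrow> f 1 = 1 \<Longrightarrow> (\<And>x y. f (x * y) = f x * f y) \<Longrightarrow> alg_hom f"
  by (simp add: alg_hom_def)

lemma alg_homD:
  assumes "alg_hom f"
  shows "clinear f" "f 1 = 1" "f (x * y) = f x * f y"
  using assms by (simp_all add: alg_hom_def)

lemma alg_hom_id: "alg_hom (\<lambda>x. x)"
  by (simp add: alg_hom_def clinear_id)

lemma alg_hom_compose: "alg_hom f \<Longrightarrow> alg_hom g \<Longrightarrow> alg_hom (\<lambda>x. f (g x))"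
  by (simp add: alg_hom_def clinear_compose)

lemma alg_hom_tensor_lift:
  fixes E :: "'a::comm_calg \<Rightarrow> 'b::comm_calg \<Rightarrow> 'c::comm_calg"
  assumes E: "cbilinear E" and one: "E 1 1 = 1"
    and mul: "\<And>x y z w. E (x * z) (y * w) = E x y * E z w"
  shows "alg_hom (tensor_lift E)"
proof (rule alg_homI)
  show "tensor_lift E (s * t) = tensor_lift E s * tensor_lift E t" for s t
    by (rule bilinear_tensor_eqI[of _ _ s t])
      (simp_all add: tensor_times E mul lin_intros cbilinear_left[OF cbilinear_times] cbilinear_right[OF cbilinear_times])
qed (simp_all add: clinear_tensor_lift E one one_tensor_def)

lemma alg_hom_sum: "alg_hom f \<Longrightarrow> f (\<Sum>i\<in>I. g i) = (\<Sum>i\<in>I. f (g i))"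
  by (rule clinear_sum[OF alg_homD(1)])

lemma alg_hom_prod: "alg_hom f \<Longrightarrow> f (\<Prod>i\<in>I. g i) = (\<Prod>i\<in>I. f (g i))"
  for f :: "'a::comm_calg \<Rightarrow> 'b::comm_calg"
  by (induction I rule: infinite_finite_induct) (simp_all add: alg_homD)

lemma alg_hom_det: "alg_hom f \<Longrightarrow> f (det M) = det (map_matrix f M)"
  for f :: "'a::comm_calg \<Rightarrow> 'b::comm_calg"
proof -
  assume f: "alg_hom f"
  have "f (of_int (sign p)) = of_int (sign p)" for p :: "'c \<Rightarrow> 'c"
    by (cases p rule: sign_cases) (simp_all add: alg_homD[OF f] clinear_neg[OF alg_homD(1)[OF f]])
  then show ?thesis
    unfolding det_def by (simp add: alg_hom_sum[OF f] alg_homD[OF f] alg_hom_prod[OF f])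
qed

lemma alg_hom_matrix_mult: "alg_hom f \<Longrightarrow> map_matrix f (M ** N) = map_matrix f M ** map_matrix f N"
  for f :: "'a::comm_calg \<Rightarrow> 'b::comm_calg"
  by (simp add: vec_eq_iff matrix_matrix_mult_def alg_hom_sum alg_homD)

lemma alg_hom_Q_matrix: "alg_hom f \<Longrightarrow> map_matrix f Q_matrix = Q_matrix"
  for f :: "'a::comm_calg \<Rightarrow> 'b::comm_calg"
  by (simp add: vec_eq_iff Q_matrix_def alg_homD clinear_zero[OF alg_homD(1)])

lemma map_matrix_transpose: "map_matrix f (transpose M) = transpose (map_matrix f M)"
  by (simp add: vec_eq_iff transpose_def)

text \<open>The points of SO with values in a commutative ring; over a commutative complex algebra
  they correspond to algebra homomorphisms out of the coordinate ring.\<close>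

definition so_relations :: "'r::comm_ring_1 ^ 'i::quad_index ^ 'i::quad_index \<Rightarrow> bool" where
  "so_relations M \<longleftrightarrow> transpose M ** Q_matrix ** M = Q_matrix \<and>
     M ** Q_matrix ** transpose M = Q_matrix \<and> det M = 1"

lemma so_relationsD:
  assumes "so_relations M"
  shows "transpose M ** Q_matrix ** M = Q_matrix" "M ** Q_matrix ** transpose M = Q_matrix" "det M = 1"
  using assms by (simp_all add: so_relations_def)

lemma so_relations_map_matrix:
  fixes f :: "'a::comm_calg \<Rightarrow> 'b::comm_calg"
  assumes f: "alg_hom f" and M: "so_relations M"
  shows "so_relations (map_matrix f M)"
  unfolding so_relations_def
  using so_relationsD(1,2)[OF M, THEN arg_cong[of _ _ "map_matrix f"]] so_relationsD(3)[OF M, THEN arg_cong[of _ _ f]]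
  by (simp add: alg_hom_matrix_mult[OF f] alg_hom_Q_matrix[OF f] map_matrix_transpose alg_homD(2)[OF f]
      flip: alg_hom_det[OF f])

text \<open>Closure of points under products, the identity matrix and adjoints provides, through the
  universal property, the coproduct, the counit and the antipode.\<close>

lemma so_relations_mult:
  assumes M: "so_relations M" and N: "so_relations N"
  shows "so_relations (M ** N)"
proof -
  have "transpose (M ** N) ** Q_matrix ** (M ** N) = transpose N ** (transpose M ** Q_matrix ** M) ** N"
    "M ** N ** Q_matrix ** transpose (M ** N) = M ** (N ** Q_matrix ** transpose N) ** transpose M"
    by (simp_all only: matrix_transpose_mul matrix_mul_assoc)
  then show ?thesis
    by (simp add: so_relations_def so_relationsD[OF M] so_relationsD[OF N] det_mul)
qed

lemma so_relations_mat: "so_relations (mat 1)"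
  by (simp add: so_relations_def)

lemma transpose_Q_matrix: "transpose Q_matrix = Q_matrix"
  by (auto simp: vec_eq_iff transpose_def Q_matrix_def conj_index_conj_index)

lemma Q_matrix_left: "(Q_matrix ** M) $ J $ K = M $ conj_index J $ K"
  by (simp add: matrix_matrix_mult_def Q_matrix_def if_distrib[of "\<lambda>x. x * _"] cong: if_cong)

lemma Q_matrix_right: "(M ** Q_matrix) $ J $ K = M $ J $ conj_index K"
proof -
  have "(M ** Q_matrix) $ J $ K = (\<Sum>m\<in>UNIV. M $ J $ m * (if K = conj_index m then 1 else 0))"
    by (simp only: matrix_matrix_mult_def Q_matrix_def vec_lambda_beta)
  also have "\<dots> = (\<Sum>m\<in>UNIV. if m = conj_index K then M $ J $ m else 0)"
    by (rule sum.cong) (auto simp: conj_index_conj_index)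
  finally show ?thesis by simp
qed

lemma Q_matrix_Q_matrix: "Q_matrix ** Q_matrix = (mat 1 :: 'r::comm_ring_1 ^ 'i::quad_index ^ 'i::quad_index)"
  unfolding vec_eq_iff Q_matrix_left by (simp add: Q_matrix_def mat_def conj_index_conj_index eq_commute)

lemma so_relations_adjoint:
  fixes M :: "'r::comm_ring_1 ^ 'i::quad_index ^ 'i::quad_index"
  assumes M: "so_relations M"
  shows "so_relations (Q_matrix ** transpose M ** Q_matrix)"
proof -
  have Q: "A ** Q_matrix ** Q_matrix = A" for A
    unfolding matrix_mul_assoc[symmetric] Q_matrix_Q_matrix by (rule matrix_mul_rid)
  have "transpose (Q_matrix ** transpose M ** Q_matrix) ** Q_matrix ** (Q_matrix ** transpose M ** Q_matrix) =
      Q_matrix ** (M ** Q_matrix ** transpose M) ** Q_matrix"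
    "Q_matrix ** transpose M ** Q_matrix ** Q_matrix ** transpose (Q_matrix ** transpose M ** Q_matrix) =
      Q_matrix ** (transpose M ** Q_matrix ** M) ** Q_matrix"
    by (simp_all only: matrix_transpose_mul transpose_transpose transpose_Q_matrix matrix_mul_assoc Q)
  moreover have "det (Q_matrix ** transpose M ** Q_matrix) = det (Q_matrix ** Q_matrix :: 'r ^ 'i::quad_index ^ 'i::quad_index) * det M"
    by (simp only: det_mul det_transpose mult.assoc mult.commute[of "det M"])
  ultimately show ?thesis
    by (simp only: so_relations_def so_relationsD[OF M] Q Q_matrix_Q_matrix det_I mult_1 matrix_mul_lid simp_thms)
qed

section \<open>Evaluation of polynomials and the universal property\<close>

definition eval_monomial :: "('v \<Rightarrow> 'r::comm_calg) \<Rightarrow> ('v \<Rightarrow>\<^sub>0 nat) \<Rightarrow> 'r"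
  where "eval_monomial f m = (\<Prod>v\<in>Poly_Mapping.keys m. f v ^ Poly_Mapping.lookup m v)"

text \<open>Serves twice: for the evaluation of polynomials, and for sums over homogeneous
  components in the deformed product.\<close>

definition poly_sum :: "('k \<Rightarrow> 'a::cvec \<Rightarrow> 'b::cvec) \<Rightarrow> ('k \<Rightarrow>\<^sub>0 'a) \<Rightarrow> 'b"
  where "poly_sum E p = (\<Sum>k\<in>Poly_Mapping.keys p. E k (Poly_Mapping.lookup p k))"

lemma poly_sum_superset:
  assumes E: "\<And>k. clinear (E k)" and "finite S" "Poly_Mapping.keys p \<subseteq> S"
  shows "poly_sum E p = (\<Sum>k\<in>S. E k (Poly_Mapping.lookup p k))"
  unfolding poly_sum_def
  by (rule sum.mono_neutral_left)
    (use assms in \<open>auto simp: not_in_keys_iff_lookup_eq_zero clinear_zero[OF E]\<close>)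

lemma poly_sum_linear:
  fixes E :: "'a \<Rightarrow> 'b::cvec \<Rightarrow> 'c::cvec"
  assumes E: "\<And>k. clinear (E k)"
  shows "clinear (poly_sum E)"
proof (rule clinearI)
  fix p q :: "'a \<Rightarrow>\<^sub>0 'b" and c
  have "Poly_Mapping.keys (p + q) \<subseteq> Poly_Mapping.keys p \<union> Poly_Mapping.keys q" by (rule keys_add)
  then show "poly_sum E (p + q) = poly_sum E p + poly_sum E q"
    by (simp add: poly_sum_superset[OF E, of "Poly_Mapping.keys p \<union> Poly_Mapping.keys q"] lookup_add
        clinear_add[OF E] sum.distrib)
  have "Poly_Mapping.keys (c *\<^sub>C p) \<subseteq> Poly_Mapping.keys p"
    by (auto simp: in_keys_iff scaleC_poly_mapping.rep_eq)
  then show "poly_sum E (c *\<^sub>C p) = c *\<^sub>C poly_sum E p"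
    by (simp add: poly_sum_superset[OF E, of "Poly_Mapping.keys p"] scaleC_poly_mapping.rep_eq
        clinear_scale[OF E] cvec.scale_sum_right)
qed

lemma poly_sum_single:
  assumes "clinear (E k)"
  shows "poly_sum E (Poly_Mapping.single k a) = E k a"
  using clinear_zero[OF assms] by (simp add: poly_sum_def)

definition eval_poly :: "('v \<Rightarrow> 'r::comm_calg) \<Rightarrow> (('v \<Rightarrow>\<^sub>0 nat) \<Rightarrow>\<^sub>0 complex) \<Rightarrow> 'r"
  where "eval_poly f = poly_sum (\<lambda>m c. c *\<^sub>C eval_monomial f m)"

lemma eval_monomial_superset:
  "finite S \<Longrightarrow> Poly_Mapping.keys m \<subseteq> S \<Longrightarrow> eval_monomial f m = (\<Prod>v\<in>S. f v ^ Poly_Mapping.lookup m v)"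
  unfolding eval_monomial_def
  by (rule prod.mono_neutral_left) (auto simp: not_in_keys_iff_lookup_eq_zero)

lemma eval_monomial_add: "eval_monomial f (m + n) = eval_monomial f m * eval_monomial f n"
proof -
  let ?S = "Poly_Mapping.keys m \<union> Poly_Mapping.keys n"
  have "Poly_Mapping.keys (m + n) \<subseteq> ?S" by (rule keys_add)
  then show ?thesis
    by (simp add: eval_monomial_superset[of ?S] lookup_add power_add prod.distrib)
qed

lemma eval_poly_linear: "clinear (eval_poly f)"
  unfolding eval_poly_def by (intro poly_sum_linear lin_intros)

lemma eval_poly_single: "eval_poly f (Poly_Mapping.single m c) = c *\<^sub>C eval_monomial f m"
  unfolding eval_poly_def by (rule poly_sum_single) (intro lin_intros)

lemma poly_mapping_add_induct [case_names zero add single]: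
  assumes "P 0" "\<And>p q. P p \<Longrightarrow> P q \<Longrightarrow> P (p + q)" "\<And>k c. P (Poly_Mapping.single k c)"
  shows "P (p :: 'k \<Rightarrow>\<^sub>0 'c::comm_monoid_add)"
proof -
  have "P (\<Sum>k\<in>K. Poly_Mapping.single k (Poly_Mapping.lookup p k))" for K
    by (induction K rule: infinite_finite_induct) (simp_all add: assms)
  moreover have "(\<Sum>k\<in>Poly_Mapping.keys p. Poly_Mapping.single k (Poly_Mapping.lookup p k)) = p"
    by (rule poly_mapping_eqI) (simp add: lookup_sum lookup_single when_def not_in_keys_iff_lookup_eq_zero)
  ultimately show ?thesis by metis
qed

lemma alg_hom_eval_poly: "alg_hom (eval_poly f)"
proof (rule alg_homI[OF eval_poly_linear])
  show "eval_poly f 1 = 1"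
    by (simp add: eval_poly_single eval_monomial_def scaleC_one flip: single_one)
  fix p q :: "('a \<Rightarrow>\<^sub>0 nat) \<Rightarrow>\<^sub>0 complex"
  show "eval_poly f (p * q) = eval_poly f p * eval_poly f q"
  proof (induction p rule: poly_mapping_add_induct)
    case (single m c)
    show ?case
    proof (induction q rule: poly_mapping_add_induct)
      case (single n d)
      show ?case
        by (simp add: mult_single eval_poly_single eval_monomial_add scaleC_mult_left scaleC_mult_right scaleC_scaleC)
    qed (simp_all add: clinear_zero[OF eval_poly_linear] clinear_add[OF eval_poly_linear] distrib_left)
  qed (simp_all add: clinear_zero[OF eval_poly_linear] clinear_add[OF eval_poly_linear] distrib_right)
qed

lemma eval_poly_generic: "map_matrix (eval_poly (\<lambda>(J, K). M $ J $ K)) generic_matrix = M"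
  by (simp add: vec_eq_iff generic_matrix_def eval_poly_single eval_monomial_def scaleC_one)

lemma eval_poly_so_ideal:
  assumes M: "so_relations M" and p: "p \<in> so_ideal"
  shows "eval_poly (\<lambda>(J, K). M $ J $ K) p = 0"
  using p unfolding so_ideal_def
proof (induction rule: ring_ideal.span_induct_alt)
  let ?E = "eval_poly (\<lambda>(J, K). M $ J $ K)"
  note E = alg_hom_eval_poly[of "\<lambda>(J, K). M $ J $ K"]
  {
    case base
    show ?case by (simp add: clinear_zero[OF eval_poly_linear])
  next
    case (step c x y)
    have map_zero: "map_matrix ?E A = 0 \<Longrightarrow> ?E (A $ J $ K) = 0" for A J K
      by (metis nth_map_matrix zero_index)
    have map_diff: "map_matrix ?E (A - C) = map_matrix ?E A - map_matrix ?E C" for A C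
      by (simp add: vec_eq_iff clinear_diff[OF eval_poly_linear])
    have "?E x = 0"
      using step(1)
      by (auto simp: map_diff alg_hom_matrix_mult[OF E] alg_hom_Q_matrix[OF E] map_matrix_transpose eval_poly_generic
          so_relationsD[OF M] clinear_diff[OF eval_poly_linear] alg_hom_det[OF E] alg_homD(2)[OF E]
          simp del: vector_minus_component intro!: map_zero)
    then show ?case using step(2)
      by (simp add: clinear_add[OF eval_poly_linear] alg_homD(3)[OF E])
  }
qed

lemma abs_so_cases: obtains p where "x = abs_so p"
  by (rule that[of "rep_so x"]) (rule Quotient3_abs_rep[OF Quotient3_so, symmetric])

lemma so_lift:
  fixes M :: "'r::comm_calg ^ 'i::quad_index ^ 'i::quad_index"
  assumes M: "so_relations M"
  obtains f where "alg_hom f" "\<And>p. f (abs_so p) = eval_poly (\<lambda>(J, K). M $ J $ K) p"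
    "\<And>J K. f (gen J K) = M $ J $ K"
proof -
  let ?E = "eval_poly (\<lambda>(J, K). M $ J $ K)"
  note E = alg_hom_eval_poly[of "\<lambda>(J, K). M $ J $ K"]
  define f where "f x = ?E (rep_so x)" for x
  have f: "f (abs_so p) = ?E p" for p
  proof -
    have "rep_so (abs_so p) - p \<in> so_ideal"
      by (rule Quotient3_rep_abs[OF Quotient3_so]) (simp add: so_ideal_zero)
    from eval_poly_so_ideal[OF M this] show ?thesis by (simp add: f_def clinear_diff[OF eval_poly_linear])
  qed
  have "alg_hom f"
  proof (intro alg_homI clinearI)
    fix x y :: "'i so" and c
    obtain p where x: "x = abs_so p" by (rule abs_so_cases)
    obtain q where y: "y = abs_so q" by (rule abs_so_cases)
    show "f (x + y) = f x + f y" "f (c *\<^sub>C x) = c *\<^sub>C f x" "f (x * y) = f x * f y"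
      by (simp_all add: x y f plus_so.abs_eq scaleC_so.abs_eq times_so.abs_eq
          clinear_add[OF eval_poly_linear] clinear_scale[OF eval_poly_linear] alg_homD(3)[OF E])
    show "f 1 = 1" by (simp add: one_so_def f alg_homD(2)[OF E])
  qed
  moreover have "f (gen J K) = M $ J $ K" for J K
    using eval_poly_generic[of M] by (metis f gen.abs_eq nth_map_matrix)
  ultimately show ?thesis using f that by blast
qed

text \<open>The identity matrix is a complex point, and its character separates 1 from 0.\<close>

lemma so_nontrivial: "(0 :: 'i::quad_index so) \<noteq> 1"
proof -
  obtain f :: "'i so \<Rightarrow> complex" where "alg_hom f" by (rule so_lift[OF so_relations_mat])
  then have "f 1 \<noteq> f 0" using clinear_zero[OF alg_homD(1)] alg_homD(2) by fastforce
  then show ?thesis by metis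
qed

instance so :: (quad_index) comm_calg
proof
  fix a b :: "'a so" and c
  obtain p where a: "a = abs_so p" by (rule abs_so_cases)
  obtain q where b: "b = abs_so q" by (rule abs_so_cases)
  show "c *\<^sub>C a * b = c *\<^sub>C (a * b)"
    by (simp add: a b scaleC_so.abs_eq times_so.abs_eq scaleC_mult_left)
qed (simp_all add: so_nontrivial)

definition gen_matrix :: "'i::quad_index so ^ 'i::quad_index ^ 'i::quad_index"
  where "gen_matrix = (\<chi> J K. gen J K)"

lemma matrix_mult_nth: "(A ** B) $ i $ j = (\<Sum>k\<in>UNIV. A $ i $ k * B $ k $ j)"
  by (simp add: matrix_matrix_mult_def)

lemma transpose_nth: "transpose M $ i $ j = M $ j $ i"
  by (simp add: transpose_def)

lemma quadratic_form_nth: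
  "(transpose M ** Q_matrix ** M) $ i $ j = (\<Sum>k\<in>UNIV. M $ conj_index k $ i * M $ k $ j)"
  "(M ** Q_matrix ** transpose M) $ i $ j = (\<Sum>k\<in>UNIV. M $ i $ conj_index k * M $ j $ k)"
  by (simp_all only: matrix_mult_nth[of "transpose M ** Q_matrix"] matrix_mult_nth[of "M ** Q_matrix"]
      Q_matrix_right transpose_nth)

lemma Q_matrix_nth: "Q_matrix $ i $ j = (if j = conj_index i then 1 else 0)"
  by (simp add: Q_matrix_def)

lemma so_relations_iff:
  "so_relations M \<longleftrightarrow>
    (\<forall>i j. (\<Sum>k\<in>UNIV. M $ conj_index k $ i * M $ k $ j) = (if j = conj_index i then 1 else 0)) \<and>
    (\<forall>i j. (\<Sum>k\<in>UNIV. M $ i $ conj_index k * M $ j $ k) = (if j = conj_index i then 1 else 0)) \<and> det M = 1"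
  by (simp only: so_relations_def vec_eq_iff quadratic_form_nth Q_matrix_nth)

lemmas so_relation_sums = so_relations_iff[THEN iffD1, THEN conjunct1, rule_format]
  so_relations_iff[THEN iffD1, THEN conjunct2, THEN conjunct1, rule_format]

lemma alg_hom_abs_so: "alg_hom abs_so"
  by (intro alg_homI clinearI)
    (simp_all add: one_so_def plus_so.abs_eq scaleC_so.abs_eq times_so.abs_eq)

lemma abs_so_eq_iff: "abs_so p = abs_so q \<longleftrightarrow> p - q \<in> so_ideal"
  by (rule so.abs_eq_iff)

lemma gen_matrix_eq: "gen_matrix = map_matrix abs_so generic_matrix"
  by (simp add: vec_eq_iff gen_matrix_def gen.abs_eq)

lemma gen_matrix_nth [simp]: "gen_matrix $ J $ K = gen J K"
  by (simp add: gen_matrix_def)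

lemma so_relations_gen_matrix: "so_relations (gen_matrix :: 'i::quad_index so ^ 'i::quad_index ^ 'i::quad_index)"
proof -
  let ?g = "generic_matrix :: 'i::quad_index entry_poly ^ 'i::quad_index ^ 'i::quad_index"
  have "map_matrix abs_so (transpose ?g ** Q_matrix ** ?g) = map_matrix abs_so Q_matrix"
    "map_matrix abs_so (?g ** Q_matrix ** transpose ?g) = map_matrix abs_so Q_matrix"
    unfolding vec_eq_iff nth_map_matrix abs_so_eq_iff vector_minus_component[symmetric]
    by (auto simp: so_ideal_def intro!: ring_ideal.span_base)
  moreover have "abs_so (det ?g) = abs_so 1"
    unfolding abs_so_eq_iff by (auto simp: so_ideal_def intro!: ring_ideal.span_base)
  ultimately show ?thesis
    by (simp add: so_relations_def gen_matrix_eq alg_hom_matrix_mult[OF alg_hom_abs_so]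
        alg_hom_Q_matrix[OF alg_hom_abs_so] map_matrix_transpose alg_homD(2)[OF alg_hom_abs_so]
        flip: alg_hom_det[OF alg_hom_abs_so])
qed

lemma so_monomial_induct [case_names one gen]:
  assumes "P 1" "\<And>x J K. P x \<Longrightarrow> P (gen J K * x)"
  shows "P (abs_so (Poly_Mapping.single m 1))"
proof -
  \<comment> \<open>A right factor x is carried along so that generators can be split off from the
    left one at a time, across products of monomials.\<close>
  have "P x \<Longrightarrow> P (abs_so (Poly_Mapping.single m 1) * x)" for x
  proof (induction m arbitrary: x rule: poly_mapping_add_induct)
    case zero
    then show ?case by (simp add: one_so_def[symmetric])
  next
    case (add m n)
    have eq: "abs_so (Poly_Mapping.single (m + n) 1) * x =
        abs_so (Poly_Mapping.single m 1) * (abs_so (Poly_Mapping.single n 1) * x)"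
      by (simp add: times_so.abs_eq mult_single flip: mult.assoc)
    show ?case unfolding eq by (rule add.IH(1)[OF add.IH(2)[OF add.prems]])
  next
    case (single v k)
    show ?case
    proof (induction k)
      case 0
      then show ?case using single by (simp add: one_so_def[symmetric])
    next
      case (Suc k)
      have "abs_so (Poly_Mapping.single (Poly_Mapping.single v (Suc k)) 1) * x =
          gen (fst v) (snd v) * (abs_so (Poly_Mapping.single (Poly_Mapping.single v k) 1) * x)"
        by (simp add: gen.abs_eq generic_matrix_def times_so.abs_eq mult_single flip: mult.assoc single_add)
      then show ?case using assms(2)[OF Suc] by simp
    qed
  qed
  from this[OF assms(1)] show ?thesis by simp
qed

lemma so_induct [case_names one add scale gen]:
  assumes one: "P 1" and add: "\<And>x y. P x \<Longrightarrow> P y \<Longrightarrow> P (x + y)" and scale: "\<And>c x. P x \<Longrightarrow> P (c *\<^sub>C x)"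
    and gen: "\<And>x J K. P x \<Longrightarrow> P (gen J K * x)"
  shows "P (x :: 'i::quad_index so)"
proof -
  obtain p where x: "x = abs_so p" by (rule abs_so_cases)
  have mono: "P (abs_so (Poly_Mapping.single m 1))" for m
    by (rule so_monomial_induct) (fact one gen)+
  show ?thesis unfolding x
  proof (induction p rule: poly_mapping_add_induct)
    case zero
    show ?case using scale[OF one, of 0] by (simp add: zero_so_def)
  next
    case (add p q)
    then show ?case using assms(2) by (simp flip: plus_so.abs_eq)
  next
    case (single m c)
    show ?case using scale[OF mono[of m], of c] by (simp add: scaleC_so.abs_eq scaleC_single)
  qed
qed

lemma so_hom_eqI:
  fixes f g :: "'i::quad_index so \<Rightarrow> 'r::{times, one, cvec}"
  assumes f: "alg_hom f" and g: "alg_hom g" and eq: "\<And>J K. f (gen J K) = g (gen J K)"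
  shows "f x = g x"
  by (induction x rule: so_induct)
    (simp_all add: alg_homD(2,3)[OF f] alg_homD(2,3)[OF g] clinear_add[OF alg_homD(1)[OF f]]
      clinear_add[OF alg_homD(1)[OF g]] clinear_scale[OF alg_homD(1)[OF f]] clinear_scale[OF alg_homD(1)[OF g]] eq)

definition so_hom :: "'r::comm_calg ^ 'i::quad_index ^ 'i::quad_index \<Rightarrow> 'i so \<Rightarrow> 'r"
  where "so_hom M = (SOME f. alg_hom f \<and> (\<forall>J K. f (gen J K) = M $ J $ K))"

lemma
  assumes "so_relations M"
  shows alg_hom_so_hom: "alg_hom (so_hom M)" and so_hom_gen: "so_hom M (gen J K) = M $ J $ K"
proof -
  obtain f where "alg_hom f" "\<And>p. f (abs_so p) = eval_poly (\<lambda>(J, K). M $ J $ K) p"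
    "\<And>J K. f (gen J K) = M $ J $ K" by (rule so_lift[OF assms]) (rule that)
  then have "\<exists>f. alg_hom f \<and> (\<forall>J K. f (gen J K) = M $ J $ K)" by blast
  from someI_ex[OF this] have "alg_hom (so_hom M) \<and> (\<forall>J K. so_hom M (gen J K) = M $ J $ K)"
    unfolding so_hom_def .
  then show "alg_hom (so_hom M)" "so_hom M (gen J K) = M $ J $ K" by simp_all
qed

section \<open>The Hopf algebra structure\<close>

lemma alg_hom_tensor_left: "alg_hom (\<lambda>x::'a::comm_calg. x \<otimes> (1 :: 'b::comm_calg))"
  by (intro alg_homI lin_intros) (simp_all add: one_tensor_def tensor_times)

lemma alg_hom_tensor_right: "alg_hom (\<lambda>x::'b::comm_calg. (1 :: 'a::comm_calg) \<otimes> x)"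
  by (intro alg_homI lin_intros) (simp_all add: one_tensor_def tensor_times)

lemma tensor_sum_right: "y \<otimes> (\<Sum>i\<in>I. f i) = (\<Sum>i\<in>I. y \<otimes> f i)"
  by (rule clinear_sum[OF clinear_tensor_right[OF clinear_id]])

lemma
  shows alg_hom_so_coproduct: "alg_hom (so_coproduct :: 'i::quad_index so \<Rightarrow> _)"
    and so_coproduct_gen: "so_coproduct (gen J K :: 'i so) = (\<Sum>M\<in>UNIV. gen J M \<otimes> gen M K)"
proof -
  \<comment> \<open>The product of two copies of the generic matrix, one in each tensor factor, is
    again a point.\<close>
  define M :: "('i so \<otimes> 'i so) ^ 'i::quad_index ^ 'i::quad_index" where
    "M = map_matrix (\<lambda>x. x \<otimes> 1) gen_matrix ** map_matrix (\<lambda>x. 1 \<otimes> x) gen_matrix"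
  have M: "so_relations M"
    unfolding M_def
    by (intro so_relations_mult so_relations_map_matrix so_relations_gen_matrix alg_hom_tensor_left
        alg_hom_tensor_right)
  have gen: "M $ J $ K = (\<Sum>M\<in>UNIV. gen J M \<otimes> gen M K)" for J K
    by (simp add: M_def matrix_matrix_mult_def tensor_times)
  define P where "P f \<longleftrightarrow> clinear f \<and> f 1 = 1 \<otimes> 1 \<and>
     (\<forall>x y. f (x * y) = tensor_mult (*) (*) (f x) (f y)) \<and>
     (\<forall>J K. f (gen J K) = (\<Sum>M\<in>UNIV. gen J M \<otimes> gen M K))" for f :: "'i so \<Rightarrow> 'i so \<otimes> 'i so"
  have P: "P f \<longleftrightarrow> alg_hom f \<and> (\<forall>J K. f (gen J K) = (\<Sum>M\<in>UNIV. gen J M \<otimes> gen M K))" for f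
    by (simp add: P_def alg_hom_def one_tensor_def times_tensor_def)
  have "P (so_hom M)" by (simp add: P alg_hom_so_hom[OF M] so_hom_gen[OF M] gen)
  moreover have "f = g" if "P f" "P g" for f g
    using that so_hom_eqI[of f g] by (auto simp: P)
  ultimately have "\<exists>!f. P f" by blast
  from theI'[OF this] have "P so_coproduct" unfolding so_coproduct_def P_def .
  then show "alg_hom (so_coproduct :: 'i so \<Rightarrow> _)"
    "so_coproduct (gen J K :: 'i so) = (\<Sum>M\<in>UNIV. gen J M \<otimes> gen M K)"
    by (auto simp: P)
qed

definition so_counit :: "'i::quad_index so \<Rightarrow> complex"
  where "so_counit = so_hom (mat 1)"

definition so_antipode :: "'i::quad_index so \<Rightarrow> 'i so"
  where "so_antipode = so_hom (Q_matrix ** transpose gen_matrix ** Q_matrix)"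

lemma alg_hom_so_counit: "alg_hom so_counit"
  unfolding so_counit_def by (rule alg_hom_so_hom[OF so_relations_mat])

lemma so_counit_gen: "so_counit (gen J K) = (if J = K then 1 else 0)"
  unfolding so_counit_def so_hom_gen[OF so_relations_mat] by (simp add: mat_def)

lemma alg_hom_so_antipode: "alg_hom so_antipode"
  unfolding so_antipode_def by (rule alg_hom_so_hom[OF so_relations_adjoint[OF so_relations_gen_matrix]])

lemma so_antipode_gen: "so_antipode (gen J K) = gen (conj_index K) (conj_index J)"
  unfolding so_antipode_def so_hom_gen[OF so_relations_adjoint[OF so_relations_gen_matrix]]
  by (simp add: Q_matrix_right Q_matrix_left transpose_def)

lemma alg_hom_tensor_lift_hom:
  fixes f :: "'a::comm_calg \<Rightarrow> 'c::comm_calg" and g :: "'b::comm_calg \<Rightarrow> 'c"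
  assumes "alg_hom f" "alg_hom g"
  shows "alg_hom (tensor_lift (\<lambda>x y. f x * g y))"
proof (rule alg_hom_tensor_lift)
  show "cbilinear (\<lambda>x y. f x * g y)"
    by (intro cbilinearI cbilinear_left[OF cbilinear_times] cbilinear_right[OF cbilinear_times]
        alg_homD(1)[OF assms(1)] alg_homD(1)[OF assms(2)])
  show "f 1 * g 1 = 1" by (simp add: alg_homD(2)[OF assms(1)] alg_homD(2)[OF assms(2)])
  show "f (x * z) * g (y * w) = f x * g y * (f z * g w)" for x y z w
    unfolding alg_homD(3)[OF assms(1)] alg_homD(3)[OF assms(2)] by (simp only: mult_ac)
qed

lemma tensor_lift_so_coproduct_gen:
  "cbilinear E \<Longrightarrow> tensor_lift E (so_coproduct (gen J K)) = (\<Sum>M\<in>UNIV. E (gen J M) (gen M K))"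
  by (simp add: so_coproduct_gen clinear_sum[OF clinear_tensor_lift])

lemma so_coassoc:
  "tensor_lift (\<lambda>u v. tensor_lift (\<lambda>p q. p \<otimes> q \<otimes> v) (so_coproduct u)) (so_coproduct x) =
    tensor_lift (\<lambda>u v. u \<otimes> so_coproduct v) (so_coproduct (x :: 'i::quad_index so))"
proof (rule so_hom_eqI)
  note \<Delta> = alg_hom_so_coproduct[where 'i = 'i]
  note \<Delta>_lin = clinear_compose[OF alg_homD(1)[OF \<Delta>]]
  show "alg_hom (\<lambda>x :: 'i so. tensor_lift (\<lambda>u v. u \<otimes> so_coproduct v) (so_coproduct x))"
    by (intro alg_hom_compose[OF alg_hom_tensor_lift \<Delta>])
      (simp_all add: lin_intros \<Delta>_lin alg_homD[OF \<Delta>] one_tensor_def tensor_times)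
  have "tensor_lift (\<lambda>p q. p \<otimes> q \<otimes> (v * v')) (s * t) =
      tensor_lift (\<lambda>p q. p \<otimes> q \<otimes> v) s * tensor_lift (\<lambda>p q. p \<otimes> q \<otimes> v') t" for s t :: "'i so \<otimes> 'i so" and v v' :: "'i so"
    by (rule bilinear_tensor_eqI[of _ _ s t])
      (simp_all add: lin_intros cbilinear_left[OF cbilinear_times] cbilinear_right[OF cbilinear_times] tensor_times)
  then show "alg_hom (\<lambda>x :: 'i so. tensor_lift (\<lambda>u v. tensor_lift (\<lambda>p q. p \<otimes> q \<otimes> v) (so_coproduct u)) (so_coproduct x))"
    by (intro alg_hom_compose[OF alg_hom_tensor_lift \<Delta>])
      (simp_all add: lin_intros \<Delta>_lin alg_homD[OF \<Delta>] one_tensor_def)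
  show "tensor_lift (\<lambda>u v. tensor_lift (\<lambda>p q. p \<otimes> q \<otimes> v) (so_coproduct u)) (so_coproduct (gen J K)) =
      tensor_lift (\<lambda>u v. u \<otimes> so_coproduct v) (so_coproduct (gen J K :: 'i so))" for J K
    by (simp add: tensor_lift_so_coproduct_gen lin_intros \<Delta>_lin,
        simp add: so_coproduct_gen tensor_sum_right, rule sum.swap)
qed

lemma so_counit_left: "tensor_lift (\<lambda>u v. so_counit u *\<^sub>C v) (so_coproduct x) = x"
  and so_counit_right: "tensor_lift (\<lambda>u v. so_counit v *\<^sub>C u) (so_coproduct x) = (x :: 'i::quad_index so)"
proof -
  note hom = alg_hom_so_coproduct[where 'i = 'i] alg_hom_so_counit[where 'a = 'i] alg_hom_id[where 'a = "'i so"]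
  note lin = lin_intros clinear_compose[OF alg_homD(1)[OF hom(2)]]
  have "alg_hom (\<lambda>x :: 'i so. tensor_lift (\<lambda>u v. so_counit u *\<^sub>C v) (so_coproduct x))"
    "alg_hom (\<lambda>x :: 'i so. tensor_lift (\<lambda>u v. so_counit v *\<^sub>C u) (so_coproduct x))"
    by (intro alg_hom_compose[OF alg_hom_tensor_lift hom(1)];
        simp add: lin alg_homD[OF hom(2)] scaleC_one scaleC_mult_left scaleC_mult_right scaleC_scaleC mult.commute)+
  note homs = this
  show "tensor_lift (\<lambda>u v. so_counit u *\<^sub>C v) (so_coproduct x) = x"
    by (rule so_hom_eqI[OF homs(1) hom(3)])
      (simp add: tensor_lift_so_coproduct_gen lin so_counit_gen if_distrib[of "\<lambda>c. c *\<^sub>C _"] scaleC_one cong: if_cong)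
  show "tensor_lift (\<lambda>u v. so_counit v *\<^sub>C u) (so_coproduct x) = x"
    by (rule so_hom_eqI[OF homs(2) hom(3)])
      (simp add: tensor_lift_so_coproduct_gen lin so_counit_gen if_distrib[of "\<lambda>c. c *\<^sub>C _"] scaleC_one cong: if_cong)
qed

lemma alg_hom_scaleC_one:
  fixes f :: "'a::comm_calg \<Rightarrow> complex"
  assumes f: "alg_hom f"
  shows "alg_hom (\<lambda>x. f x *\<^sub>C (1 :: 'b::comm_calg))"
  by (intro alg_homI lin_intros alg_homD(1)[OF f])
    (simp_all add: alg_homD[OF f] scaleC_one scaleC_mult_left scaleC_mult_right scaleC_scaleC)

lemma so_antipode_left:
    "tensor_lift (\<lambda>u v. so_antipode u * v) (so_coproduct x) = so_counit x *\<^sub>C (1 :: 'i::quad_index so)"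
  and so_antipode_right:
    "tensor_lift (\<lambda>u v. u * so_antipode v) (so_coproduct x) = so_counit x *\<^sub>C (1 :: 'i::quad_index so)"
proof -
  note hom = alg_hom_so_coproduct[where 'i = 'i] alg_hom_so_counit[where 'a = 'i] alg_hom_id[where 'a = "'i so"]
    alg_hom_so_antipode[where 'a = 'i]
  note lin = lin_intros clinear_compose[OF alg_homD(1)[OF hom(4)]] alg_homD(1)[OF hom(4)]
    cbilinear_left[OF cbilinear_times] cbilinear_right[OF cbilinear_times]
  note counit = alg_hom_scaleC_one[OF hom(2), where 'b = "'i so"]
  have left: "(\<Sum>M\<in>UNIV. gen (conj_index M) (conj_index J) * gen M K) = (if J = K then 1 else 0)" for J K :: 'i
    using so_relation_sums(1)[OF so_relations_gen_matrix, of "conj_index J" K]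
    by (simp add: conj_index_conj_index eq_commute)
  have right: "(\<Sum>M\<in>UNIV. gen J M * gen (conj_index K) (conj_index M)) = (if J = K then 1 else 0)" for J K :: 'i
  proof -
    have "(\<Sum>M\<in>UNIV. gen J M * gen (conj_index K) (conj_index M)) =
        (\<Sum>M\<in>UNIV. gen J (conj_index M) * gen (conj_index K) M)"
      by (rule sum.reindex_bij_witness[of _ conj_index conj_index]) (simp_all add: conj_index_conj_index)
    then show ?thesis
      using so_relation_sums(2)[OF so_relations_gen_matrix, of J "conj_index K"]
      by (auto dest: arg_cong[of _ _ conj_index] simp: conj_index_conj_index)
  qed
  show "tensor_lift (\<lambda>u v. so_antipode u * v) (so_coproduct x) = so_counit x *\<^sub>C (1 :: 'i so)"
    by (rule so_hom_eqI[OF alg_hom_compose[OF alg_hom_tensor_lift_hom[OF hom(4,3)] hom(1)] counit])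
      (simp add: tensor_lift_so_coproduct_gen lin so_antipode_gen left so_counit_gen scaleC_one)
  show "tensor_lift (\<lambda>u v. u * so_antipode v) (so_coproduct x) = so_counit x *\<^sub>C (1 :: 'i so)"
    by (rule so_hom_eqI[OF alg_hom_compose[OF alg_hom_tensor_lift_hom[OF hom(3,4)] hom(1)] counit])
      (simp add: tensor_lift_so_coproduct_gen lin so_antipode_gen right so_counit_gen scaleC_one)
qed

lemma so_antipode_antipode: "so_antipode (so_antipode x) = (x :: 'i::quad_index so)"
  by (rule so_hom_eqI[OF alg_hom_compose[OF alg_hom_so_antipode alg_hom_so_antipode] alg_hom_id])
    (simp add: so_antipode_gen conj_index_conj_index)

lemma so_coproduct_antipode:
  "so_coproduct (so_antipode x) =
    tensor_lift (\<lambda>u v. so_antipode v \<otimes> so_antipode u) (so_coproduct (x :: 'i::quad_index so))"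
proof (rule so_hom_eqI[OF alg_hom_compose[OF alg_hom_so_coproduct alg_hom_so_antipode]])
  note hom = alg_hom_so_antipode[where 'a = 'i]
  note lin = lin_intros clinear_compose[OF alg_homD(1)[OF hom]]
  show "alg_hom (\<lambda>x :: 'i so. tensor_lift (\<lambda>u v. so_antipode v \<otimes> so_antipode u) (so_coproduct x))"
    by (intro alg_hom_compose[OF alg_hom_tensor_lift alg_hom_so_coproduct])
      (simp_all add: lin alg_homD[OF hom] one_tensor_def tensor_times)
  fix J K :: 'i
  have "(\<Sum>M\<in>UNIV. gen (conj_index K) M \<otimes> gen M (conj_index J)) =
      (\<Sum>M\<in>UNIV. gen (conj_index K) (conj_index M) \<otimes> gen (conj_index M) (conj_index J))"
    by (rule sum.reindex_bij_witness[of _ conj_index conj_index]) (simp_all add: conj_index_conj_index)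
  then show "so_coproduct (so_antipode (gen J K)) =
      tensor_lift (\<lambda>u v. so_antipode v \<otimes> so_antipode u) (so_coproduct (gen J K))"
    by (simp add: tensor_lift_so_coproduct_gen lin so_antipode_gen, simp add: so_coproduct_gen)
qed

section \<open>The quotient map\<close>

lemma sum_option: "(\<Sum>J\<in>UNIV. f J) = f None + (\<Sum>i\<in>UNIV. f (Some i))" for f :: "'i::finite option \<Rightarrow> 'a::comm_monoid_add"
  unfolding UNIV_option_conv by (subst sum.insert) (simp_all add: sum.reindex)

lemma prod_option: "(\<Prod>J\<in>UNIV. f J) = f None * (\<Prod>i\<in>UNIV. f (Some i))" for f :: "'i::finite option \<Rightarrow> 'a::comm_monoid_mult"
  unfolding UNIV_option_conv by (subst prod.insert) (simp_all add: prod.reindex)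

text \<open>A permutation moving \<open>None\<close> sends some row \<open>Some i\<close> to the
  column \<open>None\<close>, where the entry vanishes. The remaining permutations are those of the
  smaller index set, with the same sign. The last row may be arbitrary.\<close>

lemma det_option:
  fixes F :: "'r::comm_ring_1 ^ 'i::finite option ^ 'i::finite option"
  assumes F: "F $ None $ None = 1" "\<And>i. F $ Some i $ None = 0"
  shows "det F = det (\<chi> i j. F $ Some i $ Some j)"
proof -
  define T where "T p = of_int (sign p) * (\<Prod>J\<in>UNIV. F $ J $ p J)" for p
  let ?P = "{p. p permutes (UNIV :: 'i option set)}" and ?Q = "{p. p permutes range (Some :: 'i \<Rightarrow> 'i option)}"
  have "det F = (\<Sum>p\<in>?P. T p)" by (simp add: det_def T_def)
  also have "\<dots> = (\<Sum>p\<in>?Q. T p)"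
  proof (rule sum.mono_neutral_right)
    show "finite ?P" by (simp add: finite_permutations)
    show "?Q \<subseteq> ?P" by (auto intro: permutes_subset)
    show "\<forall>p\<in>?P - ?Q. T p = 0"
    proof
      fix p assume p: "p \<in> ?P - ?Q"
      have "p None \<noteq> None"
      proof
        assume None: "p None = None"
        have "p permutes range Some"
        proof (rule permutes_superset)
          show "p permutes UNIV" using p by simp
          fix x :: "'i option" assume "x \<in> UNIV - range Some"
          then have "x = None" by (simp add: notin_range_Some)
          with None show "p x = x" by simp
        qed
        with p show False by simp
      qed
      have "surj p" using p permutes_surj by blast
      then obtain J where J: "None = p J" by (rule surjE)
      with \<open>p None \<noteq> None\<close> obtain i where "J = Some i" by (cases J) auto
      with F(2) have "F $ J $ None = 0" by simp
      then have "F $ J $ p J = 0" by (simp only: J)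
      then have "\<exists>J\<in>UNIV. F $ J $ p J = 0" by blast
      then have "(\<Prod>J\<in>UNIV. F $ J $ p J) = 0" by (rule prod_zero[rotated]) simp
      then show "T p = 0" by (simp add: T_def)
    qed
  qed
  also have "\<dots> = (\<Sum>p\<in>{p. p permutes UNIV}. T (map_permutation UNIV Some p))"
  proof (rule sum.reindex_bij_betw[symmetric])
    have "bij_betw Some (UNIV :: 'i set) (range Some)" by (simp add: bij_betw_def)
    from bij_betw_permutations[OF this]
    show "bij_betw (map_permutation UNIV Some) {p. p permutes (UNIV :: 'i set)} ?Q"
      unfolding map_permutation_def restrict_id_def comp_def .
  qed
  also have "\<dots> = det (\<chi> i j. F $ Some i $ Some j)"
    unfolding det_def
  proof (rule sum.cong)
    fix p :: "'i \<Rightarrow> 'i" assume "p \<in> {p. p permutes UNIV}"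
    moreover have "map_permutation UNIV Some p None = None" "map_permutation UNIV Some p (Some i) = Some (p i)" for i
      by (simp_all add: map_permutation_def restrict_id_def notin_range_Some)
    ultimately show "T (map_permutation UNIV Some p) =
        of_int (sign p) * (\<Prod>i\<in>UNIV. (\<chi> i j. F $ Some i $ Some j) $ i $ p i)"
      by (simp add: T_def sign_map_permutation prod_option F(1))
  qed simp
  finally show ?thesis .
qed

definition block_matrix :: "'r::zero_neq_one ^ 'i::finite ^ 'j::finite \<Rightarrow> 'r ^ 'i::finite option ^ 'j::finite option" where
  "block_matrix M = (\<chi> J K. case (J, K) of (Some j, Some k) \<Rightarrow> M $ j $ k | (None, None) \<Rightarrow> 1 | _ \<Rightarrow> 0)"

lemma block_matrix_nth [simp]:
  "block_matrix M $ Some j $ Some k = M $ j $ k" "block_matrix M $ None $ None = 1"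
  "block_matrix M $ None $ Some k = 0" "block_matrix M $ Some j $ None = 0"
  by (simp_all add: block_matrix_def)

lemma conj_index_option_simps [simp]:
  "conj_index None = None" "conj_index (Some j) = Some (conj_index j)"
  by (simp_all add: conj_index_option_def)

lemma so_relations_block_matrix:
  assumes "so_relations M"
  shows "so_relations (block_matrix M)"
proof -
  have "det (block_matrix M) = det (\<chi> i j. M $ i $ j)" by (subst det_option) simp_all
  then have "det (block_matrix M) = 1" using so_relationsD(3)[OF assms] by simp
  moreover have "(\<Sum>k\<in>UNIV. block_matrix M $ conj_index k $ i * block_matrix M $ k $ j) =
      (if j = conj_index i then 1 else 0)" for i j
    using so_relation_sums(1)[OF assms] by (cases i; cases j) (simp_all add: sum_option)
  moreover have "(\<Sum>k\<in>UNIV. block_matrix M $ i $ conj_index k * block_matrix M $ j $ k) =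
      (if j = conj_index i then 1 else 0)" for i j
    using so_relation_sums(2)[OF assms] by (cases i; cases j) (simp_all add: sum_option)
  ultimately show ?thesis by (simp add: so_relations_iff)
qed

definition so_projection :: "'i::quad_index option so \<Rightarrow> 'i so"
  where "so_projection = so_hom (block_matrix gen_matrix)"

lemma alg_hom_so_projection: "alg_hom so_projection"
  unfolding so_projection_def by (rule alg_hom_so_hom[OF so_relations_block_matrix[OF so_relations_gen_matrix]])

lemma so_projection_gen: "so_projection (gen J K) = block_matrix gen_matrix $ J $ K"
  unfolding so_projection_def by (rule so_hom_gen[OF so_relations_block_matrix[OF so_relations_gen_matrix]])

lemma so_counit_projection: "so_counit (so_projection x) = so_counit x"
  by (rule so_hom_eqI[OF alg_hom_compose[OF alg_hom_so_counit alg_hom_so_projection] alg_hom_so_counit])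
    (simp add: so_projection_gen block_matrix_def so_counit_gen alg_homD(2)[OF alg_hom_so_counit]
      clinear_zero[OF alg_homD(1)[OF alg_hom_so_counit]] split: option.split)

lemma surj_so_projection: "surj (so_projection :: 'i::quad_index option so \<Rightarrow> _)"
proof (rule surjI)
  note hom = alg_homD[OF alg_hom_so_projection]
  have "\<exists>x. so_projection x = h" for h :: "'i so"
  proof (induction h rule: so_induct)
    case one
    show ?case by (rule exI) (rule hom(2))
  next
    case (add x y)
    then obtain v w where "so_projection v = x" "so_projection w = y" by blast
    then show ?case by (intro exI[of _ "v + w"]) (simp add: clinear_add[OF hom(1)])
  next
    case (scale c x)
    then obtain v where "so_projection v = x" by blast
    then show ?case by (intro exI[of _ "c *\<^sub>C v"]) (simp add: clinear_scale[OF hom(1)])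
  next
    case (gen x J K)
    then obtain v where "so_projection v = x" by blast
    then show ?case by (intro exI[of _ "gen (Some J) (Some K) * v"]) (simp add: hom(3) so_projection_gen)
  qed
  then show "so_projection (SOME x. so_projection x = h) = h" for h :: "'i so" by (rule someI_ex)
qed

text \<open>The kernel of the quotient map is generated by \<open>N\<^sub>J\<^sub>,\<^sub>2\<^sub>n\<^sub>+\<^sub>1 - \<delta>\<^sub>J\<^sub>,\<^sub>2\<^sub>n\<^sub>+\<^sub>1\<close>; by orthogonality this ideal
  contains the last row as well.\<close>

definition column_generator :: "'i::quad_index option \<Rightarrow> 'i option so"
  where "column_generator J = gen J None - (if J = None then 1 else 0)"

definition column_ideal :: "'i::quad_index option so set"
  where "column_ideal = cvec.span {x * column_generator J |x J. True}"

lemma column_ideal_subspace: "cvec.subspace column_ideal"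
  by (simp add: column_ideal_def)

lemmas column_ideal_add = cvec.subspace_add[OF column_ideal_subspace]
  and column_ideal_diff = cvec.subspace_diff[OF column_ideal_subspace]
  and column_ideal_neg = cvec.subspace_neg[OF column_ideal_subspace]
  and column_ideal_zero = cvec.subspace_0[OF column_ideal_subspace]
  and column_ideal_sum = cvec.subspace_sum[OF column_ideal_subspace]
  and column_ideal_scale = cvec.subspace_scale[OF column_ideal_subspace]

lemma column_ideal_base: "x * column_generator J \<in> column_ideal"
  unfolding column_ideal_def by (rule cvec.span_base) blast

lemma column_ideal_mult:
  fixes x y :: "'i::quad_index option so"
  assumes "y \<in> column_ideal"
  shows "x * y \<in> column_ideal"
proof (rule clinear_span[OF cbilinear_right[OF cbilinear_times clinear_id]
      assms[unfolded column_ideal_def] _ column_ideal_subspace])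
  fix z :: "'i option so" assume "z \<in> {x * column_generator J |x J. True}"
  then obtain v J where "z = v * column_generator J" by blast
  then show "x * z \<in> column_ideal"
    by (simp add: column_ideal_base flip: mult.assoc)
qed

lemma column_ideal_mult': "y \<in> column_ideal \<Longrightarrow> y * x \<in> column_ideal"
  by (subst mult.commute) (rule column_ideal_mult)

lemma column_ideal_column: "gen (Some j) None \<in> column_ideal" "1 - gen None None \<in> column_ideal"
  using column_ideal_base[of 1 "Some j"] column_ideal_neg[OF column_ideal_base[of 1 None]]
  by (simp_all add: column_generator_def)

text \<open>In the orthogonality relation between column \<open>None\<close> and column
  \<open>Some k\<close> all terms but one contain an entry of the last column off the corner. The
  remaining term is the row entry times the corner, and the corner is 1 modulo the ideal.\<close>

lemma column_ideal_row:
  fixes k :: "'i::quad_index"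
  shows "gen None (Some k) \<in> column_ideal"
proof -
  define c where "c = (\<Sum>i\<in>UNIV. gen (Some (conj_index i)) None * gen (Some i) (Some k))"
  have "gen None None * gen None (Some k) + c = 0"
    using so_relation_sums(1)[OF so_relations_gen_matrix, of None "Some k"] by (simp add: sum_option c_def)
  moreover have "(1 - gen None None) * gen None (Some k) - c =
      gen None (Some k) - (gen None None * gen None (Some k) + c)"
    by (simp add: left_diff_distrib)
  moreover have "(1 - gen None None) * gen None (Some k) - c \<in> column_ideal"
    unfolding c_def
    by (intro column_ideal_diff column_ideal_sum column_ideal_mult' column_ideal_column)
  ultimately show ?thesis by simp
qed

lemma column_ideal_prod:
  assumes "finite I" "\<And>i. i \<in> I \<Longrightarrow> f i - g i \<in> column_ideal"
  shows "(\<Prod>i\<in>I. f i) - (\<Prod>i\<in>I. g i) \<in> column_ideal"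
  using assms
proof (induction I rule: finite_induct)
  case (insert i I)
  have eq: "f i * prod f I - g i * prod g I = (f i - g i) * prod f I + g i * (prod f I - prod g I)"
    by (simp add: algebra_simps)
  show ?case
    unfolding prod.insert[OF insert.hyps(1,2)] eq
    using insert.IH insert.prems by (intro column_ideal_add column_ideal_mult column_ideal_mult') simp_all
qed (simp add: column_ideal_zero)

lemma column_ideal_det:
  assumes "\<And>i j. M $ i $ j - N $ i $ j \<in> column_ideal"
  shows "det M - det N \<in> column_ideal"
  unfolding det_def sum_subtractf[symmetric] right_diff_distrib[symmetric]
  by (intro column_ideal_sum column_ideal_mult column_ideal_prod assms) simp

text \<open>The upper left block satisfies the relations of the smaller group only modulo the ideal,
  so the section s is defined on polynomials. It maps \<open>so_ideal\<close> into the ideal, and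
  every x is congruent to s q for some polynomial q representing its projection. If the projection
  vanishes, q lies in \<open>so_ideal\<close>, and then so does x in the column ideal.\<close>

lemma so_projection_kernel:
  fixes x :: "'i::quad_index option so"
  assumes "so_projection x = 0"
  shows "x \<in> column_ideal"
proof -
  define W :: "'i option so ^ 'i::quad_index ^ 'i::quad_index" where "W = (\<chi> j k. gen (Some j) (Some k))"
  define s where "s = eval_poly (\<lambda>(j, k). W $ j $ k)"
  have s: "alg_hom s" unfolding s_def by (rule alg_hom_eval_poly)
  note s_simps = clinear_add[OF alg_homD(1)[OF s]] clinear_diff[OF alg_homD(1)[OF s]]
    clinear_scale[OF alg_homD(1)[OF s]] alg_homD(2,3)[OF s]
  have s_generic: "map_matrix s generic_matrix = W" unfolding s_def by (rule eval_poly_generic)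
  have rel1: "s ((transpose generic_matrix ** Q_matrix ** generic_matrix - Q_matrix) $ i $ j) \<in> column_ideal" for i j
  proof -
    have "s ((transpose generic_matrix ** Q_matrix ** generic_matrix - Q_matrix) $ i $ j) =
        map_matrix s (transpose generic_matrix ** Q_matrix ** generic_matrix) $ i $ j - map_matrix s Q_matrix $ i $ j"
      by (simp only: s_simps nth_map_matrix vector_minus_component)
    also have "\<dots> = (\<Sum>k\<in>UNIV. W $ conj_index k $ i * W $ k $ j) - (if j = conj_index i then 1 else 0)"
      by (simp only: alg_hom_matrix_mult[OF s] alg_hom_Q_matrix[OF s] map_matrix_transpose s_generic
          quadratic_form_nth Q_matrix_nth)
    \<comment> \<open>Orthogonality of the full matrix leaves exactly the summand at index
      \<open>None\<close>, a product of entries of the last row.\<close>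
    also have "\<dots> = - (gen None (Some i) * gen None (Some j))"
      using so_relation_sums(1)[OF so_relations_gen_matrix, of "Some i" "Some j"]
      by (simp add: sum_option W_def algebra_simps)
    also have "\<dots> \<in> column_ideal" by (intro column_ideal_neg column_ideal_mult column_ideal_row)
    finally show ?thesis .
  qed
  have rel2: "s ((generic_matrix ** Q_matrix ** transpose generic_matrix - Q_matrix) $ i $ j) \<in> column_ideal" for i j
  proof -
    have "s ((generic_matrix ** Q_matrix ** transpose generic_matrix - Q_matrix) $ i $ j) =
        map_matrix s (generic_matrix ** Q_matrix ** transpose generic_matrix) $ i $ j - map_matrix s Q_matrix $ i $ j"
      by (simp only: s_simps nth_map_matrix vector_minus_component)
    also have "\<dots> = (\<Sum>k\<in>UNIV. W $ i $ conj_index k * W $ j $ k) - (if j = conj_index i then 1 else 0)"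
      by (simp only: alg_hom_matrix_mult[OF s] alg_hom_Q_matrix[OF s] map_matrix_transpose s_generic
          quadratic_form_nth Q_matrix_nth)
    also have "\<dots> = - (gen (Some i) None * gen (Some j) None)"
      using so_relation_sums(2)[OF so_relations_gen_matrix, of "Some i" "Some j"]
      by (simp add: sum_option W_def algebra_simps)
    also have "\<dots> \<in> column_ideal" by (intro column_ideal_neg column_ideal_mult column_ideal_column)
    finally show ?thesis .
  qed
  have det: "s (det generic_matrix - 1) \<in> column_ideal"
  proof -
    have "s (det generic_matrix - 1) = det W - 1"
      by (simp add: s_simps alg_hom_det[OF s] s_generic)
    \<comment> \<open>The full generic matrix has determinant 1 and agrees entrywise with the block
      matrix modulo the ideal.\<close>
    also have "\<dots> = det (block_matrix W) - det (gen_matrix :: 'i option so ^ 'i::quad_index option ^ 'i::quad_index option)"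
      by (subst det_option) (simp_all add: so_relationsD(3)[OF so_relations_gen_matrix])
    also have "\<dots> \<in> column_ideal"
    proof (rule column_ideal_det)
      show "block_matrix W $ i $ j - gen_matrix $ i $ j \<in> column_ideal" for i j
        by (cases i; cases j)
          (simp_all add: W_def column_ideal_zero column_ideal_column column_ideal_neg column_ideal_row)
    qed
    finally show ?thesis .
  qed
  have s_ideal: "s p \<in> column_ideal" if "p \<in> so_ideal" for p
    using that unfolding so_ideal_def
  proof (induction rule: ring_ideal.span_induct_alt)
    case base
    show ?case by (simp add: clinear_zero[OF alg_homD(1)[OF s]] column_ideal_zero)
  next
    case (step c x y)
    have "s x \<in> column_ideal" using step(1) rel1 rel2 det by blast
    then show ?case using step(2) by (simp add: s_simps column_ideal_add column_ideal_mult)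
  qed
  have lift: "\<exists>q. abs_so q = so_projection x \<and> x - s q \<in> column_ideal"
  proof (induction x rule: so_induct)
    case one
    have "abs_so 1 = so_projection (1 :: 'i option so)"
      by (simp add: alg_homD(2)[OF alg_hom_so_projection] alg_homD(2)[OF alg_hom_abs_so])
    moreover have "1 - s 1 \<in> column_ideal" by (simp add: s_simps column_ideal_zero)
    ultimately show ?case by blast
  next
    case (add x y)
    then obtain q r where q: "abs_so q = so_projection x" "x - s q \<in> column_ideal"
      "abs_so r = so_projection y" "y - s r \<in> column_ideal" by blast
    have eq: "x + y - s (q + r) = (x - s q) + (y - s r)" by (simp add: s_simps)
    have "x + y - s (q + r) \<in> column_ideal" unfolding eq by (rule column_ideal_add[OF q(2,4)])
    moreover have "abs_so (q + r) = so_projection (x + y)"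
      by (simp add: clinear_add[OF alg_homD(1)[OF alg_hom_so_projection]] q(1,3) flip: plus_so.abs_eq)
    ultimately show ?case by blast
  next
    case (scale c x)
    then obtain q where q: "abs_so q = so_projection x" "x - s q \<in> column_ideal" by blast
    have eq: "c *\<^sub>C x - s (c *\<^sub>C q) = c *\<^sub>C (x - s q)"
      by (simp only: s_simps cvec.scale_right_diff_distrib)
    have "c *\<^sub>C x - s (c *\<^sub>C q) \<in> column_ideal" unfolding eq by (rule column_ideal_scale[OF q(2)])
    moreover have "abs_so (c *\<^sub>C q) = so_projection (c *\<^sub>C x)"
      by (simp add: clinear_scale[OF alg_homD(1)[OF alg_hom_so_projection]] q(1) flip: scaleC_so.abs_eq)
    ultimately show ?case by blast
  next
    case (gen x J K)
    then obtain q where q: "abs_so q = so_projection x" "x - s q \<in> column_ideal" by blast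
    obtain g where g: "abs_so g = block_matrix gen_matrix $ J $ K" "gen J K - s g \<in> column_ideal"
    proof (cases "J = None \<or> K = None")
      case True
      show ?thesis
      proof (rule that[of "if J = K then 1 else 0"])
        show "abs_so (if J = K then 1 else 0) = block_matrix gen_matrix $ J $ K"
          using True by (cases J; cases K) (auto simp: one_so_def zero_so_def)
        show "gen J K - s (if J = K then 1 else 0) \<in> column_ideal"
          using True column_ideal_neg[OF column_ideal_column(2)]
          by (cases J; cases K)
            (auto simp: s_simps clinear_zero[OF alg_homD(1)[OF s]] column_ideal_row column_ideal_column)
      qed
    next
      case False
      then obtain j k where jk: "J = Some j" "K = Some k" by auto
      show ?thesis
      proof (rule that[of "generic_matrix $ j $ k"])
        have "s (generic_matrix $ j $ k) = W $ j $ k" using s_generic by (metis nth_map_matrix)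
        then show "gen J K - s (generic_matrix $ j $ k) \<in> column_ideal"
          by (simp add: jk W_def column_ideal_zero)
      qed (simp add: jk gen.abs_eq)
    qed
    have "abs_so (g * q) = so_projection (gen J K * x)"
      by (simp add: alg_homD(3)[OF alg_hom_so_projection] so_projection_gen g(1) q(1) flip: times_so.abs_eq)
    moreover have "gen J K * x - s (g * q) \<in> column_ideal"
    proof -
      have eq: "gen J K * x - s (g * q) = (gen J K - s g) * x + s g * (x - s q)"
        by (simp add: s_simps algebra_simps)
      show ?thesis
        unfolding eq by (intro column_ideal_add column_ideal_mult'[OF g(2)] column_ideal_mult[OF q(2)])
    qed
    ultimately show ?case by blast
  qed
  then obtain q where q: "abs_so q = 0" "x - s q \<in> column_ideal" using assms by auto
  then have "s q \<in> column_ideal" by (intro s_ideal) (simp add: zero_so_def abs_so_eq_iff)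
  from column_ideal_add[OF q(2) this] show ?thesis by simp
qed

section \<open>The bigrading and the deformed product\<close>

lemma single_sum: "Poly_Mapping.single k (\<Sum>i\<in>I. f i) = (\<Sum>i\<in>I. Poly_Mapping.single k (f i))"
  by (induction I rule: infinite_finite_induct) (simp_all add: single_add)

lemma prod_single:
  "(\<Prod>i\<in>I. Poly_Mapping.single (d i) (f i)) = Poly_Mapping.single (\<Sum>i\<in>I. d i) (\<Prod>i\<in>I. f i)"
  for d :: "'i \<Rightarrow> 'k::comm_monoid_add" and f :: "'i \<Rightarrow> 'r::comm_ring_1"
  by (induction I rule: infinite_finite_induct) (simp_all add: mult_single)

lemma clinear_single: "clinear (Poly_Mapping.single k)"
  by (rule clinearI) (simp_all add: single_add poly_mapping_eqI scaleC_poly_mapping.rep_eq lookup_single when_def)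

lemma clinear_lookup: "clinear (\<lambda>p. Poly_Mapping.lookup p k)"
  by (rule clinearI) (simp_all add: lookup_add scaleC_poly_mapping.rep_eq)

lemma scalar_vec_distrib: "int (a + b) *s v = int a *s v + int b *s (v :: int ^ 'n)"
  by (simp add: vec_eq_iff distrib_right)

lemma bidegree_superset:
  assumes "finite S" "Poly_Mapping.keys m \<subseteq> S"
  shows "bidegree w m = (\<Sum>(J, K)\<in>S. int (Poly_Mapping.lookup m (J, K)) *s w J,
      \<Sum>(J, K)\<in>S. int (Poly_Mapping.lookup m (J, K)) *s w K)"
proof -
  have "(\<Sum>(J, K)\<in>Poly_Mapping.keys m. int (Poly_Mapping.lookup m (J, K)) *s f J K) =
      (\<Sum>(J, K)\<in>S. int (Poly_Mapping.lookup m (J, K)) *s f J K)" for f :: "_ \<Rightarrow> _ \<Rightarrow> int ^ 'b"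
    by (rule sum.mono_neutral_left)
      (use assms in \<open>auto simp: not_in_keys_iff_lookup_eq_zero vec_eq_iff\<close>)
  then show ?thesis by (simp add: bidegree_def)
qed

lemma bidegree_add: "bidegree w (m + n) = bidegree w m + bidegree w n"
proof -
  let ?S = "Poly_Mapping.keys m \<union> Poly_Mapping.keys n"
  have "Poly_Mapping.keys (m + n) \<subseteq> ?S" by (rule keys_add)
  then show ?thesis
    by (simp add: bidegree_superset[of ?S] lookup_add scalar_vec_distrib sum.distrib case_prod_unfold
        del: of_nat_add)
qed

lemma bidegree_single: "bidegree w (Poly_Mapping.single (J, K) 1) = (w J, w K)"
  by (simp add: bidegree_def)

lemma bidegree_zero: "bidegree w 0 = 0"
  by (simp add: bidegree_def zero_prod_def)

lemma abs_so_eq_sum: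
  "abs_so p = (\<Sum>m\<in>Poly_Mapping.keys p. Poly_Mapping.lookup p m *\<^sub>C abs_so (Poly_Mapping.single m 1))"
proof -
  note hom = alg_homD(1)[OF alg_hom_abs_so]
  have "(\<Sum>m\<in>Poly_Mapping.keys p. Poly_Mapping.lookup p m *\<^sub>C Poly_Mapping.single m 1) = p"
    by (rule poly_mapping_eqI)
      (simp add: scaleC_single lookup_sum lookup_single when_def not_in_keys_iff_lookup_eq_zero)
  moreover have "abs_so (\<Sum>m\<in>Poly_Mapping.keys p. Poly_Mapping.lookup p m *\<^sub>C Poly_Mapping.single m 1) =
      (\<Sum>m\<in>Poly_Mapping.keys p. Poly_Mapping.lookup p m *\<^sub>C abs_so (Poly_Mapping.single m 1))"
    by (simp only: clinear_sum[OF hom] clinear_scale[OF hom])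
  ultimately show ?thesis by simp
qed

text \<open>Opposite weights at conjugate indices make the quadratic relations homogeneous; they
  also make the weights sum to zero, so that the determinant has degree zero.\<close>

locale weight =
  fixes w :: "'i::quad_index \<Rightarrow> int ^ 'n::finite"
  assumes weight_conj: "w (conj_index i) = - w i"
begin

lemma sum_weight: "(\<Sum>i\<in>UNIV. w i) = 0"
proof -
  have "(\<Sum>i\<in>UNIV. w i) = (\<Sum>i\<in>UNIV. w (conj_index i))"
    by (rule sum.reindex_bij_witness[of _ conj_index conj_index]) (simp_all add: conj_index_conj_index)
  then have "(\<Sum>i\<in>UNIV. w i) = - (\<Sum>i\<in>UNIV. w i)" by (simp add: weight_conj sum_negf)
  then show ?thesis by (simp add: vec_eq_iff)
qed

text \<open>The generic matrix multiplied on both sides by diagonal torus matrices, as a point over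
  the group ring of bidegrees.\<close>

definition grade_matrix :: "(((int ^ 'n) \<times> (int ^ 'n)) \<Rightarrow>\<^sub>0 'i so) ^ 'i::quad_index ^ 'i::quad_index"
  where "grade_matrix = (\<chi> J K. Poly_Mapping.single (w J, w K) (gen J K))"

lemma so_relations_grade_matrix: "so_relations grade_matrix"
  unfolding so_relations_iff
proof (intro conjI allI)
  fix i j
  have "(\<Sum>k\<in>UNIV. grade_matrix $ conj_index k $ i * grade_matrix $ k $ j) =
      Poly_Mapping.single (0, w i + w j) (\<Sum>k\<in>UNIV. gen (conj_index k) i * gen k j)"
    by (simp add: grade_matrix_def mult_single weight_conj single_sum)
  also have "(\<Sum>k\<in>UNIV. gen (conj_index k) i * gen k j) = (if j = conj_index i then 1 else 0)"
    using so_relation_sums(1)[OF so_relations_gen_matrix, of i j] by simp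
  finally show "(\<Sum>k\<in>UNIV. grade_matrix $ conj_index k $ i * grade_matrix $ k $ j) =
      (if j = conj_index i then 1 else 0)"
    by (simp add: weight_conj zero_prod_def[symmetric])
  have "(\<Sum>k\<in>UNIV. grade_matrix $ i $ conj_index k * grade_matrix $ j $ k) =
      Poly_Mapping.single (w i + w j, 0) (\<Sum>k\<in>UNIV. gen i (conj_index k) * gen j k)"
    by (simp add: grade_matrix_def mult_single weight_conj single_sum)
  also have "(\<Sum>k\<in>UNIV. gen i (conj_index k) * gen j k) = (if j = conj_index i then 1 else 0)"
    using so_relation_sums(2)[OF so_relations_gen_matrix, of i j] by simp
  finally show "(\<Sum>k\<in>UNIV. grade_matrix $ i $ conj_index k * grade_matrix $ j $ k) =
      (if j = conj_index i then 1 else 0)"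
    by (simp add: weight_conj zero_prod_def[symmetric])
next
  \<comment> \<open>Every Leibniz term has bidegree zero: a permutation only reorders weights whose
    sum is zero.\<close>
  have "of_int (sign p) * (\<Prod>i\<in>UNIV. grade_matrix $ i $ p i) =
      Poly_Mapping.single 0 (of_int (sign p) * (\<Prod>i\<in>UNIV. gen_matrix $ i $ p i))"
    if "p permutes UNIV" for p :: "'i \<Rightarrow> 'i"
  proof -
    have "(\<Sum>i\<in>UNIV. (w i, w (p i))) = 0"
    proof (rule prod_eqI)
      have "(\<Sum>i\<in>UNIV. w (p i)) = (\<Sum>i\<in>UNIV. w i)"
        using sum.permute[OF that, of w] by (simp add: comp_def)
      then show "snd (\<Sum>i\<in>UNIV. (w i, w (p i))) = snd 0" by (simp add: snd_sum sum_weight)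
    qed (simp add: fst_sum sum_weight)
    then have "(\<Prod>i\<in>UNIV. grade_matrix $ i $ p i) = Poly_Mapping.single 0 (\<Prod>i\<in>UNIV. gen_matrix $ i $ p i)"
      by (simp add: grade_matrix_def prod_single)
    then show ?thesis by (simp add: mult_single flip: single_of_int)
  qed
  then have "det grade_matrix = Poly_Mapping.single 0 (det (gen_matrix :: 'i so ^ 'i::quad_index ^ 'i::quad_index))"
    unfolding det_def single_sum by (intro sum.cong) simp_all
  then show "det grade_matrix = 1" by (simp add: so_relationsD(3)[OF so_relations_gen_matrix])
qed

definition grade :: "'i so \<Rightarrow> ((int ^ 'n) \<times> (int ^ 'n)) \<Rightarrow>\<^sub>0 'i so"
  where "grade = so_hom grade_matrix"

lemma alg_hom_grade: "alg_hom grade"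
  unfolding grade_def by (rule alg_hom_so_hom[OF so_relations_grade_matrix])

lemma grade_gen: "grade (gen J K) = Poly_Mapping.single (w J, w K) (gen J K)"
  unfolding grade_def so_hom_gen[OF so_relations_grade_matrix] by (simp add: grade_matrix_def)

text \<open>In place of the existence of a homogeneous polynomial representative, as in
  \<open>homogeneous\<close>, an eigenvector condition for \<open>grade\<close>; the subspace
  property and multiplicativity are then immediate.\<close>

definition homog :: "(int ^ 'n) \<times> (int ^ 'n) \<Rightarrow> 'i so set"
  where "homog r = {x. grade x = Poly_Mapping.single r x}"

lemma homog_subspace: "cvec.subspace (homog r)"
  by (simp add: cvec.subspace_def homog_def clinear_zero[OF alg_homD(1)[OF alg_hom_grade]]
      clinear_add[OF alg_homD(1)[OF alg_hom_grade]] clinear_scale[OF alg_homD(1)[OF alg_hom_grade]]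
      single_add clinear_scale[OF clinear_single])

lemma homog_one: "1 \<in> homog 0"
  by (simp add: homog_def alg_homD(2)[OF alg_hom_grade])

lemma homog_mult: "x \<in> homog r \<Longrightarrow> y \<in> homog l \<Longrightarrow> x * y \<in> homog (r + l)"
  by (simp add: homog_def alg_homD(3)[OF alg_hom_grade] mult_single)

lemma homog_gen: "gen J K \<in> homog (w J, w K)"
  by (simp add: homog_def grade_gen)

lemma monomial_degree:
  fixes f :: "'i so \<Rightarrow> 'r::comm_calg"
  assumes f: "alg_hom f" and V: "1 \<in> V 0" "\<And>r l x y. x \<in> V r \<Longrightarrow> y \<in> V l \<Longrightarrow> x * y \<in> V (r + l)"
    "\<And>J K. f (gen J K) \<in> V (w J, w K)"
  shows "f (abs_so (Poly_Mapping.single m 1)) \<in> V (bidegree w m)"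
proof (induction m rule: poly_mapping_add_induct)
  case zero
  then show ?case using V(1) alg_homD(2)[OF f] by (simp add: bidegree_zero one_so_def)
next
  case (add m n)
  have eq: "f (abs_so (Poly_Mapping.single (m + n) 1)) =
      f (abs_so (Poly_Mapping.single m 1)) * f (abs_so (Poly_Mapping.single n 1))"
    by (simp add: times_so.abs_eq mult_single flip: alg_homD(3)[OF f])
  show ?case unfolding bidegree_add eq by (rule V(2)[OF add.IH])
next
  case (single v k)
  obtain J K where v: "v = (J, K)" by (cases v)
  show ?case
  proof (induction k)
    case 0
    then show ?case using V(1) alg_homD(2)[OF f] by (simp add: bidegree_zero one_so_def)
  next
    case (Suc k)
    have single: "Poly_Mapping.single v (Suc k) = Poly_Mapping.single v 1 + Poly_Mapping.single v k"
      by (simp flip: single_add)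
    have eq: "f (abs_so (Poly_Mapping.single (Poly_Mapping.single v (Suc k)) 1)) =
        f (gen J K) * f (abs_so (Poly_Mapping.single (Poly_Mapping.single v k) 1))"
      unfolding single
      by (simp add: v gen.abs_eq generic_matrix_def times_so.abs_eq mult_single flip: alg_homD(3)[OF f])
    have deg: "bidegree w (Poly_Mapping.single v (Suc k)) = (w J, w K) + bidegree w (Poly_Mapping.single v k)"
      by (simp only: single bidegree_add) (simp only: v bidegree_single)
    show ?case unfolding eq deg by (rule V(2)[OF V(3) Suc])
  qed
qed

lemma homog_monomial: "abs_so (Poly_Mapping.single m 1) \<in> homog (bidegree w m)"
  using monomial_degree[OF alg_hom_id, of homog] homog_one homog_mult homog_gen by blast

lemma homogeneous_homog: "x \<in> homogeneous w r1 r2 \<Longrightarrow> x \<in> homog (r1, r2)"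
proof -
  assume "x \<in> homogeneous w r1 r2"
  then obtain p where p: "x = abs_so p" "\<forall>m\<in>Poly_Mapping.keys p. bidegree w m = (r1, r2)"
    by (auto simp: homogeneous_def)
  show ?thesis
    unfolding p(1) abs_so_eq_sum[of p]
  proof (intro cvec.subspace_sum[OF homog_subspace] cvec.subspace_scale[OF homog_subspace])
    fix m assume "m \<in> Poly_Mapping.keys p"
    with p(2) homog_monomial[of m] show "abs_so (Poly_Mapping.single m 1) \<in> homog (r1, r2)" by simp
  qed
qed

lemma homogeneous_induct [case_names add homogeneous]:
  assumes "\<And>x y. P x \<Longrightarrow> P y \<Longrightarrow> P (x + y)" "\<And>r1 r2 x. x \<in> homogeneous w r1 r2 \<Longrightarrow> P x"
  shows "P x"
proof -
  obtain p where x: "x = abs_so p" by (rule abs_so_cases)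
  have single: "P (abs_so (Poly_Mapping.single m c))" for m c
  proof (rule assms(2))
    show "abs_so (Poly_Mapping.single m c) \<in> homogeneous w (fst (bidegree w m)) (snd (bidegree w m))"
      unfolding homogeneous_def by (rule imageI) simp
  qed
  show ?thesis unfolding x
  proof (induction p rule: poly_mapping_add_induct)
    case zero
    show ?case using single[of 0 0] by simp
  next
    case (add p q)
    then show ?case using assms(1) by (simp flip: plus_so.abs_eq)
  qed (rule single)
qed

lemma homog_induct [case_names add homog]:
  assumes "\<And>x y. P x \<Longrightarrow> P y \<Longrightarrow> P (x + y)" "\<And>r x. x \<in> homog r \<Longrightarrow> P x"
  shows "P x"
  by (induction x rule: homogeneous_induct) (use assms homogeneous_homog in blast)+

text \<open>A homogeneous x is its own component of degree r, so in any expansion into monomials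
  only those of bidegree r survive. On these the degree of f is known from the generators.\<close>

lemma alg_hom_degree:
  fixes f :: "'i so \<Rightarrow> 'r::comm_calg"
  assumes f: "alg_hom f" and V: "\<And>r. cvec.subspace (V r)"
    "1 \<in> V 0" "\<And>r l x y. x \<in> V r \<Longrightarrow> y \<in> V l \<Longrightarrow> x * y \<in> V (r + l)"
    "\<And>J K. f (gen J K) \<in> V (w J, w K)"
    and x: "x \<in> homog r"
  shows "f x \<in> V r"
proof -
  obtain p where p: "x = abs_so p" by (rule abs_so_cases)
  have "x = Poly_Mapping.lookup (grade x) r" using x by (simp add: homog_def)
  also have "\<dots> = (\<Sum>m\<in>Poly_Mapping.keys p. Poly_Mapping.lookup p m *\<^sub>C
      Poly_Mapping.lookup (grade (abs_so (Poly_Mapping.single m 1))) r)"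
    unfolding p abs_so_eq_sum[of p]
    by (simp add: clinear_sum[OF clinear_compose[OF clinear_lookup alg_homD(1)[OF alg_hom_grade]]]
        clinear_scale[OF clinear_compose[OF clinear_lookup alg_homD(1)[OF alg_hom_grade]]])
  finally have "f x = (\<Sum>m\<in>Poly_Mapping.keys p. Poly_Mapping.lookup p m *\<^sub>C
      f (Poly_Mapping.lookup (grade (abs_so (Poly_Mapping.single m 1))) r))"
    by (metis (no_types, lifting) clinear_scale[OF alg_homD(1)[OF f]] clinear_sum[OF alg_homD(1)[OF f]] sum.cong)
  also have "\<dots> \<in> V r"
  proof (intro cvec.subspace_sum[OF V(1)] cvec.subspace_scale[OF V(1)])
    fix m
    have "grade (abs_so (Poly_Mapping.single m 1)) = Poly_Mapping.single (bidegree w m) (abs_so (Poly_Mapping.single m 1))"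
      using homog_monomial[of m] by (simp add: homog_def)
    then show "f (Poly_Mapping.lookup (grade (abs_so (Poly_Mapping.single m 1))) r) \<in> V r"
      using monomial_degree[OF f V(2,3,4), of m] clinear_zero[OF alg_homD(1)[OF f]] cvec.subspace_0[OF V(1)]
      by (auto simp: lookup_single when_def)
  qed
  finally show ?thesis .
qed

end

section \<open>The bicharacter and the deformed product\<close>

lemma lam_nonzero [simp]: "lam \<theta> r l \<noteq> 0"
  by (simp add: lam_def)

lemma lam_add: "lam \<theta> (r + s) l = lam \<theta> r l * lam \<theta> s l" "lam \<theta> r (l + m) = lam \<theta> r l * lam \<theta> r m"
  by (simp_all add: lam_def sum.distrib distrib_left distrib_right flip: exp_add)

lemma lam_zero [simp]: "lam \<theta> 0 l = 1" "lam \<theta> r 0 = 1"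
  by (simp_all add: lam_def)

lemma lam_minus: "lam \<theta> (- r) l = inverse (lam \<theta> r l)" "lam \<theta> r (- l) = inverse (lam \<theta> r l)"
  using lam_add(1)[of \<theta> "- r" r l] lam_add(2)[of \<theta> r "- l" l]
  by (simp_all add: inverse_unique[symmetric] mult.commute inverse_eq_divide field_simps)

lemma lam_swap:
  assumes "transpose \<theta> = - \<theta>"
  shows "lam \<theta> l r = inverse (lam \<theta> r l)" and lam_self: "lam \<theta> r r = 1"
proof -
  define B where "B r l = (\<Sum>j\<in>UNIV. \<Sum>k\<in>UNIV. complex_of_real (\<theta> $ j $ k) * of_int (r $ j) * of_int (l $ k))"
    for r l
  have skew: "\<theta> $ k $ j = - \<theta> $ j $ k" for j k
    using assms by (metis transpose_nth vector_uminus_component)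
  have swap: "B l r = - B r l" for r l
  proof -
    have "B l r = (\<Sum>k\<in>UNIV. \<Sum>j\<in>UNIV. complex_of_real (\<theta> $ j $ k) * of_int (l $ j) * of_int (r $ k))"
      unfolding B_def by (rule sum.swap)
    also have "\<dots> = - B r l"
      unfolding B_def sum_negf[symmetric] by (intro sum.cong refl) (subst skew, simp)
    finally show ?thesis .
  qed
  have lam: "lam \<theta> r l = exp (complex_of_real pi * \<i> * B r l)" for r l
    by (simp add: lam_def B_def)
  show "lam \<theta> l r = inverse (lam \<theta> r l)"
    by (simp add: lam swap[of l r] exp_minus)
  have "B r r = 0" using swap[of r r] by simp
  then show "lam \<theta> r r = 1" by (simp add: lam)
qed

locale deformation = weight w for w :: "'i::quad_index \<Rightarrow> int ^ 'n::finite" +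
  fixes \<theta> :: "real ^ 'n ^ 'n"
  assumes skew: "transpose \<theta> = - \<theta>"
begin

definition twist :: "(int ^ 'n) \<times> (int ^ 'n) \<Rightarrow> (int ^ 'n) \<times> (int ^ 'n) \<Rightarrow> complex"
  where "twist r l = lam \<theta> (fst r) (fst l) * inverse (lam \<theta> (snd r) (snd l))"

lemma twist_add: "twist (r + s) l = twist r l * twist s l" "twist r (l + m) = twist r l * twist r m"
  by (simp_all add: twist_def lam_add)

lemma twist_zero [simp]: "twist 0 l = 1" "twist r 0 = 1"
  by (simp_all add: twist_def)

lemma twist_nonzero [simp]: "twist r l \<noteq> 0"
  by (simp add: twist_def)

definition dmul :: "'i so \<Rightarrow> 'i so \<Rightarrow> 'i so"  (infixl \<open>\<bullet>\<^sub>\<theta>\<close> 75)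
  where "dmul = deformed_mult w \<theta>"

lemma deformed_product:
  shows dmul_bilinear: "cbilinear dmul"
    and dmul_homog: "x \<in> homog r \<Longrightarrow> y \<in> homog l \<Longrightarrow> dmul x y = twist r l *\<^sub>C (x * y)"
proof -
  \<comment> \<open>All pairs of homogeneous components are multiplied, each product rescaled by its
    twist.\<close>
  define m where "m x y = poly_sum (\<lambda>r a. poly_sum (\<lambda>l b. twist r l *\<^sub>C (a * b)) (grade y)) (grade x)" for x y
  note lin = lin_intros cbilinear_left[OF cbilinear_times] cbilinear_right[OF cbilinear_times]
  have inner: "clinear (poly_sum (\<lambda>l b. twist r l *\<^sub>C (a * b)))" for r and a :: "'i so"
    by (intro poly_sum_linear lin)
  have inner_left: "clinear (\<lambda>a :: 'i so. poly_sum (\<lambda>l b. twist r l *\<^sub>C (a * b)) p)" for r p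
    unfolding poly_sum_def
    by (intro clinear_setsum clinear_scaleC_right cbilinear_left[OF cbilinear_times clinear_id])
  have m_bilinear: "cbilinear m"
  proof (rule cbilinearI)
    show "clinear (\<lambda>x. m x y)" for y
      unfolding m_def by (intro clinear_compose[OF poly_sum_linear alg_homD(1)[OF alg_hom_grade]] inner_left)
    show "clinear (\<lambda>y. m x y)" for x
      unfolding m_def poly_sum_def[of _ "grade x"]
      by (intro clinear_setsum clinear_compose[OF inner alg_homD(1)[OF alg_hom_grade]])
  qed
  have m_homog: "m x y = twist r l *\<^sub>C (x * y)" if "x \<in> homog r" "y \<in> homog l" for x y r l
    using that by (simp add: m_def homog_def poly_sum_single inner_left lin)
  define P where "P m \<longleftrightarrow> cbilinear m \<and>
     (\<forall>r1 r2 l1 l2. \<forall>x \<in> homogeneous w r1 r2. \<forall>y \<in> homogeneous w l1 l2.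
        m x y = (lam \<theta> r1 l1 * inverse (lam \<theta> r2 l2)) *\<^sub>C (x * y))" for m
  have "P m"
    unfolding P_def
    using m_bilinear m_homog[OF homogeneous_homog homogeneous_homog] by (auto simp: twist_def)
  moreover have "m1 = m2" if "P m1" "P m2" for m1 m2
  proof (intro ext)
    fix x y
    have bil: "cbilinear m1" "cbilinear m2" using that by (auto simp: P_def)
    show "m1 x y = m2 x y"
    proof (induction x rule: homogeneous_induct)
      case (add x x')
      then show ?case by (simp add: cbilinear_add[OF bil(1)] cbilinear_add[OF bil(2)])
    next
      case (homogeneous r1 r2 x)
      show ?case
      proof (induction y rule: homogeneous_induct)
        case (add y y')
        then show ?case by (simp add: cbilinear_add[OF bil(1)] cbilinear_add[OF bil(2)])
      next
        case (homogeneous l1 l2 y)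
        with \<open>x \<in> homogeneous w r1 r2\<close> that show ?case by (simp add: P_def)
      qed
    qed
  qed
  ultimately have "(THE m. P m) = m" by blast
  then have "deformed_mult w \<theta> = m" unfolding deformed_mult_def P_def .
  then show "cbilinear dmul" "x \<in> homog r \<Longrightarrow> y \<in> homog l \<Longrightarrow> dmul x y = twist r l *\<^sub>C (x * y)"
    using m_bilinear m_homog by (simp_all add: dmul_def)
qed

lemma dmul_eqI:
  assumes E: "cbilinear E" "cbilinear F"
    and eq: "\<And>r l x y. x \<in> homog r \<Longrightarrow> y \<in> homog l \<Longrightarrow> E x y = F x y"
  shows "E x y = F x y"
proof (induction x rule: homog_induct)
  case (homog r x)
  show ?case
    by (induction y rule: homog_induct) (use eq homog in \<open>simp_all add: cbilinear_add[OF E(1)] cbilinear_add[OF E(2)]\<close>)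
qed (simp add: cbilinear_add[OF E(1)] cbilinear_add[OF E(2)])

lemma dmul_one: "dmul 1 x = x" "dmul x 1 = x"
proof -
  have "dmul 1 x = x \<and> dmul x 1 = x"
    by (induction x rule: homog_induct)
      (auto simp: cbilinear_add[OF dmul_bilinear] dmul_homog[OF homog_one] dmul_homog[OF _ homog_one] scaleC_one)
  then show "dmul 1 x = x" "dmul x 1 = x" by simp_all
qed

text \<open>Since the twist is bimultiplicative, both bracketings acquire the same factor, the
  product of the twists of the three pairs in order.\<close>

lemma dmul_assoc: "dmul (dmul x y) z = dmul x (dmul y z)"
proof (induction z rule: homog_induct)
  case (homog m z)
  have "dmul (dmul x y) z = dmul x (dmul y z)"
  proof (rule dmul_eqI[of "\<lambda>x y. dmul (dmul x y) z" "\<lambda>x y. dmul x (dmul y z)" x y])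
    fix r l x y
    assume xy: "x \<in> homog r" "y \<in> homog l"
    show "dmul (dmul x y) z = dmul x (dmul y z)"
      by (simp only: dmul_homog[OF xy] dmul_homog[OF xy(2) homog] cbilinear_scale[OF dmul_bilinear]
          dmul_homog[OF homog_mult[OF xy] homog] dmul_homog[OF xy(1) homog_mult[OF xy(2) homog]]
          twist_add scaleC_scaleC mult_ac)
  qed (intro cbilinearI cbilinear_left[OF dmul_bilinear] cbilinear_right[OF dmul_bilinear] clinear_id
      clinear_compose[OF cbilinear_left[OF dmul_bilinear clinear_id]])+
  then show ?case .
qed (simp add: cbilinear_add[OF dmul_bilinear])

text \<open>The right degree of the first leg equals the left degree of the second, as in the sum of
  N_JM \<otimes> N_MK. This shared degree is what cancels in the Hopf algebra identities.\<close>

lemma coproduct_degree: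
  assumes "x \<in> homog r"
  shows "so_coproduct x \<in> cvec.span {u \<otimes> v |u v. \<exists>m. u \<in> homog (fst r, m) \<and> v \<in> homog (m, snd r)}"
proof -
  define V where "V r = cvec.span {u \<otimes> v |u v. \<exists>m. u \<in> homog (fst r, m) \<and> v \<in> homog (m, snd r)}" for r
  have base: "u \<otimes> v \<in> V (a, b)" if "u \<in> homog (a, m)" "v \<in> homog (m, b)" for u v a b m
    unfolding V_def using that by (intro cvec.span_base) auto
  have "so_coproduct x \<in> V r"
  proof (rule alg_hom_degree[OF alg_hom_so_coproduct _ _ _ _ assms])
    show V: "cvec.subspace (V r)" for r by (simp add: V_def)
    show "1 \<in> V 0"
      using base[of 1 0 0 1 0] homog_one by (simp add: one_tensor_def zero_prod_def)
    show "s * t \<in> V (r + l)" if s: "s \<in> V r" and t: "t \<in> V l" for r l s t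
    proof (rule clinear_span[OF cbilinear_left[OF cbilinear_times clinear_id] s[unfolded V_def] _ V])
      fix a assume "a \<in> {u \<otimes> v |u v. \<exists>m. u \<in> homog (fst r, m) \<and> v \<in> homog (m, snd r)}"
      then obtain u v m where a: "a = u \<otimes> v" "u \<in> homog (fst r, m)" "v \<in> homog (m, snd r)" by blast
      show "a * t \<in> V (r + l)"
      proof (rule clinear_span[OF cbilinear_right[OF cbilinear_times clinear_id] t[unfolded V_def] _ V])
        fix b assume "b \<in> {u \<otimes> v |u v. \<exists>m. u \<in> homog (fst l, m) \<and> v \<in> homog (m, snd l)}"
        then obtain u' v' m' where b: "b = u' \<otimes> v'" "u' \<in> homog (fst l, m')" "v' \<in> homog (m', snd l)" by blast
        have "(u * u') \<otimes> (v * v') \<in> V (fst r + fst l, snd r + snd l)"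
          using homog_mult[OF a(2) b(2)] homog_mult[OF a(3) b(3)] by (intro base[where m = "m + m'"]) simp_all
        then show "a * b \<in> V (r + l)" by (simp add: a(1) b(1) tensor_times plus_prod_def)
      qed
    qed
    show "so_coproduct (gen J K) \<in> V (w J, w K)" for J K
      unfolding so_coproduct_gen
      by (rule cvec.subspace_sum[OF V]) (rule base[OF homog_gen homog_gen])
  qed
  then show ?thesis by (simp add: V_def)
qed

lemma coproduct_dmul: "so_coproduct (dmul x y) = tensor_mult dmul dmul (so_coproduct x) (so_coproduct y)"
proof (rule dmul_eqI[of "\<lambda>x y. so_coproduct (dmul x y)" "\<lambda>x y. tensor_mult dmul dmul (so_coproduct x) (so_coproduct y)" x y])
  note bil = cbilinear_tensor_mult[OF dmul_bilinear dmul_bilinear]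
  note \<Delta> = alg_homD(1)[OF alg_hom_so_coproduct]
  show "cbilinear (\<lambda>x y. so_coproduct (dmul x y))"
    by (intro cbilinearI clinear_compose[OF \<Delta>] cbilinear_left[OF dmul_bilinear clinear_id] cbilinear_right[OF dmul_bilinear clinear_id])
  show "cbilinear (\<lambda>x y. tensor_mult dmul dmul (so_coproduct x) (so_coproduct y))"
    by (intro cbilinearI cbilinear_left[OF bil \<Delta>] cbilinear_right[OF bil \<Delta>])
  fix r l x y assume xy: "x \<in> homog r" "y \<in> homog l"
  have "tensor_mult dmul dmul (so_coproduct x) (so_coproduct y) = twist r l *\<^sub>C (so_coproduct x * so_coproduct y)"
  proof (rule clinear_eq_on_span[OF cbilinear_left[OF bil clinear_id] _ coproduct_degree[OF xy(1)]])
    fix a assume "a \<in> {u \<otimes> v |u v. \<exists>m. u \<in> homog (fst r, m) \<and> v \<in> homog (m, snd r)}"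
    then obtain u v m where a: "a = u \<otimes> v" "u \<in> homog (fst r, m)" "v \<in> homog (m, snd r)" by blast
    show "tensor_mult dmul dmul a (so_coproduct y) = twist r l *\<^sub>C (a * so_coproduct y)"
    proof (rule clinear_eq_on_span[OF cbilinear_right[OF bil clinear_id] _ coproduct_degree[OF xy(2)]])
      fix b assume "b \<in> {u \<otimes> v |u v. \<exists>m. u \<in> homog (fst l, m) \<and> v \<in> homog (m, snd l)}"
      then obtain u' v' m' where b: "b = u' \<otimes> v'" "u' \<in> homog (fst l, m')" "v' \<in> homog (m', snd l)" by blast
      \<comment> \<open>The middle degrees enter the first factor through an inverse and the second
        one directly.\<close>
      have "twist (fst r, m) (fst l, m') * twist (m, snd r) (m', snd l) = twist r l"
        by (simp add: twist_def)
      then show "tensor_mult dmul dmul a b = twist r l *\<^sub>C (a * b)"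
        by (simp add: a(1) b(1) tensor_mult_tensor[OF dmul_bilinear dmul_bilinear] dmul_homog[OF a(2) b(2)]
            dmul_homog[OF a(3) b(3)] tensor_times tensor_scale_left tensor_scale_right scaleC_scaleC mult.commute)
    qed (intro lin_intros cbilinear_right[OF cbilinear_times])
  qed (intro lin_intros cbilinear_left[OF cbilinear_times])
  then show "so_coproduct (dmul x y) = tensor_mult dmul dmul (so_coproduct x) (so_coproduct y)"
    by (simp add: dmul_homog[OF xy] clinear_scale[OF \<Delta>] alg_homD(3)[OF alg_hom_so_coproduct])
qed

lemma antipode_degree: "x \<in> homog r \<Longrightarrow> so_antipode x \<in> homog (- snd r, - fst r)"
proof (rule alg_hom_degree[OF alg_hom_so_antipode, where V = "\<lambda>r. homog (- snd r, - fst r)"])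
  show "x * y \<in> homog (- snd (r + l), - fst (r + l))"
    if "x \<in> homog (- snd r, - fst r)" "y \<in> homog (- snd l, - fst l)" for r l x y
    using homog_mult[OF that] by simp
  show "so_antipode (gen J K) \<in> homog (- snd (w J, w K), - fst (w J, w K))" for J K
    using homog_gen[of "conj_index K" "conj_index J"] by (simp add: so_antipode_gen weight_conj)
qed (use homog_one in \<open>simp_all add: homog_subspace zero_prod_def\<close>)

text \<open>The antipode exchanges left and right degrees, which inverts the twist; reversing the
  order of the factors inverts it again by skewness. The two negations of degrees cancel each
  other.\<close>

lemma antipode_dmul: "so_antipode (dmul x y) = dmul (so_antipode y) (so_antipode x)"
proof (rule dmul_eqI[of "\<lambda>x y. so_antipode (dmul x y)" "\<lambda>x y. dmul (so_antipode y) (so_antipode x)" x y])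
  note S = alg_homD[OF alg_hom_so_antipode]
  show "cbilinear (\<lambda>x y. so_antipode (dmul x y))"
    by (intro cbilinearI clinear_compose[OF S(1)] cbilinear_left[OF dmul_bilinear clinear_id] cbilinear_right[OF dmul_bilinear clinear_id])
  show "cbilinear (\<lambda>x y. dmul (so_antipode y) (so_antipode x))"
    by (intro cbilinearI cbilinear_left[OF dmul_bilinear S(1)] cbilinear_right[OF dmul_bilinear S(1)])
  fix r l x y assume xy: "x \<in> homog r" "y \<in> homog l"
  have "twist (- snd l, - fst l) (- snd r, - fst r) = twist r l"
    by (simp add: twist_def lam_minus lam_swap[OF skew, of "snd l"] lam_swap[OF skew, of "fst l"] mult.commute)
  then show "so_antipode (dmul x y) = dmul (so_antipode y) (so_antipode x)"
    by (simp add: dmul_homog[OF xy] dmul_homog[OF antipode_degree[OF xy(2)] antipode_degree[OF xy(1)]]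
        clinear_scale[OF S(1)] S(3) mult.commute)
qed

text \<open>The counit is nonzero only on generators N_JJ, whose left and right degrees agree, and
  agreement of the two degrees is preserved by products.\<close>

lemma counit_degree:
  assumes "x \<in> homog r" "fst r \<noteq> snd r"
  shows "so_counit x = 0"
proof -
  have "so_counit x \<in> (if fst r = snd r then UNIV else {0})"
    by (rule alg_hom_degree[OF alg_hom_so_counit _ _ _ _ assms(1), where V = "\<lambda>r. if fst r = snd r then UNIV else {0}"])
      (auto simp: cvec.subspace_single_0 so_counit_gen split: if_splits)
  with assms(2) show ?thesis by simp
qed

text \<open>On bidegree r the deformation multiplies the undeformed sum by a constant,
  \<lambda>(r_1, r_2) or its inverse, since the middle degree contributes \<lambda>(m, m) = 1. The
  counit vanishes unless r_1 = r_2, and then the constant is 1.\<close>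

lemma antipode_dmul_left: "tensor_lift (\<lambda>u v. dmul (so_antipode u) v) (so_coproduct x) = so_counit x *\<^sub>C 1"
  and antipode_dmul_right: "tensor_lift (\<lambda>u v. dmul u (so_antipode v)) (so_coproduct x) = so_counit x *\<^sub>C 1"
proof -
  note lin = lin_intros cbilinear_left[OF cbilinear_times] cbilinear_right[OF cbilinear_times]
    cbilinear_left[OF dmul_bilinear] cbilinear_right[OF dmul_bilinear]
    alg_homD(1)[OF alg_hom_so_antipode] clinear_compose[OF alg_homD(1)[OF alg_hom_so_antipode]]
  note \<Delta> = alg_homD(1)[OF alg_hom_so_coproduct]
  note \<epsilon> = alg_homD(1)[OF alg_hom_so_counit]
  have "tensor_lift (\<lambda>u v. dmul (so_antipode u) v) (so_coproduct x) = so_counit x *\<^sub>C 1 \<and>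
    tensor_lift (\<lambda>u v. dmul u (so_antipode v)) (so_coproduct x) = so_counit x *\<^sub>C 1"
  proof (induction x rule: homog_induct)
    case (add x y)
    then show ?case
      by (simp add: clinear_add[OF \<Delta>] clinear_add[OF \<epsilon>] clinear_add[OF clinear_tensor_lift] lin scaleC_add_left)
  next
    case (homog r x)
    have left: "tensor_lift (\<lambda>u v. dmul (so_antipode u) v) (so_coproduct x) =
        lam \<theta> (fst r) (snd r) *\<^sub>C tensor_lift (\<lambda>u v. so_antipode u * v) (so_coproduct x)"
    proof (rule clinear_eq_on_span[OF _ _ coproduct_degree[OF homog]])
      fix a assume "a \<in> {u \<otimes> v |u v. \<exists>m. u \<in> homog (fst r, m) \<and> v \<in> homog (m, snd r)}"
      then obtain u v m where a: "a = u \<otimes> v" "u \<in> homog (fst r, m)" "v \<in> homog (m, snd r)" by blast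
      have "twist (- m, - fst r) (m, snd r) = lam \<theta> (fst r) (snd r)"
        by (simp add: twist_def lam_minus lam_self[OF skew])
      then show "tensor_lift (\<lambda>u v. dmul (so_antipode u) v) a =
          lam \<theta> (fst r) (snd r) *\<^sub>C tensor_lift (\<lambda>u v. so_antipode u * v) a"
        using dmul_homog[OF antipode_degree[OF a(2)] a(3)] by (simp add: a(1) lin)
    qed (simp_all add: clinear_tensor_lift lin)
    have right: "tensor_lift (\<lambda>u v. dmul u (so_antipode v)) (so_coproduct x) =
        inverse (lam \<theta> (fst r) (snd r)) *\<^sub>C tensor_lift (\<lambda>u v. u * so_antipode v) (so_coproduct x)"
    proof (rule clinear_eq_on_span[OF _ _ coproduct_degree[OF homog]])
      fix a assume "a \<in> {u \<otimes> v |u v. \<exists>m. u \<in> homog (fst r, m) \<and> v \<in> homog (m, snd r)}"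
      then obtain u v m where a: "a = u \<otimes> v" "u \<in> homog (fst r, m)" "v \<in> homog (m, snd r)" by blast
      have "twist (fst r, m) (- snd r, - m) = inverse (lam \<theta> (fst r) (snd r))"
        by (simp add: twist_def lam_minus lam_self[OF skew])
      then show "tensor_lift (\<lambda>u v. dmul u (so_antipode v)) a =
          inverse (lam \<theta> (fst r) (snd r)) *\<^sub>C tensor_lift (\<lambda>u v. u * so_antipode v) a"
        using dmul_homog[OF a(2) antipode_degree[OF a(3)]] by (simp add: a(1) lin)
    qed (simp_all add: clinear_tensor_lift lin)
    show ?case
      unfolding left right so_antipode_left so_antipode_right
      using counit_degree[OF homog] by (cases "fst r = snd r") (simp_all add: lam_self[OF skew] scaleC_one)
  qed
  then show "tensor_lift (\<lambda>u v. dmul (so_antipode u) v) (so_coproduct x) = so_counit x *\<^sub>C 1"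
    "tensor_lift (\<lambda>u v. dmul u (so_antipode v)) (so_coproduct x) = so_counit x *\<^sub>C 1" by simp_all
qed

end

section \<open>The flip on the Ehresmann--Schauenburg bialgebroid\<close>

locale so_theta =
  fixes \<theta> :: "real ^ 'n::finite ^ 'n::finite"
  assumes skew: "transpose \<theta> = - \<theta>"
begin

sublocale H: deformation even_weight \<theta>
proof
  show "even_weight (conj_index i) = - even_weight i" for i :: "'n even_index" by (cases i) simp_all
qed (rule skew)

sublocale A: deformation odd_weight \<theta>
proof
  show "odd_weight (conj_index i) = - odd_weight i" for i :: "'n odd_index"
    by (cases i) (simp_all add: H.weight_conj)
qed (rule skew)

lemma mulA_eq: "mulA \<theta> = A.dmul" and mulH_eq: "mulH \<theta> = H.dmul"
  by (simp_all add: mulA_def mulH_def A.dmul_def H.dmul_def)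

lemma projection_degree:
  assumes "x \<in> A.homog r"
  shows "so_projection x \<in> H.homog r"
proof (rule A.alg_hom_degree[OF alg_hom_so_projection H.homog_subspace H.homog_one H.homog_mult _ assms])
  show "so_projection (gen J K) \<in> H.homog (odd_weight J, odd_weight K)" for J K
    using H.homog_gen H.homog_one cvec.subspace_0[OF H.homog_subspace]
    by (cases J; cases K) (simp_all add: so_projection_gen zero_prod_def)
qed

lemma projection_mul: "so_projection (mulA \<theta> x y) = mulH \<theta> (so_projection x) (so_projection y)"
  unfolding mulA_eq mulH_eq
proof (rule A.dmul_eqI[of "\<lambda>x y. so_projection (A.dmul x y)" "\<lambda>x y. H.dmul (so_projection x) (so_projection y)" x y])
  note \<pi> = alg_homD[OF alg_hom_so_projection]
  show "cbilinear (\<lambda>x y. so_projection (A.dmul x y))"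
    by (intro cbilinearI clinear_compose[OF \<pi>(1)] cbilinear_left[OF A.dmul_bilinear clinear_id]
        cbilinear_right[OF A.dmul_bilinear clinear_id])
  show "cbilinear (\<lambda>x y. H.dmul (so_projection x) (so_projection y))"
    by (intro cbilinearI cbilinear_left[OF H.dmul_bilinear \<pi>(1)] cbilinear_right[OF H.dmul_bilinear \<pi>(1)])
  show "so_projection (A.dmul x y) = H.dmul (so_projection x) (so_projection y)"
    if "x \<in> A.homog r" "y \<in> A.homog l" for r l x y
    by (simp add: A.dmul_homog[OF that] H.dmul_homog[OF projection_degree[OF that(1)] projection_degree[OF that(2)]]
        clinear_scale[OF \<pi>(1)] \<pi>(3) A.twist_def H.twist_def)
qed

lemma projection_eq: "projection \<theta> = so_projection"
  unfolding projection_def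
proof (rule the_equality)
  note \<pi> = alg_homD[OF alg_hom_so_projection]
  have proj_gen: "so_projection (gen J K) = (case (J, K) of (Some j, Some k) \<Rightarrow> gen j k | (None, None) \<Rightarrow> 1 | _ \<Rightarrow> 0)"
    for J K :: "'n odd_index"
    by (cases J; cases K) (simp_all add: so_projection_gen)
  show "clinear (so_projection :: 'n algA \<Rightarrow> 'n algH) \<and> so_projection (1 :: 'n algA) = 1 \<and>
     (\<forall>x y. so_projection (mulA \<theta> x y) = mulH \<theta> (so_projection x) (so_projection y)) \<and>
     (\<forall>J K. so_projection (gen J K :: 'n algA) =
        (case (J, K) of (Some j, Some k) \<Rightarrow> gen j k | (None, None) \<Rightarrow> 1 | _ \<Rightarrow> 0))"
    by (intro conjI allI \<pi>(1,2) projection_mul proj_gen)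
  fix f :: "'n algA \<Rightarrow> 'n algH"
  assume f: "clinear f \<and> f 1 = 1 \<and>
     (\<forall>x y. f (mulA \<theta> x y) = mulH \<theta> (f x) (f y)) \<and>
     (\<forall>J K. f (gen J K) = (case (J, K) of (Some j, Some k) \<Rightarrow> gen j k | (None, None) \<Rightarrow> 1 | _ \<Rightarrow> 0))"
  then have f_lin: "clinear f" by simp
  \<comment> \<open>Since f is multiplicative only for the deformed product, homogeneity is carried
    through the induction: it expresses the undeformed product with a generator as a scalar multiple
    of the deformed one.\<close>
  have mono: "(\<exists>r. abs_so (Poly_Mapping.single m 1) \<in> A.homog r) \<and>
      f (abs_so (Poly_Mapping.single m 1)) = so_projection (abs_so (Poly_Mapping.single m 1))" for m
  proof (induction rule: so_monomial_induct)
    case one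
    have "f 1 = so_projection 1" using f \<pi>(2) by simp
    with A.homog_one show ?case by blast
  next
    case (gen x J K)
    then obtain r where x: "x \<in> A.homog r" "f x = so_projection x" by blast
    have "f (gen J K) = so_projection (gen J K)" using f proj_gen by simp
    then have "f (mulA \<theta> (gen J K) x) = so_projection (mulA \<theta> (gen J K) x)"
      using f projection_mul x(2) by simp
    moreover have "gen J K * x = inverse (A.twist (odd_weight J, odd_weight K) r) *\<^sub>C mulA \<theta> (gen J K) x"
      by (simp add: mulA_eq A.dmul_homog[OF A.homog_gen x(1)] scaleC_scaleC scaleC_one)
    ultimately have "f (gen J K * x) = so_projection (gen J K * x)"
      by (simp only: clinear_scale[OF f_lin] clinear_scale[OF \<pi>(1)])
    then show ?case using A.homog_mult[OF A.homog_gen x(1)] by blast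
  qed
  show "f = so_projection"
  proof
    fix x :: "'n algA"
    obtain p where x: "x = abs_so p" by (rule abs_so_cases)
    show "f x = so_projection x"
      unfolding x abs_so_eq_sum[of p] clinear_sum[OF f_lin] clinear_sum[OF \<pi>(1)]
        clinear_scale[OF f_lin] clinear_scale[OF \<pi>(1)]
      using mono by simp
  qed
qed

lemma hopf_quotient: "hopf_quotient (mulA \<theta>) so_coproduct so_counit so_antipode (mulH \<theta>) so_counit so_projection"
proof (rule hopf_quotient.intro)
  show "cbilinear (mulA \<theta>)" "cbilinear (mulH \<theta>)"
    by (simp_all add: mulA_eq mulH_eq A.dmul_bilinear H.dmul_bilinear)
  show "so_coproduct (mulA \<theta> x y) = tensor_mult (mulA \<theta>) (mulA \<theta>) (so_coproduct x) (so_coproduct y)" for x y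
    by (simp add: mulA_eq A.coproduct_dmul)
  show "so_coproduct 1 = (1 :: 'n algA) \<otimes> (1 :: 'n algA)"
    by (simp add: alg_homD(2)[OF alg_hom_so_coproduct] one_tensor_def)
qed (simp_all add: mulA_eq mulH_eq A.dmul_assoc A.dmul_one H.dmul_assoc H.dmul_one so_coassoc so_counit_left
    so_counit_right A.antipode_dmul_left A.antipode_dmul_right A.antipode_dmul so_antipode_antipode
    so_coproduct_antipode alg_homD(1)[OF alg_hom_so_coproduct] alg_homD(1)[OF alg_hom_so_counit]
    alg_homD(1,2)[OF alg_hom_so_antipode] alg_homD(1,2)[OF alg_hom_so_projection] surj_so_projection
    so_counit_projection projection_mul[unfolded mulA_eq mulH_eq])

sublocale hopf_quotient "mulA \<theta>" so_coproduct so_counit so_antipode "mulH \<theta>" so_counit so_projection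
  by (rule hopf_quotient)

text \<open>The last column of the block matrix is the last unit vector, so only the summand at
  \<open>None\<close> survives.\<close>

lemma column_base: "gen J None \<in> base"
proof -
  have "coact (gen J None) = (\<Sum>M\<in>UNIV. gen J M \<otimes> so_projection (gen M None))"
    by (simp add: coact_eq tensor_lift_so_coproduct_gen lin proj_linear)
  also have "\<dots> = gen J None \<otimes> 1"
    by (simp add: sum_option so_projection_gen clinear_zero[OF clinear_tensor_right[OF clinear_id]])
  finally show ?thesis by (simp add: base_def)
qed

text \<open>The kernel is known as an ideal for the commutative product. For homogeneous x the
  product with a column generator is a multiple of an element of the required form for the deformed
  product.\<close>

sublocale hopf_galois_quotient "mulA \<theta>" so_coproduct so_counit so_antipode "mulH \<theta>" so_counit so_projection
proof
  define K where "K = cvec.span {mulA \<theta> b y - so_counit b *\<^sub>C y |b y. b \<in> base}"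
  have K: "cvec.subspace K" by (simp add: K_def)
  have base: "mulA \<theta> b y - so_counit b *\<^sub>C y \<in> K" if "b \<in> base" for b y
    unfolding K_def by (rule cvec.span_base) (use that in blast)
  have gen: "x * column_generator J \<in> K" for x J
  proof (induction x rule: A.homog_induct)
    case (add x y)
    then show ?case by (simp add: distrib_right cvec.subspace_add[OF K])
  next
    case (homog r x)
    have mul: "mulA \<theta> (gen J None) x = A.twist (odd_weight J, 0) r *\<^sub>C (gen J None * x)"
      using A.dmul_homog[OF A.homog_gen homog, of J None] by (simp add: mulA_eq)
    show ?case
    proof (cases J)
      \<comment> \<open>The corner entry has bidegree zero, so it meets no twist and the subtracted
        counit term has the right coefficient.\<close>
      case None
      have "mulA \<theta> (gen J None) x - so_counit (gen J None) *\<^sub>C x = x * column_generator J"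
        unfolding mul
        by (simp add: None zero_prod_def[symmetric] so_counit_gen scaleC_one column_generator_def algebra_simps)
      then show ?thesis using base[OF column_base, of J x] by simp
    next
      \<comment> \<open>Here the counit of the entry is zero, so dividing by the twist is
        harmless.\<close>
      case (Some j)
      have "inverse (A.twist (odd_weight J, 0) r) *\<^sub>C (mulA \<theta> (gen J None) x - so_counit (gen J None) *\<^sub>C x) =
          x * column_generator J"
        unfolding mul
        by (simp add: Some so_counit_gen scaleC_scaleC scaleC_one column_generator_def mult.commute)
      then show ?thesis using cvec.subspace_scale[OF K base[OF column_base, of J x]] by metis
    qed
  qed
  fix x assume "so_projection x = (0 :: 'n algH)"
  then have "x \<in> cvec.span {x * column_generator J |x J. True}"
    using so_projection_kernel by (simp add: column_ideal_def)
  then have "x \<in> K"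
    by (rule clinear_span[OF clinear_id _ _ K]) (use gen in blast)
  then show "x \<in> cvec.span {mulA \<theta> b y - so_counit b *\<^sub>C y |b y. b \<in> base}"
    by (simp add: K_def)
qed

section \<open>Agreement of the general constructions with the given definitions\<close>

lemma
  shows coaction_eq: "coaction \<theta> = coact"
    and sphere_alg_eq: "sphere_alg \<theta> = base"
  by (simp_all add: fun_eq_iff coaction_def coact_def sphere_alg_def base_def projection_eq)

lemma translation_eq: "translation \<theta> = transl"
proof -
  have "canonical_lift \<theta> = can_lift"
    by (simp add: canonical_lift_def can_lift_def coaction_eq)
  then have "canonical \<theta> = can"
    by (simp add: fun_eq_iff canonical_def can_def)
  then show ?thesis
    by (intro ext) (simp only: translation_def transl_def AB_tensor_def AB_def sphere_alg_eq)
qed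

lemma ES_eq: "ES \<theta> = es" and ES_mult_eq: "ES_mult \<theta> = es_mul" and ES_counit_eq: "ES_counit \<theta> = mult"
  by (simp_all add: ES_def es_def diagonal_coaction_def diag_def coaction_eq ES_mult_def es_mul_def
      ES_counit_def mult_def)

lemma ES_coproduct_eq: "ES_coproduct \<theta> = cop"
proof -
  have "AA_rel \<theta> = full_rel"
    by (simp add: AA_rel_def full_rel_def sphere_alg_eq ES_mult_eq ES_target_def ES_source_def)
  then have "coproduct_formula \<theta> = cop_formula"
    by (simp add: fun_eq_iff coproduct_formula_def cop_formula_def coaction_eq translation_eq)
  then show ?thesis
    by (simp add: fun_eq_iff ES_coproduct_def cop_def sphere_alg_eq ES_eq ES_mult_eq ES_target_def ES_source_def)
qed

end

theorem proposition5p10: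
  fixes \<theta> :: "real ^ 'n::finite ^ 'n"
  assumes skew: "transpose \<theta> = - \<theta>"
  shows "hopf_algebroid (sphere_alg \<theta>) (mulA \<theta>) 1
           (ES \<theta>) (ES_mult \<theta>) ES_one ES_source ES_target
           (ES_coproduct \<theta>) (ES_counit \<theta>) flip"
proof -
  interpret so_theta \<theta> by unfold_locales (rule skew)
  have "(ES_source :: 'n algA \<Rightarrow> _) = (\<lambda>b. b \<otimes> 1)" "(ES_target :: 'n algA \<Rightarrow> _) = (\<lambda>b. 1 \<otimes> b)"
    by (simp_all add: fun_eq_iff ES_source_def ES_target_def)
  with flip_hopf_algebroid show ?thesis
    by (simp only: sphere_alg_eq ES_eq ES_mult_eq ES_one_def ES_coproduct_eq ES_counit_eq)
qed

end
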